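(* There are unique real numbers $r_0, r_1\in(0,\frac13)$ satisfying, respectively, $$-\frac{3 r_0^5+15 r_0^4+6 r_0^3-42 r_0^2+31 r_0-13}{240 (r_0+1)}=-\frac{3 r_0^3-3 r_0^2+r_0-1}{24 (r_0+1)},$$ $$-\frac{3 r_1^5+15 r_1^4+6 r_1^3-42 r_1^2+31 r_1-13}{240 (r_1+1)}=-\frac{3 r_1^7+15 r_1^6+60 r_1^5+66 r_1^4+18 r_1^3-324 r_1^2+283 r_1-121}{2184 (r_1+1)},$$ and, to ten decimal places, $r_0\approx 0.1622776602$ and $r_1\approx 0.2317626315$. If $r=r_0$ or $r=r_1$, then for every $n\ge3$ and every admissible $I$ the set $\gamma_n(I)$ is an optimal set of $n$-means for $P$.
   Context: For $0<r<\frac13$ and $j\in\{1,2,3\}$ let $S_j(x)=rx+\frac{j-1}{2}(1-r)$, $x\in\mathbb R$. Let $P$ be the unique Borel probability measure on $\mathbb R$ with $P=\frac13\sum_{j=1}^3 P\circ S_j^{-1}$, and let $X$ be a random variable with distribution $P$. For a word $\sigma=\sigma_1\cdots\sigma_k\in\{1,2,3\}^k$ put $S_\sigma=S_{\sigma_1}\circ\cdots\circ S_{\sigma_k}$ ($S_\emptyset$ is the identity), $J_\sigma=S_\sigma([0,1])$, $a(\sigma)=S_\sigma(\frac12)$. For words $\sigma,\tau,\dots,\rho$ put $a(\sigma,\tau,\dots,\rho)=E(X\mid X\in J_\sigma\cup J_\tau\cup\cdots\cup J_\rho)$. Strings of digits such as $21$, $22$ denote words. For a finite set $\alpha\subset\mathbb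 R$ let $V(P;\alpha)=\int\min_{a\in\alpha}(x-a)^2\,dP(x)$, and $V_n=\inf\{V(P;\alpha):\alpha\subset\mathbb R,\ \mathrm{card}(\alpha)\le n\}$. A set $\alpha$ with $\mathrm{card}(\alpha)\le n$ is an optimal set of $n$-means for $P$ if $V(P;\alpha)=V_n$. For $n\ge3$ let $\ell(n)$ be the unique natural number with $3^{\ell(n)}\le n<3^{\ell(n)+1}$. A set $I\subseteq\{1,2,3\}^{\ell(n)}$ is called admissible (for $n$) if $\mathrm{card}(I)=n-3^{\ell(n)}$ when $3^{\ell(n)}\le n\le 2\cdot3^{\ell(n)}$, and $\mathrm{card}(I)=n-2\cdot3^{\ell(n)}$ when $2\cdot3^{\ell(n)}<n<3^{\ell(n)+1}$. Let $\gamma_2=\{a(1,21),a(22,23,3)\}$, $\gamma_3=\{a(1),a(2),a(3)\}$. For $n\ge3$ and admissible $I$, $$\gamma_n(I)=\{a(\omega):\omega\in\{1,2,3\}^{\ell(n)}\setminus I\}\cup\bigcup_{\omega\in I}S_\omega(\gamma_2)\quad\text{if }3^{\ell(n)}\le n\le2\cdot3^{\ell(n)},$$ $$\gamma_n(I)=\bigcup_{\omega\in\{1,2,3\}^{\ell(n)}\setminus I}S_\omega(\gamma_2)\cup\bigcup_{\omega\in I}S_\omega(\gamma_3)\quad\text{if }2\cdot3^{\ell(n)}<n<3^{\ell(n)+1}.$$ *)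

theory Defs
  imports "HOL-Probability.Probability"
begin

definition S :: "real \<Rightarrow> nat \<Rightarrow> real \<Rightarrow> real" where
  "S r j x = r * x + (real j - 1) / 2 * (1 - r)"

text \<open>Words over \<open>{1,2,3}\<close> are lists of natural numbers, leftmost letter first.\<close>

definition words :: "nat \<Rightarrow> nat list set" where
  "words k = {\<sigma>. length \<sigma> = k \<and> set \<sigma> \<subseteq> {1, 2, 3}}"

primrec S_word :: "real \<Rightarrow> nat list \<Rightarrow> real \<Rightarrow> real" where
  "S_word r [] = id"
| "S_word r (j # \<sigma>) = S r j \<circ> S_word r \<sigma>"

definition J :: "real \<Rightarrow> nat list \<Rightarrow> real set" where
  "J r \<sigma> = S_word r \<sigma> ` {0..1}"

text \<open>\<open>P\<close> is a Borel probability measure on the line with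
  \<open>P = (1/3) * (\<Sum>j. P \<circ> S\<^sub>j\<^sup>-\<^sup>1)\<close>. For \<open>0 < r < 1/3\<close> there is exactly one such measure.\<close>

definition self_similar_measure :: "real \<Rightarrow> real measure \<Rightarrow> bool" where
  "self_similar_measure r P \<longleftrightarrow>
     prob_space P \<and> sets P = sets borel \<and>
     (\<forall>A\<in>sets borel. measure P A = 1 / 3 * (\<Sum>j\<in>{1, 2, 3}. measure P (S r j -` A)))"

definition a_word :: "real \<Rightarrow> nat list \<Rightarrow> real" where
  "a_word r \<sigma> = S_word r \<sigma> (1 / 2)"

text \<open>The elementary conditional expectation \<open>E(X | X \<in> A) = E(X; X \<in> A) / P(A)\<close> for a random
  variable \<open>X\<close> with distribution \<open>P\<close>, and its instance where \<open>A\<close> is the union of the \<open>J\<^sub>\<sigma>\<close> for \<open>\<sigma>\<close>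
  in a finite set \<open>W\<close> of words.\<close>

definition cond_mean :: "real measure \<Rightarrow> real set \<Rightarrow> real" where
  "cond_mean P A = (LINT x:A|P. x) / measure P A"

definition a_words :: "real \<Rightarrow> real measure \<Rightarrow> nat list set \<Rightarrow> real" where
  "a_words r P W = cond_mean P (\<Union>\<sigma>\<in>W. J r \<sigma>)"

text \<open>The minimum, hence the distortion, is meaningful for finite nonempty sets only, so
  competitors are required to be nonempty. The self-similar measures are concentrated on
  \<open>[0,1]\<close>, so the integrand below is integrable for them.\<close>

definition distortion :: "real measure \<Rightarrow> real set \<Rightarrow> real" where
  "distortion P \<alpha> = (LINT x|P. Min ((\<lambda>a. (x - a)\<^sup>2) ` \<alpha>))"

definition quant_error :: "real measure \<Rightarrow> nat \<Rightarrow> real" where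
  "quant_error P n =
     Inf {distortion P \<alpha> |\<alpha>. finite \<alpha> \<and> \<alpha> \<noteq> {} \<and> card \<alpha> \<le> n}"

definition optimal_n_means :: "real measure \<Rightarrow> nat \<Rightarrow> real set \<Rightarrow> bool" where
  "optimal_n_means P n \<alpha> \<longleftrightarrow>
     finite \<alpha> \<and> \<alpha> \<noteq> {} \<and> card \<alpha> \<le> n \<and> distortion P \<alpha> = quant_error P n"

definition level :: "nat \<Rightarrow> nat" where
  "level n = (THE l. 3 ^ l \<le> n \<and> n < 3 ^ (l + 1))"

definition admissible :: "nat \<Rightarrow> nat list set \<Rightarrow> bool" where
  "admissible n I \<longleftrightarrow>
     I \<subseteq> words (level n) \<and>
     card I = (if n \<le> 2 * 3 ^ level n then n - 3 ^ level n else n - 2 * 3 ^ level n)"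

definition gamma2 :: "real \<Rightarrow> real measure \<Rightarrow> real set" where
  "gamma2 r P = {a_words r P {[1], [2, 1]}, a_words r P {[2, 2], [2, 3], [3]}}"

definition gamma3 :: "real \<Rightarrow> real set" where
  "gamma3 r = {a_word r [1], a_word r [2], a_word r [3]}"

definition gamma_set :: "real \<Rightarrow> real measure \<Rightarrow> nat \<Rightarrow> nat list set \<Rightarrow> real set" where
  "gamma_set r P n I =
     (if n \<le> 2 * 3 ^ level n
      then a_word r ` (words (level n) - I) \<union> (\<Union>\<omega>\<in>I. S_word r \<omega> ` gamma2 r P)
      else (\<Union>\<omega>\<in>words (level n) - I. S_word r \<omega> ` gamma2 r P) \<union>
           (\<Union>\<omega>\<in>I. S_word r \<omega> ` gamma3 r))"

definition eq_r0 :: "real \<Rightarrow> bool" where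
  "eq_r0 r \<longleftrightarrow>
     - ((3 * r^5 + 15 * r^4 + 6 * r^3 - 42 * r^2 + 31 * r - 13) / (240 * (r + 1)))
     = - ((3 * r^3 - 3 * r^2 + r - 1) / (24 * (r + 1)))"

definition eq_r1 :: "real \<Rightarrow> bool" where
  "eq_r1 r \<longleftrightarrow>
     - ((3 * r^5 + 15 * r^4 + 6 * r^3 - 42 * r^2 + 31 * r - 13) / (240 * (r + 1)))
     = - ((3 * r^7 + 15 * r^6 + 60 * r^5 + 66 * r^4 + 18 * r^3 - 324 * r^2 + 283 * r - 121)
          / (2184 * (r + 1)))"

end

theory Submission
  imports Defs
begin

text \<open>
  Write \<open>V\<close> for the variance of \<open>P\<close>, \<open>f(1) = V\<close>, \<open>f(2) = V - K\<close> with \<open>K = ((1 - r) (3 + r))\<^sup>2 / 80\<close> and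
  \<open>f(3) = r\<^sup>2 V\<close>, the distortions of one point, \<open>\<gamma>\<^sub>2\<close> and \<open>\<gamma>\<^sub>3\<close>. The values of the sets \<open>\<gamma>\<^sub>n(I)\<close> form a
  convex piecewise linear function of \<open>n\<close>, so the lower bound is proved in Lagrangian form:
  \<open>distortion \<beta> + (r\<^sup>2 / 3)\<^sup>l \<lambda> |\<beta>| \<ge> r\<^sup>2\<^sup>l \<Phi>\<close> for every finite \<open>\<beta>\<close> and \<open>l\<close>, where \<open>\<lambda>\<close> is one of the two
  slopes \<open>f(1) - f(2)\<close>, \<open>f(2) - f(3)\<close> and \<open>\<Phi> = min\<^sub>n (f(n) + \<lambda> n)\<close>.

  The induction on \<open>l\<close> restricts \<open>\<beta>\<close> to the points serving each of \<open>J\<^sub>1, J\<^sub>2, J\<^sub>3\<close>. It only fails to be immediate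
  when a point serves two neighbouring pieces and is counted twice; but such a point is far from one of the
  two pieces, no other point is closer to the facing end, and the cost of this outweighs \<open>\<lambda>\<close>.

  Two points: with \<open>p = P(A)\<close> and \<open>m = \<integral>\<^sub>A (1/2 - x) dP\<close> for the cell \<open>A\<close> of the first point, the
  distortion is at least \<open>V - m\<^sup>2 / (p (1 - p))\<close>. The pairs \<open>(p, m)\<close> lie below the lines
  \<open>m = \<integral> max 0 (x - y) dP(y) + (1/2 - x) p\<close>, and the polygon cut out by finitely many of them lies inside
  the ellipse \<open>m\<^sup>2 = K p (1 - p)\<close>. Both \<open>r\<^sub>0\<close> and \<open>r\<^sub>1\<close> are values of \<open>r\<close> at which this polygon
  touches the ellipse in two vertices.
\<close>

section \<open>Squared distance to a finite set\<close>

text \<open>\<open>K\<close> is the gain of splitting the words into 1, 21 and 22, 23, 3, that is,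
  of cutting at mass \<open>p = 4/9\<close>. The competing cuts are at \<open>p = 1/3\<close> (after
  1) and at \<open>p = 13/27\<close> (after 1, 21, 221). At \<open>r0\<close> the cut at 1/3, at
  \<open>r1\<close> the cut at 13/27 is exactly as good, so there is no margin at these vertices.
  The debt \<open>lam\<close> of a doubly counted point is split by a charge \<open>e\<close>: its
  distances \<open>s\<close>, \<open>t\<close> from the two facing ends add up to
  \<open>gap\<close>, and \<open>e s + e t >= lam\<close> is all that is required. At
  \<open>r0\<close>, \<open>gap\<close> is about 1.58 and the more distant piece can pay everything.
  At \<open>r1\<close> it is about 0.66, \<open>far_cost (gap / 2)\<close> is only about 0.017, too
  little for that argument in the first step; there the charge is linear in the distance, and pairs
  of points need estimates of their own. From the second step on \<Phi> carries a factor r^2 while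
  the cost of a far point does not, and the simple charge suffices for both ratios. The second slope
  presupposes the optimal three-point value. It comes from the first slope at \<open>l = 1\<close>,
  since r^2 (V + K) - r^2 K = r^2 V.\<close>

definition sqdist :: "real set \<Rightarrow> real \<Rightarrow> real" where
  "sqdist \<alpha> x = Min ((\<lambda>a. (x - a)\<^sup>2) ` \<alpha>)"

lemma distortion_sqdist: "distortion P \<alpha> = (LINT x|P. sqdist \<alpha> x)"
  by (simp add: distortion_def sqdist_def)

lemma sqdist_le: "finite \<alpha> \<Longrightarrow> a \<in> \<alpha> \<Longrightarrow> sqdist \<alpha> x \<le> (x - a)\<^sup>2"
  by (simp add: sqdist_def)

lemma sqdist_ge: "finite \<alpha> \<Longrightarrow> \<alpha> \<noteq> {} \<Longrightarrow> (\<And>a. a \<in> \<alpha> \<Longrightarrow> c \<le> (x - a)\<^sup>2) \<Longrightarrow> c \<le> sqdist \<alpha> x"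
  by (simp add: sqdist_def)

lemma sqdist_nonneg: "finite \<alpha> \<Longrightarrow> \<alpha> \<noteq> {} \<Longrightarrow> 0 \<le> sqdist \<alpha> x"
  by (rule sqdist_ge) auto

lemma sqdist_attained:
  assumes "finite \<alpha>" "\<alpha> \<noteq> {}"
  obtains a where "a \<in> \<alpha>" "sqdist \<alpha> x = (x - a)\<^sup>2" "\<And>b. b \<in> \<alpha> \<Longrightarrow> \<bar>x - a\<bar> \<le> \<bar>x - b\<bar>"
proof -
  have "sqdist \<alpha> x \<in> (\<lambda>a. (x - a)\<^sup>2) ` \<alpha>"
    unfolding sqdist_def using assms by (intro Min_in) auto
  then obtain a where a: "a \<in> \<alpha>" "sqdist \<alpha> x = (x - a)\<^sup>2" by auto
  have "\<bar>x - a\<bar> \<le> \<bar>x - b\<bar>" if "b \<in> \<alpha>" for b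
    using sqdist_le[OF assms(1) that, of x] a(2) by (simp add: abs_le_square_iff)
  with a that show thesis by blast
qed

lemma sqdist_eqI:
  assumes "finite \<alpha>" "a \<in> \<alpha>" "\<And>b. b \<in> \<alpha> \<Longrightarrow> \<bar>x - a\<bar> \<le> \<bar>x - b\<bar>"
  shows "sqdist \<alpha> x = (x - a)\<^sup>2"
  unfolding sqdist_def using assms by (intro Min_eqI) (auto simp: abs_le_square_iff)

lemma sqdist_insert: "finite \<alpha> \<Longrightarrow> \<alpha> \<noteq> {} \<Longrightarrow> sqdist (insert a \<alpha>) x = min ((x - a)\<^sup>2) (sqdist \<alpha> x)"
  by (simp add: sqdist_def)

lemma sqdist_singleton [simp]: "sqdist {a} x = (x - a)\<^sup>2"
  by (simp add: sqdist_def)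

lemma continuous_sqdist:
  assumes "finite \<alpha>" "\<alpha> \<noteq> {}"
  shows "continuous_on UNIV (sqdist \<alpha>)"
  using assms
proof (induction \<alpha> rule: finite_ne_induct)
  case (singleton a)
  have "sqdist {a} = (\<lambda>x. (x - a)\<^sup>2)" by (simp add: fun_eq_iff)
  then show ?case by (auto intro!: continuous_intros)
next
  case (insert a \<alpha>)
  have "sqdist (insert a \<alpha>) = (\<lambda>x. min ((x - a)\<^sup>2) (sqdist \<alpha> x))"
    using insert by (simp add: fun_eq_iff sqdist_insert)
  then show ?case using insert by (auto intro!: continuous_intros)
qed

text \<open>\<open>sqdist \<alpha> x - x\<^sup>2\<close> is a minimum of affine functions, hence lies above its chords.\<close>

lemma sqdist_concave:
  assumes "finite \<alpha>" "\<alpha> \<noteq> {}" "0 \<le> x" "x \<le> 1"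
  shows "(1 - x) * sqdist \<alpha> l + x * sqdist \<alpha> u - (u - l)\<^sup>2 * (x * (1 - x)) \<le> sqdist \<alpha> (l + (u - l) * x)"
proof (rule sqdist_ge[OF assms(1,2)])
  fix a assume a: "a \<in> \<alpha>"
  have "(1 - x) * sqdist \<alpha> l + x * sqdist \<alpha> u \<le> (1 - x) * (l - a)\<^sup>2 + x * (u - a)\<^sup>2"
    using assms sqdist_le[OF assms(1) a] by (intro add_mono mult_left_mono) auto
  then show "(1 - x) * sqdist \<alpha> l + x * sqdist \<alpha> u - (u - l)\<^sup>2 * (x * (1 - x)) \<le> (l + (u - l) * x - a)\<^sup>2"
    by (simp add: power2_eq_square algebra_simps)
qed

section \<open>Integration against a self-similar measure\<close>

lemma continuous_S [continuous_intros]: "continuous_on A f \<Longrightarrow> continuous_on A (\<lambda>x. S r j (f x))"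
  unfolding S_def by (intro continuous_intros)

lemma measurable_S [measurable]: "S r j \<in> borel_measurable borel"
  by (intro borel_measurable_continuous_onI continuous_intros)

lemma S_simps: "S r 1 x = r * x" "S r (Suc 0) x = r * x" "S r 2 x = r * x + (1 - r) / 2" "S r 3 x = r * x + (1 - r)"
  by (simp_all add: S_def)

lemma S_fun: "S r 1 = (\<lambda>x. r * x)" "S r (Suc 0) = (\<lambda>x. r * x)" "S r 2 = (\<lambda>x. r * x + (1 - r) / 2)" "S r 3 = (\<lambda>x. r * x + (1 - r))"
  by (simp_all add: S_simps fun_eq_iff)

text \<open>A bound is asked on [0,1] only, where \<open>P\<close> lives almost surely. The class
  contains continuous functions and indicators, is closed under products and under composition with
  the maps \<open>S r j\<close>, and its members are integrable.\<close>

definition unit_bounded :: "(real \<Rightarrow> real) \<Rightarrow> bool" where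
  "unit_bounded f \<longleftrightarrow> f \<in> borel_measurable borel \<and> (\<exists>C. \<forall>x\<in>{0..1}. \<bar>f x\<bar> \<le> C)"

lemma unit_boundedI: "f \<in> borel_measurable borel \<Longrightarrow> (\<And>x. x \<in> {0..1} \<Longrightarrow> \<bar>f x\<bar> \<le> C) \<Longrightarrow> unit_bounded f"
  unfolding unit_bounded_def by blast

lemma unit_bounded_continuous:
  assumes "continuous_on UNIV f"
  shows "unit_bounded f"
proof -
  have "bounded (f ` {0..1})"
    using assms by (intro compact_imp_bounded compact_continuous_image continuous_on_subset[OF assms]) auto
  then obtain C where "\<forall>y\<in>f ` {0..1}. \<bar>y\<bar> \<le> C" by (auto simp: bounded_iff)
  then show ?thesis
    using assms by (intro unit_boundedI[of _ C] borel_measurable_continuous_onI) auto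
qed

lemma unit_bounded_mult:
  assumes "unit_bounded f" "unit_bounded g"
  shows "unit_bounded (\<lambda>x. f x * g x)"
proof -
  obtain C D where "\<forall>x\<in>{0..1}. \<bar>f x\<bar> \<le> C" "\<forall>x\<in>{0..1}. \<bar>g x\<bar> \<le> D"
    using assms by (auto simp: unit_bounded_def)
  moreover have "\<bar>f x * g x\<bar> \<le> C * D" if "\<bar>f x\<bar> \<le> C" "\<bar>g x\<bar> \<le> D" for x
    using that by (simp add: abs_mult mult_mono')
  ultimately show ?thesis
    using assms by (intro unit_boundedI[of _ "C * D"]) (auto simp: unit_bounded_def)
qed

lemma unit_bounded_indicator: "A \<in> sets borel \<Longrightarrow> unit_bounded (indicator A)"
  by (intro unit_boundedI[of _ 1]) (auto simp: indicator_def)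

locale self_similar =
  fixes r :: real and P :: "real measure"
  assumes r_pos: "0 < r" and r_less: "r < 1 / 3" and self_similar: "self_similar_measure r P"
begin

sublocale prob_space P
  using self_similar by (simp add: self_similar_measure_def)

lemma sets_P [measurable_cong, simp]: "sets P = sets borel"
  using self_similar by (simp add: self_similar_measure_def)

lemma space_P [simp]: "space P = UNIV"
  using sets_eq_imp_space_eq[OF sets_P] by simp

lemma prob_UNIV [simp]: "measure P UNIV = 1"
  using prob_space by simp

lemma measure_P: "A \<in> sets borel \<Longrightarrow> measure P A = 1 / 3 * (\<Sum>j\<in>{1,2,3}. measure P (S r j -` A))"
  using self_similar by (simp add: self_similar_measure_def)

lemma S_unit:
  assumes "j \<in> {1,2,3}" "x \<in> {0..1}"
  shows "S r j x \<in> {0..1}"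
proof -
  have "0 \<le> r * x" "r * x \<le> r * 1"
    using assms r_pos by (auto intro: mult_left_mono)
  moreover define w where "w = (real j - 1) / 2 * (1 - r)"
  moreover have "0 \<le> (real j - 1) / 2 * (1 - r)" "(real j - 1) / 2 * (1 - r) \<le> 1 * (1 - r)"
    using assms r_less by (auto intro: mult_right_mono)
  ultimately have "0 \<le> r * x" "r * x \<le> r" "0 \<le> w" "w \<le> 1 - r" "S r j x = r * x + w"
    by (simp_all only: S_def mult_1_right mult_1_left)
  then show ?thesis by simp
qed

text \<open>Each \<open>S r j\<close> shrinks the excess of |x - 1/2| over 1/2 at least by the
  factor \<open>r\<close>. Hence the mass at excess beyond \<open>e\<close> is at most the mass at
  excess beyond \<open>e / r ^ k\<close> for every \<open>k\<close>, which tends to 0.\<close>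

lemma AE_unit: "AE x in P. x \<in> {0..1}"
proof -
  define m where "m t = measure P {x. t < \<bar>x - 1/2\<bar>}" for t :: real
  have [measurable]: "{x. t < \<bar>x - 1/2\<bar>} \<in> sets borel" for t :: real by measurable
  have m_step: "m (1/2 + e) \<le> m (1/2 + e / r)" for e
  proof -
    have "S r j -` {x. 1/2 + e < \<bar>x - 1/2\<bar>} \<subseteq> {x. 1/2 + e / r < \<bar>x - 1/2\<bar>}" if "j \<in> {1,2,3}" for j
    proof
      fix x assume "x \<in> S r j -` {x. 1/2 + e < \<bar>x - 1/2\<bar>}"
      then have "1/2 + e < \<bar>S r j x - 1/2\<bar>" by simp
      moreover have "\<bar>S r j x - 1/2\<bar> \<le> r * \<bar>x - 1/2\<bar> + (1 - r) / 2"
      proof -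
        have "S r j x - 1/2 = r * (x - 1/2) + (real j - 2) / 2 * (1 - r)"
          by (simp add: S_def algebra_simps diff_divide_distrib)
        moreover have "\<bar>(real j - 2) / 2 * (1 - r)\<bar> \<le> (1 - r) / 2"
          using that r_less r_pos by auto
        moreover have "\<bar>r * (x - 1/2)\<bar> = r * \<bar>x - 1/2\<bar>"
          using r_pos by (simp add: abs_mult)
        ultimately show ?thesis by linarith
      qed
      ultimately have "r / 2 + e < r * \<bar>x - 1/2\<bar>" by argo
      then show "x \<in> {x. 1/2 + e / r < \<bar>x - 1/2\<bar>}" using r_pos by (simp add: field_simps)
    qed
    then have "measure P (S r j -` {x. 1/2 + e < \<bar>x - 1/2\<bar>}) \<le> m (1/2 + e / r)" if "j \<in> {1,2,3}" for j
      unfolding m_def using that by (intro finite_measure_mono) auto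
    then show ?thesis
      unfolding m_def[of "1/2 + e"] using sum_mono[of "{1,2,3}" "\<lambda>j. measure P (S r j -` {x. 1/2 + e < \<bar>x - 1/2\<bar>})" "\<lambda>_. m (1/2 + e / r)"]
      by (subst measure_P) auto
  qed
  have m_pow: "m (1/2 + e) \<le> m (1/2 + e / r ^ k)" for e k
  proof (induction k)
    case (Suc k)
    then show ?case using m_step[of "e / r ^ k"] by (simp add: field_simps)
  qed simp
  have lim: "(\<lambda>k::nat. m (real k)) \<longlonglongrightarrow> 0"
  proof -
    have "decseq (\<lambda>k::nat. {x::real. real k < \<bar>x - 1/2\<bar>})"
      by (auto simp: decseq_def)
    then have "(\<lambda>k::nat. measure P {x::real. real k < \<bar>x - 1/2\<bar>}) \<longlonglongrightarrow> measure P (\<Inter>k::nat. {x::real. real k < \<bar>x - 1/2\<bar>})"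
      by (intro finite_Lim_measure_decseq) auto
    moreover have "(\<Inter>k::nat. {x::real. real k < \<bar>x - 1/2\<bar>}) = {}"
    proof -
      have "x \<notin> (\<Inter>k::nat. {x::real. real k < \<bar>x - 1/2\<bar>})" for x
      proof -
        obtain k :: nat where "\<bar>x - 1/2\<bar> < real k" using reals_Archimedean2 by blast
        then have "x \<notin> {x. real k < \<bar>x - 1/2\<bar>}" by simp
        then show ?thesis by blast
      qed
      then show ?thesis by blast
    qed
    ultimately show ?thesis by (simp add: m_def)
  qed
  have zero: "m (1/2 + e) = 0" if "e > 0" for e
  proof -
    have "m (1/2 + e) \<le> m (real k)" for k :: nat
    proof -
      obtain n where n: "real k / e < (1 / r) ^ n"
        using real_arch_pow[of "1/r" "real k / e"] r_pos r_less by auto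
      then have "real k < e / r ^ n"
        using that r_pos by (simp add: field_simps power_one_over)
      then have "real k \<le> 1/2 + e / r ^ n" by simp
      then have "m (1/2 + e / r ^ n) \<le> m (real k)"
        unfolding m_def by (intro finite_measure_mono) auto
      with m_pow[of e n] show ?thesis by linarith
    qed
    then have "m (1/2 + e) \<le> 0"
      by (intro LIMSEQ_le_const[OF lim]) auto
    then show ?thesis unfolding m_def using measure_nonneg[of P "{x. 1/2 + e < \<bar>x - 1/2\<bar>}"] by linarith
  qed
  have "AE x in P. \<forall>n::nat. \<not> 1/2 + 1 / Suc n < \<bar>x - 1/2\<bar>"
  proof (subst AE_all_countable, intro allI)
    fix n :: nat
    have "measure P {x. 1/2 + 1 / Suc n < \<bar>x - 1/2\<bar>} = 0"
      using zero[of "1 / Suc n"] by (simp add: m_def)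
    then show "AE x in P. \<not> 1/2 + 1 / Suc n < \<bar>x - 1/2\<bar>"
      by (intro AE_I[of _ _ "{x. 1/2 + 1 / Suc n < \<bar>x - 1/2\<bar>}"])
         (auto simp: emeasure_eq_measure)
  qed
  then show ?thesis
  proof (rule AE_mp, intro AE_I2 impI)
    fix x :: real assume *: "\<forall>n::nat. \<not> 1/2 + 1 / Suc n < \<bar>x - 1/2\<bar>"
    have "\<bar>x - 1/2\<bar> \<le> 1/2"
    proof (rule ccontr)
      assume "\<not> \<bar>x - 1/2\<bar> \<le> 1/2"
      then obtain n where "inverse (real (Suc n)) < \<bar>x - 1/2\<bar> - 1/2"
        using reals_Archimedean[of "\<bar>x - 1/2\<bar> - 1/2"] by auto
      with * show False by (simp add: inverse_eq_divide) (metis add.commute less_diff_eq not_less)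
    qed
    then show "x \<in> {0..1}" by (auto simp: abs_if split: if_splits)
  qed
qed

lemma nn_integral_self_similar:
  assumes "f \<in> borel_measurable borel"
  shows "(\<integral>\<^sup>+x. f x \<partial>P) = ennreal (1/3) * (\<Sum>j\<in>{1,2,3}. \<integral>\<^sup>+x. f (S r j x) \<partial>P)"
  using assms
proof (induction f rule: borel_measurable_induct)
  case (cong f g)
  then have "f = g" by (auto simp: fun_eq_iff)
  with cong show ?case by simp
next
  case (set A)
  have [measurable]: "S r j -` A \<in> sets borel" for j
    using measurable_sets[OF measurable_S set, of r j] by simp
  have "(\<integral>\<^sup>+x. indicator A (S r j x) \<partial>P) = ennreal (measure P (S r j -` A))" for j
  proof -
    have "(\<integral>\<^sup>+x. indicator A (S r j x) \<partial>P) = (\<integral>\<^sup>+x. indicator (S r j -` A) x \<partial>P)"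
      by (simp add: indicator_def)
    then show ?thesis by (simp add: emeasure_eq_measure)
  qed
  moreover have "(\<integral>\<^sup>+x. indicator A x \<partial>P) = ennreal (measure P A)"
    using set by (simp add: emeasure_eq_measure)
  ultimately show ?case
    using measure_P[OF set] by (simp add: ennreal_plus[symmetric] ennreal_mult[symmetric] del: ennreal_plus)
next
  case (mult u c)
  then show ?case
    by (simp add: nn_integral_cmult distrib_left mult_ac)
next
  case (add u v)
  then show ?case
    by (simp add: nn_integral_add distrib_left add_ac)
next
  case (seq U)
  have U [measurable]: "U i \<in> borel_measurable borel" for i using seq by auto
  have inc: "incseq (\<lambda>i x. U i (S r j x))" for j
    using seq(3) by (auto simp: incseq_def le_fun_def)
  have eq: "(\<integral>\<^sup>+x. (SUP i. U i) (S r j x) \<partial>P) = (SUP i. \<integral>\<^sup>+x. U i (S r j x) \<partial>P)" for j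
    using nn_integral_monotone_convergence_SUP[OF inc, where M = P] by (simp add: SUP_apply image_comp)
  have inc': "incseq (\<lambda>i. \<integral>\<^sup>+x. U i (S r j x) \<partial>P)" for j
    using inc[of j] by (auto simp: incseq_def le_fun_def intro!: nn_integral_mono)
  have "(\<integral>\<^sup>+x. (SUP i. U i) x \<partial>P) = (SUP i. \<integral>\<^sup>+x. U i x \<partial>P)"
    using nn_integral_monotone_convergence_SUP[OF seq(3), where M = P] by (simp add: SUP_apply image_comp)
  also have "\<dots> = (SUP i. ennreal (1/3) * (\<Sum>j\<in>{1,2,3}. \<integral>\<^sup>+x. U i (S r j x) \<partial>P))"
    using seq by simp
  also have "\<dots> = ennreal (1/3) * (SUP i. (\<Sum>j\<in>{1,2,3}. \<integral>\<^sup>+x. U i (S r j x) \<partial>P))"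
    by (rule SUP_mult_left_ennreal[symmetric])
  also have "(SUP i. (\<Sum>j\<in>{1,2,3}. \<integral>\<^sup>+x. U i (S r j x) \<partial>P)) = (\<Sum>j\<in>{1,2,3}. SUP i. \<integral>\<^sup>+x. U i (S r j x) \<partial>P)"
    by (intro ennreal_SUP_sum inc')
  finally show ?case unfolding eq .
qed

lemma integrable_unit_bounded: "unit_bounded f \<Longrightarrow> integrable P f"
proof -
  assume "unit_bounded f"
  then obtain C where f: "f \<in> borel_measurable borel" "\<forall>x\<in>{0..1}. \<bar>f x\<bar> \<le> C"
    by (auto simp: unit_bounded_def)
  show ?thesis
  proof (rule integrable_const_bound[where B = C])
    show "AE x in P. norm (f x) \<le> C" using AE_unit f(2) by auto
  qed (use f in measurable)
qed

lemma integrable_continuous: "continuous_on UNIV f \<Longrightarrow> integrable P (f :: real \<Rightarrow> real)"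
  by (intro integrable_unit_bounded unit_bounded_continuous)

lemma unit_bounded_S: "unit_bounded f \<Longrightarrow> j \<in> {1,2,3} \<Longrightarrow> unit_bounded (\<lambda>x. f (S r j x))"
proof -
  assume "unit_bounded f" and j: "j \<in> {1,2,3}"
  then obtain C where f: "f \<in> borel_measurable borel" "\<forall>x\<in>{0..1}. \<bar>f x\<bar> \<le> C"
    by (auto simp: unit_bounded_def)
  show ?thesis
    using f(1) S_unit[OF j] f(2) by (intro unit_boundedI[of _ C]) auto
qed

lemma integral_self_similar:
  assumes f: "unit_bounded f"
  shows "(LINT x|P. f x) = (\<Sum>j\<in>{1,2,3}. LINT x|P. f (S r j x)) / 3"
proof -
  obtain C where [measurable]: "f \<in> borel_measurable borel" and C: "\<forall>x\<in>{0..1}. \<bar>f x\<bar> \<le> C"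
    using f by (auto simp: unit_bounded_def)
  have int: "integrable P f" "\<And>j. j \<in> {1,2,3} \<Longrightarrow> integrable P (\<lambda>x. f (S r j x))"
    using f unit_bounded_S by (auto intro: integrable_unit_bounded)
  \<comment> \<open>Adding the bound \<open>C\<close> makes the integrand nonnegative almost
    everywhere, which reduces the claim to nonnegative integrals.\<close>
  have AE: "AE x in P. 0 \<le> f x + C" using AE_unit
  proof (rule AE_mp, intro AE_I2 impI)
    fix x assume "x \<in> {0..1::real}" then have "\<bar>f x\<bar> \<le> C" using C by blast
    then show "0 \<le> f x + C" by linarith
  qed
  have AES: "AE x in P. 0 \<le> f (S r j x) + C" if "j \<in> {1,2,3}" for j using AE_unit
  proof (rule AE_mp, intro AE_I2 impI)
    fix x assume "x \<in> {0..1::real}" then have "\<bar>f (S r j x)\<bar> \<le> C" using C S_unit[OF that] by blast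
    then show "0 \<le> f (S r j x) + C" by linarith
  qed
  have "ennreal (LINT x|P. f x + C) = (\<integral>\<^sup>+x. ennreal (f x + C) \<partial>P)"
    using int AE by (subst nn_integral_eq_integral) auto
  also have "\<dots> = ennreal (1/3) * (\<Sum>j\<in>{1,2,3}. \<integral>\<^sup>+x. ennreal (f (S r j x) + C) \<partial>P)"
    by (rule nn_integral_self_similar) measurable
  also have "(\<Sum>j\<in>{1,2,3}. \<integral>\<^sup>+x. ennreal (f (S r j x) + C) \<partial>P)
      = (\<Sum>j\<in>{1,2,3}. ennreal (LINT x|P. f (S r j x) + C))"
    using int AES by (intro sum.cong refl nn_integral_eq_integral) auto
  also have "\<dots> = ennreal (\<Sum>j\<in>{1,2,3}. LINT x|P. f (S r j x) + C)"
    using AES by (intro sum_ennreal integral_nonneg_AE) auto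
  also have "ennreal (1/3) * \<dots> = ennreal ((\<Sum>j\<in>{1,2,3}. LINT x|P. f (S r j x) + C) / 3)"
    using AES by (subst ennreal_mult[symmetric]) (auto intro!: sum_nonneg integral_nonneg_AE simp del: sum.insert)
  finally have eq: "ennreal (LINT x|P. f x + C) = ennreal ((\<Sum>j\<in>{1,2,3}. LINT x|P. f (S r j x) + C) / 3)" .
  have "0 \<le> (LINT x|P. f x + C)" "0 \<le> (\<Sum>j\<in>{1,2,3}. LINT x|P. f (S r j x) + C)"
    using AE by (auto intro!: sum_nonneg integral_nonneg_AE AES simp del: sum.insert)
  with eq have "(LINT x|P. f x + C) = (\<Sum>j\<in>{1,2,3}. LINT x|P. f (S r j x) + C) / 3"
    by (subst (asm) ennreal_inj) auto
  moreover have "(LINT x|P. f x + C) = (LINT x|P. f x) + C"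
    using int by (simp add: prob_space)
  moreover have "(\<Sum>j\<in>{1,2,3}. LINT x|P. f (S r j x) + C) = (\<Sum>j\<in>{1,2,3}. (LINT x|P. f (S r j x)) + C)"
    using int by (intro sum.cong refl) (simp add: prob_space)
  ultimately show ?thesis by simp
qed

lemma integral_mono_unit:
  assumes "unit_bounded f" "unit_bounded g" "\<And>x. x \<in> {0..1} \<Longrightarrow> f x \<le> g x"
  shows "(LINT x|P. f x) \<le> (LINT x|P. g x)"
  using assms AE_unit by (intro integral_mono_AE integrable_unit_bounded) auto

lemma integral_cong_unit:
  assumes "unit_bounded f" "unit_bounded g" "\<And>x. x \<in> {0..1} \<Longrightarrow> f x = g x"
  shows "(LINT x|P. f x) = (LINT x|P. g x)"
  using assms by (intro antisym integral_mono_unit) auto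

text \<open>Self-similarity makes the mean a solution of m = r m + (1 - r)/2. The second moment is
  found in the same way.\<close>

lemma mean: "(LINT x|P. x) = 1/2"
proof -
  have [simp]: "integrable P (\<lambda>x. x)" by (intro integrable_continuous continuous_intros)
  have "(LINT x|P. x) = (\<Sum>j\<in>{1,2,3}. LINT x|P. S r j x) / 3"
    by (intro integral_self_similar unit_bounded_continuous continuous_intros)
  also have "\<dots> = r * (LINT x|P. x) + (1 - r) / 2"
    by (simp add: S_fun prob_space add_divide_distrib diff_divide_distrib)
  finally have "(1 - r) * ((LINT x|P. x) - 1/2) = 0" by (simp add: algebra_simps)
  then show ?thesis using r_less by simp
qed

end

section \<open>Moments of the measure and distortion of the three pieces\<close>

context self_similar
begin

text \<open>The variance of \<open>P\<close>: it solves V = r^2 V + (1 - r)^2 / 6, the last term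
  being the variance of the three centres.\<close>

definition V :: real where "V = (1 - r) / (6 * (1 + r))"

lemma V_eq: "V * (1 - r\<^sup>2) = (1 - r)\<^sup>2 / 6"
  using r_pos r_less unfolding V_def by (simp add: field_simps power2_eq_square)

lemma V_pos: "0 < V"
  using r_pos r_less by (simp add: V_def)

lemma second_moment: "(LINT x|P. x\<^sup>2) = V + 1/4"
proof -
  have [simp]: "integrable P (\<lambda>x. x)" "integrable P (\<lambda>x. x\<^sup>2)"
    by (auto intro!: integrable_continuous continuous_intros)
  have int: "(LINT x|P. (r * x + b)\<^sup>2) = r\<^sup>2 * (LINT x|P. x\<^sup>2) + r * b + b\<^sup>2" for b
    by (simp add: power2_sum power_mult_distrib prob_space mean mult.assoc)
  have "(LINT x|P. x\<^sup>2) = (\<Sum>j\<in>{1,2,3}. LINT x|P. (S r j x)\<^sup>2) / 3"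
    by (intro integral_self_similar unit_bounded_continuous continuous_intros)
  also have "\<dots> = (\<Sum>j\<in>{1,2,3}. LINT x|P. (r * x + (real j - 1) / 2 * (1 - r))\<^sup>2) / 3"
    unfolding S_def by simp
  also have "\<dots> = r\<^sup>2 * (LINT x|P. x\<^sup>2) + r * (1 - r) / 2 + 5 / 12 * (1 - r)\<^sup>2"
    unfolding int by (simp add: power2_eq_square field_simps)
  finally have "((LINT x|P. x\<^sup>2) - (V + 1/4)) * (1 - r\<^sup>2) = 0"
    using V_eq by (simp add: power2_eq_square field_simps)
  moreover have "1 - r\<^sup>2 \<noteq> 0"
    using r_pos r_less by (simp add: power2_eq_1_iff)
  ultimately show ?thesis by simp
qed

lemma integral_quadratic: "(LINT x|P. a * x\<^sup>2 + b * x + c) = a * (V + 1/4) + b / 2 + c"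
proof -
  have [simp]: "integrable P (\<lambda>x. x)" "integrable P (\<lambda>x. x\<^sup>2)"
    by (auto intro!: integrable_continuous continuous_intros)
  show ?thesis by (simp add: second_moment mean)
qed

lemma integral_square_affine: "(LINT x|P. (b * x + c)\<^sup>2) = b\<^sup>2 * V + (b / 2 + c)\<^sup>2"
proof -
  have "(LINT x|P. (b * x + c)\<^sup>2) = (LINT x|P. b\<^sup>2 * x\<^sup>2 + 2 * b * c * x + c\<^sup>2)"
    by (simp add: power2_eq_square algebra_simps)
  also have "\<dots> = b\<^sup>2 * V + (b / 2 + c)\<^sup>2"
    unfolding integral_quadratic by (simp add: power2_eq_square algebra_simps)
  finally show ?thesis .
qed

lemma unit_bounded_sqdist: "finite \<alpha> \<Longrightarrow> \<alpha> \<noteq> {} \<Longrightarrow> unit_bounded (sqdist \<alpha>)"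
  by (intro unit_bounded_continuous continuous_sqdist)

lemma distortion_singleton: "distortion P {a} = V + (1/2 - a)\<^sup>2"
  using integral_square_affine[of 1 "- a"] by (simp add: distortion_sqdist)

lemma distortion_nonneg: "finite \<alpha> \<Longrightarrow> \<alpha> \<noteq> {} \<Longrightarrow> 0 \<le> distortion P \<alpha>"
  unfolding distortion_sqdist by (intro integral_nonneg_AE AE_I2 sqdist_nonneg)

text \<open>The conditional distortion on the j-th piece, not weighted with its mass 1/3.\<close>

definition child :: "nat \<Rightarrow> real set \<Rightarrow> real" where
  "child j \<alpha> = (LINT x|P. sqdist \<alpha> (S r j x))"

lemma distortion_child:
  assumes "finite \<alpha>" "\<alpha> \<noteq> {}"
  shows "distortion P \<alpha> = (child 1 \<alpha> + child 2 \<alpha> + child 3 \<alpha>) / 3"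
  unfolding distortion_sqdist child_def
  by (subst integral_self_similar[OF unit_bounded_sqdist[OF assms]]) simp

lemma unit_bounded_sqdist_S: "finite \<alpha> \<Longrightarrow> \<alpha> \<noteq> {} \<Longrightarrow> j \<in> {1,2,3} \<Longrightarrow> unit_bounded (\<lambda>x. sqdist \<alpha> (S r j x))"
  by (intro unit_bounded_S unit_bounded_sqdist)

lemma child_nonneg: "finite \<alpha> \<Longrightarrow> \<alpha> \<noteq> {} \<Longrightarrow> 0 \<le> child j \<alpha>"
  unfolding child_def by (intro integral_nonneg_AE AE_I2 sqdist_nonneg)

text \<open>The chord bound \<open>sqdist_concave\<close> integrated over the piece; x (1 - x) has
  mean 1/4 - V. The bound is sharp when a single point serves the piece, so that values at end
  points can stand in for the integral.\<close>

lemma child_endpoints: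
  assumes "finite \<alpha>" "\<alpha> \<noteq> {}" "j \<in> {1,2,3}"
  shows "(sqdist \<alpha> (S r j 0) + sqdist \<alpha> (S r j 1)) / 2 - r\<^sup>2 * (1/4 - V) \<le> child j \<alpha>"
proof -
  let ?l = "sqdist \<alpha> (S r j 0)" and ?u = "sqdist \<alpha> (S r j 1)"
  have eq: "S r j 0 + r * x = S r j x" "S r j 1 - S r j 0 = r" for x
    by (simp_all add: S_def algebra_simps)
  have "(?l + ?u) / 2 - r\<^sup>2 * (1/4 - V) = (LINT x|P. r\<^sup>2 * x\<^sup>2 + (?u - ?l - r\<^sup>2) * x + ?l)"
    unfolding integral_quadratic by (simp add: field_simps)
  also have "\<dots> = (LINT x|P. (1 - x) * ?l + x * ?u - r\<^sup>2 * (x * (1 - x)))"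
    by (intro Bochner_Integration.integral_cong refl) (simp add: power2_eq_square algebra_simps)
  also have "\<dots> \<le> child j \<alpha>"
    unfolding child_def
  proof (intro integral_mono_unit unit_bounded_sqdist_S assms unit_bounded_continuous continuous_intros)
    fix x :: real assume "x \<in> {0..1}"
    then show "(1 - x) * ?l + x * ?u - r\<^sup>2 * (x * (1 - x)) \<le> sqdist \<alpha> (S r j x)"
      using sqdist_concave[OF assms(1,2), of x "S r j 0" "S r j 1"] by (simp add: eq)
  qed
  finally show ?thesis .
qed

text \<open>Among the points at distance at least \<open>t\<close> from 0, the one most favourable
  to [0, r] is \<open>t\<close> itself, because \<open>r \<le> t\<close>. It costs the mean of (t -
  r x)^2.\<close>

lemma child_1_far:
  assumes "finite \<alpha>" "\<alpha> \<noteq> {}" "r \<le> t" "\<And>a. a \<in> \<alpha> \<Longrightarrow> t \<le> \<bar>a\<bar>"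
  shows "r\<^sup>2 * V + (t - r / 2)\<^sup>2 \<le> child 1 \<alpha>"
proof -
  have "r\<^sup>2 * V + (t - r / 2)\<^sup>2 = (LINT x|P. (- r * x + t)\<^sup>2)"
    unfolding integral_square_affine by (simp add: power2_eq_square algebra_simps)
  also have "\<dots> \<le> child 1 \<alpha>"
    unfolding child_def
  proof (intro integral_mono_unit unit_bounded_sqdist_S assms unit_bounded_continuous continuous_intros)
    fix x :: real assume x: "x \<in> {0..1}"
    then have "r * x \<le> r" "0 \<le> r * x" using r_pos by auto
    then show "(- r * x + t)\<^sup>2 \<le> sqdist \<alpha> (S r 1 x)"
      using assms(3) by (intro sqdist_ge[OF assms(1,2)])
        (auto simp: S_simps abs_le_square_iff[symmetric] dest!: assms(4))
  qed simp
  finally show ?thesis .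
qed

lemma child_3_far:
  assumes "finite \<alpha>" "\<alpha> \<noteq> {}" "r \<le> t" "\<And>a. a \<in> \<alpha> \<Longrightarrow> t \<le> \<bar>a - 1\<bar>"
  shows "r\<^sup>2 * V + (t - r / 2)\<^sup>2 \<le> child 3 \<alpha>"
proof -
  have "r\<^sup>2 * V + (t - r / 2)\<^sup>2 = (LINT x|P. (r * x + (t - r))\<^sup>2)"
    unfolding integral_square_affine by (simp add: power2_eq_square algebra_simps)
  also have "\<dots> \<le> child 3 \<alpha>"
    unfolding child_def
  proof (intro integral_mono_unit unit_bounded_sqdist_S assms unit_bounded_continuous continuous_intros)
    fix x :: real assume x: "x \<in> {0..1}"
    then have "r * x \<le> r" "0 \<le> r * x" using r_pos by auto
    then show "(r * x + (t - r))\<^sup>2 \<le> sqdist \<alpha> (S r 3 x)"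
      using assms(3) by (intro sqdist_ge[OF assms(1,2)])
        (auto simp: S_simps abs_le_square_iff[symmetric] dest!: assms(4))
  qed simp
  finally show ?thesis .
qed

lemma sqdist_scale:
  assumes "finite \<beta>" "\<beta> \<noteq> {}"
  shows "sqdist (S r j ` \<beta>) (S r j x) = r\<^sup>2 * sqdist \<beta> x"
proof -
  obtain a where a: "a \<in> \<beta>" "sqdist \<beta> x = (x - a)\<^sup>2" "\<And>b. b \<in> \<beta> \<Longrightarrow> \<bar>x - a\<bar> \<le> \<bar>x - b\<bar>"
    using sqdist_attained[OF assms] by metis
  have S: "S r j x - S r j b = r * (x - b)" for b
    by (simp add: S_def algebra_simps)
  have "sqdist (S r j ` \<beta>) (S r j x) = (S r j x - S r j a)\<^sup>2"
    using assms a r_pos by (intro sqdist_eqI) (auto simp: S abs_mult)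
  then show ?thesis by (simp add: S a(2) power_mult_distrib)
qed

lemma child_scale:
  "finite \<beta> \<Longrightarrow> \<beta> \<noteq> {} \<Longrightarrow> child j (S r j ` \<beta>) = r\<^sup>2 * distortion P \<beta>"
  by (simp add: child_def sqdist_scale distortion_sqdist)

text \<open>The map x -> 1 - x interchanges the first and the third contraction. Estimates at the
  left end, proved in the locale for any such measure, are carried to the right end by instantiating
  them at the reflected measure.\<close>

lemma reflected: "self_similar r (distr P borel (\<lambda>x. 1 - x))"
proof
  let ?Q = "distr P borel (\<lambda>x. 1 - x)"
  have Q: "measure ?Q A = measure P ((\<lambda>x. 1 - x) -` A)" if "A \<in> sets borel" for A
    using that by (simp add: measure_distr)
  have "measure ?Q A = 1 / 3 * (\<Sum>j\<in>{1,2,3}. measure ?Q (S r j -` A))" if [measurable]: "A \<in> sets borel" for A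
  proof -
    have [measurable]: "S r j -` A \<in> sets borel" "(\<lambda>x. 1 - x) -` A \<in> sets borel" for j
      using measurable_sets[OF measurable_S that, of r j]
        measurable_sets[of "\<lambda>x::real. 1 - x" borel borel A] by auto
    have "S r j -` (\<lambda>x. 1 - x) -` A = (\<lambda>x. 1 - x) -` S r (4 - j) -` A" if "j \<in> {1,2,3}" for j
      using that by (auto simp: S_def algebra_simps diff_divide_distrib)
    then show ?thesis
      by (simp add: Q measure_P)
  qed
  then show "self_similar_measure r ?Q"
    unfolding self_similar_measure_def by (auto intro!: prob_space_distr)
qed (use r_pos r_less in auto)

lemma distortion_reflected:
  assumes "finite \<alpha>" "\<alpha> \<noteq> {}"
  shows "distortion (distr P borel (\<lambda>x. 1 - x)) \<alpha> = distortion P ((\<lambda>x. 1 - x) ` \<alpha>)"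
proof -
  have "sqdist \<alpha> (1 - x) = sqdist ((\<lambda>x. 1 - x) ` \<alpha>) x" for x
  proof -
    obtain a where a: "a \<in> \<alpha>" "sqdist \<alpha> (1 - x) = (1 - x - a)\<^sup>2" "\<And>b. b \<in> \<alpha> \<Longrightarrow> \<bar>1 - x - a\<bar> \<le> \<bar>1 - x - b\<bar>"
      using sqdist_attained[OF assms] by metis
    have "sqdist ((\<lambda>x. 1 - x) ` \<alpha>) x = (x - (1 - a))\<^sup>2"
    proof (rule sqdist_eqI)
      fix b assume "b \<in> (\<lambda>x. 1 - x) ` \<alpha>"
      then obtain c where "b = 1 - c" "c \<in> \<alpha>" by auto
      then show "\<bar>x - (1 - a)\<bar> \<le> \<bar>x - b\<bar>" using a(3)[of c] by (auto simp: abs_if split: if_splits)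
    qed (use assms a in auto)
    with a(2) show ?thesis by (simp add: power2_eq_square algebra_simps)
  qed
  moreover have [measurable]: "sqdist \<alpha> \<in> borel_measurable borel"
    by (intro borel_measurable_continuous_onI continuous_sqdist assms)
  ultimately show ?thesis
    unfolding distortion_sqdist by (subst integral_distr) auto
qed

end

section \<open>Points serving a piece\<close>

text \<open>The points whose closed Voronoi cells meet \<open>A\<close>.\<close>

definition serving :: "real set \<Rightarrow> real set \<Rightarrow> real set" where
  "serving \<alpha> A = {a \<in> \<alpha>. \<exists>x\<in>A. \<forall>b\<in>\<alpha>. \<bar>x - a\<bar> \<le> \<bar>x - b\<bar>}"

lemma serving_subset: "serving \<alpha> A \<subseteq> \<alpha>"
  by (auto simp: serving_def)

lemma finite_serving: "finite \<alpha> \<Longrightarrow> finite (serving \<alpha> A)"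
  by (rule finite_subset[OF serving_subset])

lemma sqdist_serving:
  assumes "finite \<alpha>" "\<alpha> \<noteq> {}" "x \<in> A"
  shows "serving \<alpha> A \<noteq> {}" "sqdist (serving \<alpha> A) x = sqdist \<alpha> x"
proof -
  obtain a where a: "a \<in> \<alpha>" "sqdist \<alpha> x = (x - a)\<^sup>2" "\<And>b. b \<in> \<alpha> \<Longrightarrow> \<bar>x - a\<bar> \<le> \<bar>x - b\<bar>"
    using sqdist_attained[OF assms(1,2)] by metis
  then have *: "a \<in> serving \<alpha> A" using assms by (auto simp: serving_def)
  then show "serving \<alpha> A \<noteq> {}" by blast
  have "sqdist (serving \<alpha> A) x = (x - a)\<^sup>2"
    using a * serving_subset[of \<alpha> A] by (intro sqdist_eqI finite_serving assms) auto
  with a(2) show "sqdist (serving \<alpha> A) x = sqdist \<alpha> x" by simp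
qed

lemma nearest_between:
  fixes a b x y z :: real
  assumes "\<bar>x - a\<bar> \<le> \<bar>x - b\<bar>" "\<bar>y - a\<bar> \<le> \<bar>y - b\<bar>" "x \<le> z" "z \<le> y"
  shows "\<bar>z - a\<bar> \<le> \<bar>z - b\<bar>"
  using assms by linarith

lemma nearest_unique:
  fixes a b x y :: real
  assumes "\<bar>x - a\<bar> = \<bar>x - b\<bar>" "\<bar>y - a\<bar> = \<bar>y - b\<bar>" "x \<noteq> y"
  shows "a = b"
  using assms by (auto simp: abs_if split: if_splits)

context self_similar
begin

text \<open>The serving points pulled back by the inverse of \<open>S r j\<close>, so that the piece
  becomes [0,1] and the distortion is again one with respect to \<open>P\<close>.\<close>

definition piece :: "nat \<Rightarrow> real set \<Rightarrow> real set" where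
  "piece j \<alpha> = (\<lambda>a. (a - S r j 0) / r) ` serving \<alpha> (S r j ` {0..1})"

lemma S_piece: "S r j ` piece j \<alpha> = serving \<alpha> (S r j ` {0..1})"
proof -
  have "S r j ((a - S r j 0) / r) = a" for a using r_pos by (simp add: S_def)
  then show ?thesis by (simp add: piece_def image_image)
qed

lemma finite_piece: "finite \<alpha> \<Longrightarrow> finite (piece j \<alpha>)"
  by (simp add: piece_def finite_serving)

lemma piece_nonempty: "finite \<alpha> \<Longrightarrow> \<alpha> \<noteq> {} \<Longrightarrow> piece j \<alpha> \<noteq> {}"
  unfolding piece_def using sqdist_serving(1)[of \<alpha> "S r j 0" "S r j ` {0..1}"] by auto

lemma card_piece: "card (piece j \<alpha>) = card (serving \<alpha> (S r j ` {0..1}))"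
  unfolding piece_def using r_pos by (intro card_image) (auto simp: inj_on_def)

lemma distortion_pieces:
  assumes "finite \<alpha>" "\<alpha> \<noteq> {}"
  shows "distortion P \<alpha> = r\<^sup>2 / 3 * (distortion P (piece 1 \<alpha>) + distortion P (piece 2 \<alpha>) + distortion P (piece 3 \<alpha>))"
proof -
  have "child j \<alpha> = r\<^sup>2 * distortion P (piece j \<alpha>)" if "j \<in> {1,2,3}" for j
  proof -
    have "child j \<alpha> = child j (S r j ` piece j \<alpha>)"
      unfolding child_def
    proof (intro integral_cong_unit unit_bounded_sqdist_S that)
      fix x :: real assume "x \<in> {0..1}"
      then show "sqdist \<alpha> (S r j x) = sqdist (S r j ` piece j \<alpha>) (S r j x)"
        unfolding S_piece by (intro sqdist_serving(2)[symmetric] assms) auto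
    qed (use assms finite_piece piece_nonempty in auto)
    then show ?thesis using child_scale finite_piece[OF assms(1)] piece_nonempty[OF assms] by simp
  qed
  then show ?thesis by (simp add: distortion_child[OF assms] field_simps)
qed

lemma unit_image: "S r 1 ` {0..1} = {0..r}" "S r 2 ` {0..1} = {(1 - r) / 2..(1 + r) / 2}" "S r 3 ` {0..1} = {1 - r..1}"
proof -
  have img: "S r j ` {0..1} = {S r j 0..S r j 1}" for j
  proof -
    have eq: "S r j = (\<lambda>x. r *\<^sub>R x + (real j - 1) / 2 * (1 - r))" by (simp add: S_def fun_eq_iff)
    show ?thesis
      unfolding eq using r_pos by (simp add: image_affinity_atLeastAtMost)
  qed
  have "S r 1 0 = 0" "S r 1 1 = r" "S r 2 0 = (1 - r) / 2" "S r 2 1 = (1 + r) / 2" "S r 3 0 = 1 - r" "S r 3 1 = 1"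
    by (simp_all add: S_simps field_simps)
  then show "S r 1 ` {0..1} = {0..r}" "S r 2 ` {0..1} = {(1 - r) / 2..(1 + r) / 2}" "S r 3 ` {0..1} = {1 - r..1}"
    unfolding img by simp_all
qed

text \<open>The hole between neighbouring pieces has width (1 - 3r)/2; this is its width in units of
  the length \<open>r\<close> of a piece.\<close>

definition gap :: real where "gap = (1 - 3 * r) / (2 * r)"

text \<open>Closed Voronoi cells are intervals, so a point serving both pieces is nearest at both
  ends that face the hole. In the coordinates of the two pieces it lies \<open>s\<close> beyond 1
  and \<open>t\<close> before 0.\<close>

lemma shared_piece:
  assumes "finite \<alpha>" and j: "j \<in> {1,2}" and k: "k = Suc j"
    and a: "a \<in> serving \<alpha> (S r j ` {0..1})" "a \<in> serving \<alpha> (S r k ` {0..1})"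
  shows "\<exists>s t. s + t = gap \<and>
    1 + s \<in> piece j \<alpha> \<and> (\<forall>b\<in>piece j \<alpha>. \<bar>s\<bar> \<le> \<bar>b - 1\<bar>) \<and>
    - t \<in> piece k \<alpha> \<and> (\<forall>b\<in>piece k \<alpha>. \<bar>t\<bar> \<le> \<bar>b\<bar>)"
proof -
  obtain x y where x: "x \<in> S r j ` {0..1}" "\<And>b. b \<in> \<alpha> \<Longrightarrow> \<bar>x - a\<bar> \<le> \<bar>x - b\<bar>"
    and y: "y \<in> S r k ` {0..1}" "\<And>b. b \<in> \<alpha> \<Longrightarrow> \<bar>y - a\<bar> \<le> \<bar>y - b\<bar>"
    using a by (auto simp: serving_def)
  have xy: "x \<le> S r j 1" "S r j 1 \<le> S r k 0" "S r k 0 \<le> y"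
    using x(1) y(1) j k r_pos r_less by (auto simp: S_def field_simps mult_left_le)
  have u: "\<bar>S r j 1 - a\<bar> \<le> \<bar>S r j 1 - b\<bar>" and l: "\<bar>S r k 0 - a\<bar> \<le> \<bar>S r k 0 - b\<bar>" if "b \<in> \<alpha>" for b
    using nearest_between[OF x(2) y(2)] that xy by auto
  define s where "s = (a - S r j 1) / r"
  define t where "t = (S r k 0 - a) / r"
  have scale: "\<bar>c / r\<bar> = \<bar>c\<bar> / r" for c using r_pos by simp
  show ?thesis
  proof (intro exI conjI ballI)
    show "s + t = gap"
      using r_pos j k by (auto simp: s_def t_def gap_def S_def field_simps)
    have "1 + s = (a - S r j 0) / r"
      using r_pos by (simp add: s_def S_def field_simps)
    then show "1 + s \<in> piece j \<alpha>" using a(1) by (auto simp: piece_def)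
    have "- t = (a - S r k 0) / r"
      using r_pos by (simp add: t_def field_simps)
    then show "- t \<in> piece k \<alpha>" using a(2) by (auto simp: piece_def)
    show "\<bar>s\<bar> \<le> \<bar>b - 1\<bar>" if b: "b \<in> piece j \<alpha>" for b
    proof -
      obtain c where c: "c \<in> \<alpha>" "b = (c - S r j 0) / r"
        using b serving_subset by (auto simp: piece_def)
      have "b - 1 = (c - S r j 1) / r" using r_pos by (simp add: c(2) S_def field_simps)
      then show ?thesis using u[OF c(1)] r_pos
        by (simp add: s_def scale divide_right_mono abs_minus_commute)
    qed
    show "\<bar>t\<bar> \<le> \<bar>b\<bar>" if b: "b \<in> piece k \<alpha>" for b
    proof -
      obtain c where c: "c \<in> \<alpha>" "b = (c - S r k 0) / r"
        using b serving_subset by (auto simp: piece_def)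
      then show ?thesis using l[OF c(1)] r_pos
        by (simp add: t_def scale divide_right_mono abs_minus_commute)
    qed
  qed
qed

text \<open>Two shared points would tie at both facing ends, but distinct points are equidistant
  from one place only.\<close>

lemma card_shared:
  assumes "finite \<alpha>" "j \<in> {1,2}" "k = Suc j"
  shows "card (serving \<alpha> (S r j ` {0..1}) \<inter> serving \<alpha> (S r k ` {0..1})) \<le> 1"
proof (rule ccontr)
  let ?I = "serving \<alpha> (S r j ` {0..1}) \<inter> serving \<alpha> (S r k ` {0..1})"
  have fin: "finite ?I" using assms finite_serving by blast
  assume "\<not> card ?I \<le> 1"
  then obtain a b where ab: "a \<in> ?I" "b \<in> ?I" "a \<noteq> b"
    using card_le_Suc0_iff_eq[OF fin] by auto
  have near: "\<bar>S r j 1 - a\<bar> \<le> \<bar>S r j 1 - b\<bar>" "\<bar>S r k 0 - a\<bar> \<le> \<bar>S r k 0 - b\<bar>"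
    if "a \<in> ?I" "b \<in> ?I" for a b
  proof -
    have a: "a \<in> serving \<alpha> (S r j ` {0..1})" "a \<in> serving \<alpha> (S r k ` {0..1})" using that(1) by simp_all
    obtain x where x: "x \<in> S r j ` {0..1}" "\<And>b. b \<in> \<alpha> \<Longrightarrow> \<bar>x - a\<bar> \<le> \<bar>x - b\<bar>"
      using a(1) by (auto simp: serving_def)
    obtain y where y: "y \<in> S r k ` {0..1}" "\<And>b. b \<in> \<alpha> \<Longrightarrow> \<bar>y - a\<bar> \<le> \<bar>y - b\<bar>"
      using a(2) by (auto simp: serving_def)
    have xy: "x \<le> S r j 1" "S r j 1 \<le> S r k 0" "S r k 0 \<le> y"
      using x(1) y(1) assms r_pos r_less by (auto simp: S_def field_simps mult_left_le)
    have "b \<in> \<alpha>" using that serving_subset by blast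
    from nearest_between[OF x(2)[OF this] y(2)[OF this]] xy
    show "\<bar>S r j 1 - a\<bar> \<le> \<bar>S r j 1 - b\<bar>" "\<bar>S r k 0 - a\<bar> \<le> \<bar>S r k 0 - b\<bar>" by auto
  qed
  have "S r j 1 < S r k 0" using assms r_pos r_less by (auto simp: S_def field_simps)
  with ab near[OF ab(1,2)] near[OF ab(2,1)] nearest_unique[of "S r j 1" a b "S r k 0"]
  show False by auto
qed

lemma card_pieces:
  assumes "finite \<alpha>"
  shows "card (piece 1 \<alpha>) + card (piece 2 \<alpha>) + card (piece 3 \<alpha>)
    \<le> card \<alpha> + card (serving \<alpha> (S r 1 ` {0..1}) \<inter> serving \<alpha> (S r 2 ` {0..1}))
        + card (serving \<alpha> (S r 2 ` {0..1}) \<inter> serving \<alpha> (S r 3 ` {0..1}))"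
proof -
  define N where "N j = serving \<alpha> (S r j ` {0..1})" for j
  have fin: "finite (N j)" for j using assms by (simp add: N_def finite_serving)
  \<comment> \<open>A cell meeting both outer pieces contains 1/2. Thus overlaps of the outer pieces
    are already counted at the middle one.\<close>
  have sub: "N 1 \<inter> N 3 \<subseteq> N 2"
  proof
    fix a assume a: "a \<in> N 1 \<inter> N 3"
    then obtain x y where x: "x \<in> S r 1 ` {0..1}" "\<And>b. b \<in> \<alpha> \<Longrightarrow> \<bar>x - a\<bar> \<le> \<bar>x - b\<bar>"
      and y: "y \<in> S r 3 ` {0..1}" "\<And>b. b \<in> \<alpha> \<Longrightarrow> \<bar>y - a\<bar> \<le> \<bar>y - b\<bar>"
      by (auto simp: N_def serving_def)
    have "x \<le> 1/2" "1/2 \<le> y" using x(1) y(1) r_less unfolding unit_image by auto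
    then have "\<forall>b\<in>\<alpha>. \<bar>1/2 - a\<bar> \<le> \<bar>1/2 - b\<bar>"
      using nearest_between[OF x(2) y(2)] by blast
    moreover have "1/2 \<in> S r 2 ` {0..1}" using r_pos unfolding unit_image by simp
    ultimately show "a \<in> N 2" using a unfolding N_def serving_def by blast
  qed
  have "card (N 1) + card (N 2) = card (N 1 \<union> N 2) + card (N 1 \<inter> N 2)"
    using fin by (intro card_Un_Int) auto
  moreover have "card (N 1 \<union> N 2) + card (N 3) = card (N 1 \<union> N 2 \<union> N 3) + card ((N 1 \<union> N 2) \<inter> N 3)"
    using fin by (intro card_Un_Int) auto
  moreover have "card ((N 1 \<union> N 2) \<inter> N 3) \<le> card (N 2 \<inter> N 3)"
    using fin sub by (intro card_mono) auto
  moreover have "card (N 1 \<union> N 2 \<union> N 3) \<le> card \<alpha>"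
    using assms serving_subset by (intro card_mono) (auto simp: N_def)
  ultimately show ?thesis by (simp add: card_piece N_def)
qed

end

text \<open>The number \<open>e t\<close> is the amount by which the Lagrangian of a set exceeds \<open>\<Phi>\<close> if one of its points
  lies at distance \<open>t\<close> outside \<open>[0, 1]\<close> and no other point is closer to that end. A point shared by two
  neighbouring pieces is seen from them at distances \<open>s\<close> and \<open>t\<close> with \<open>s + t = gap\<close>, where a negative
  value means that it lies on the side of the piece itself.\<close>

lemma (in self_similar) lagrange_step:
  fixes lam \<Phi> :: real and e :: "real \<Rightarrow> real"
  assumes lam: "0 \<le> lam"
    and base: "\<And>\<beta>. finite \<beta> \<Longrightarrow> \<beta> \<noteq> {} \<Longrightarrow> \<Phi> \<le> distortion P \<beta> + lam * card \<beta>"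
    and left: "\<And>\<beta> t. finite \<beta> \<Longrightarrow> 0 \<le> t \<Longrightarrow> - t \<in> \<beta> \<Longrightarrow> (\<And>b. b \<in> \<beta> \<Longrightarrow> t \<le> \<bar>b\<bar>) \<Longrightarrow>
      \<Phi> + e t \<le> distortion P \<beta> + lam * card \<beta>"
    and right: "\<And>\<beta> s. finite \<beta> \<Longrightarrow> 0 \<le> s \<Longrightarrow> 1 + s \<in> \<beta> \<Longrightarrow> (\<And>b. b \<in> \<beta> \<Longrightarrow> s \<le> \<bar>b - 1\<bar>) \<Longrightarrow>
      \<Phi> + e s \<le> distortion P \<beta> + lam * card \<beta>"
    and both: "\<And>\<beta> s t. finite \<beta> \<Longrightarrow> 0 \<le> t \<Longrightarrow> - t \<in> \<beta> \<Longrightarrow> (\<And>b. b \<in> \<beta> \<Longrightarrow> t \<le> \<bar>b\<bar>) \<Longrightarrow>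
      0 \<le> s \<Longrightarrow> 1 + s \<in> \<beta> \<Longrightarrow> (\<And>b. b \<in> \<beta> \<Longrightarrow> s \<le> \<bar>b - 1\<bar>) \<Longrightarrow>
      \<Phi> + e t + e s \<le> distortion P \<beta> + lam * card \<beta>"
    and e: "\<And>t. t < 0 \<Longrightarrow> e t = 0" "\<And>s t. s + t = gap \<Longrightarrow> lam \<le> e s + e t"
    and \<alpha>: "finite \<alpha>" "\<alpha> \<noteq> {}"
  shows "r\<^sup>2 * \<Phi> \<le> distortion P \<alpha> + r\<^sup>2 / 3 * lam * card \<alpha>"
proof -
  define B where "B j = piece j \<alpha>" for j
  define N where "N j = serving \<alpha> (S r j ` {0..1})" for j
  \<comment> \<open>The excess of a piece over \<Phi>. The three excesses together have to pay
    \<open>lam\<close> for each shared point.\<close>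
  define x where "x j = distortion P (B j) + lam * card (B j) - \<Phi>" for j
  have B: "finite (B j)" "B j \<noteq> {}" for j
    using \<alpha> by (auto simp: B_def finite_piece piece_nonempty)
  have base': "0 \<le> x j" for j using base[OF B] by (simp add: x_def)
  have left': "e t \<le> x j" if "- t \<in> B j" "\<And>b. b \<in> B j \<Longrightarrow> \<bar>t\<bar> \<le> \<bar>b\<bar>" for j t
  proof (cases "0 \<le> t")
    case True
    then show ?thesis using left[OF B(1) True that(1)] that(2) by (simp add: x_def)
  qed (use e(1)[of t] base'[of j] in simp)
  have right': "e s \<le> x j" if "1 + s \<in> B j" "\<And>b. b \<in> B j \<Longrightarrow> \<bar>s\<bar> \<le> \<bar>b - 1\<bar>" for j s
  proof (cases "0 \<le> s")
    case True
    then show ?thesis using right[OF B(1) True that(1)] that(2) by (simp add: x_def)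
  qed (use e(1)[of s] base'[of j] in simp)
  have both': "e t + e s \<le> x j" if "- t \<in> B j" "\<And>b. b \<in> B j \<Longrightarrow> \<bar>t\<bar> \<le> \<bar>b\<bar>"
     "1 + s \<in> B j" "\<And>b. b \<in> B j \<Longrightarrow> \<bar>s\<bar> \<le> \<bar>b - 1\<bar>" for j s t
  proof (cases "0 \<le> t \<and> 0 \<le> s")
    case True
    then show ?thesis using both[OF B(1), of t j s] that by (simp add: x_def)
  next
    case False
    then show ?thesis using e(1)[of t] e(1)[of s] left'[OF that(1,2)] right'[OF that(3,4)] by force
  qed
  have share: "card (N j \<inter> N k) = 0 \<or> (card (N j \<inter> N k) = 1 \<and> (\<exists>s t. s + t = gap \<and> 
     1 + s \<in> B j \<and> (\<forall>b\<in>B j. \<bar>s\<bar> \<le> \<bar>b - 1\<bar>) \<and> - t \<in> B k \<and> (\<forall>b\<in>B k. \<bar>t\<bar> \<le> \<bar>b\<bar>)))"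
    if "j \<in> {1,2}" "k = Suc j" for j k
  proof (cases "N j \<inter> N k = {}")
    case False
    then obtain a where a: "a \<in> N j" "a \<in> N k" by auto
    have "finite (N j \<inter> N k)" using \<alpha> finite_serving by (auto simp: N_def)
    with False have "card (N j \<inter> N k) \<noteq> 0" by simp
    moreover have "card (N j \<inter> N k) \<le> 1" using card_shared[OF \<alpha>(1) that] by (simp add: N_def)
    ultimately have "card (N j \<inter> N k) = 1" by simp
    then show ?thesis
      using shared_piece[OF \<alpha>(1) that a[unfolded N_def]] unfolding B_def by blast
  qed simp
  have 1: "(2::nat) = Suc 1" "(3::nat) = Suc 2" "1 \<in> {1,2::nat}" "2 \<in> {1,2::nat}" by auto
  have "lam * (card (N 1 \<inter> N 2) + card (N 2 \<inter> N 3)) \<le> x 1 + x 2 + x 3"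
    using share[OF 1(3,1)]
  proof (elim disjE conjE exE)
    assume 12: "card (N 1 \<inter> N 2) = 0"
    show ?thesis using share[OF 1(4,2)]
    proof (elim disjE conjE exE)
      assume 23: "card (N 2 \<inter> N 3) = 0"
      show ?thesis using base'[of 1] base'[of 2] base'[of 3] unfolding 12 23 by simp
    next
      fix s t assume 23: "card (N 2 \<inter> N 3) = 1" "s + t = gap" "1 + s \<in> B 2" "\<forall>b\<in>B 2. \<bar>s\<bar> \<le> \<bar>b - 1\<bar>"
        "- t \<in> B 3" "\<forall>b\<in>B 3. \<bar>t\<bar> \<le> \<bar>b\<bar>"
      have "e s \<le> x 2" by (rule right') (use 23 in blast)+
      moreover have "e t \<le> x 3" by (rule left') (use 23 in blast)+
      ultimately show ?thesis using e(2)[OF 23(2)] base'[of 1] unfolding 12 23(1) by simp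
    qed
  next
    fix s t assume 12: "card (N 1 \<inter> N 2) = 1" "s + t = gap" "1 + s \<in> B 1" "\<forall>b\<in>B 1. \<bar>s\<bar> \<le> \<bar>b - 1\<bar>"
        "- t \<in> B 2" "\<forall>b\<in>B 2. \<bar>t\<bar> \<le> \<bar>b\<bar>"
    show ?thesis using share[OF 1(4,2)]
    proof (elim disjE conjE exE)
      assume 23: "card (N 2 \<inter> N 3) = 0"
      have "e s \<le> x 1" by (rule right') (use 12 in blast)+
      moreover have "e t \<le> x 2" by (rule left') (use 12 in blast)+
      ultimately show ?thesis using e(2)[OF 12(2)] base'[of 3] unfolding 12(1) 23 by simp
    next
      fix s' t' assume 23: "card (N 2 \<inter> N 3) = 1" "s' + t' = gap" "1 + s' \<in> B 2" "\<forall>b\<in>B 2. \<bar>s'\<bar> \<le> \<bar>b - 1\<bar>"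
        "- t' \<in> B 3" "\<forall>b\<in>B 3. \<bar>t'\<bar> \<le> \<bar>b\<bar>"
      have "e s \<le> x 1" by (rule right') (use 12 in blast)+
      moreover have "e t' \<le> x 3" by (rule left') (use 23 in blast)+
      \<comment> \<open>The middle piece pays its share of both debts out of one excess, hence the
        separate assumption on sets with far points at both ends.\<close>
      moreover have "e t + e s' \<le> x 2" by (rule both') (use 12 23 in blast)+
      ultimately show ?thesis using e(2)[OF 12(2)] e(2)[OF 23(2)] unfolding 12(1) 23(1) by simp
    qed
  qed
  moreover have "lam * (real (card (B 1)) + card (B 2) + card (B 3)) \<le> lam * (card \<alpha> + (card (N 1 \<inter> N 2) + card (N 2 \<inter> N 3)))"
    using card_pieces[OF \<alpha>(1)] lam by (intro mult_left_mono) (auto simp: B_def N_def)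
  ultimately have "3 * \<Phi> \<le> distortion P (B 1) + distortion P (B 2) + distortion P (B 3) + lam * card \<alpha>"
    by (simp add: x_def algebra_simps)
  then have "r\<^sup>2 / 3 * (3 * \<Phi>) \<le> r\<^sup>2 / 3 * (distortion P (B 1) + distortion P (B 2) + distortion P (B 3) + lam * card \<alpha>)"
    by (intro mult_left_mono) auto
  then show ?thesis
    unfolding distortion_pieces[OF \<alpha>] B_def by (simp add: algebra_simps)
qed

section \<open>Optimal sets of two means\<close>

context self_similar
begin

text \<open>The integrated distribution function of \<open>P\<close>; its values are the intercepts
  of the lines that bound the polygon.\<close>

definition hinge :: "real \<Rightarrow> real" where
  "hinge x = (LINT y|P. max 0 (x - y))"

lemma hinge_0: "hinge 0 = 0"
proof -
  have "hinge 0 = (LINT y|P. 0)"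
    unfolding hinge_def by (intro integral_cong_unit unit_bounded_continuous continuous_intros) auto
  then show ?thesis by simp
qed

lemma hinge_1: "hinge 1 = 1/2"
proof -
  have "hinge 1 = (LINT y|P. 0 * y\<^sup>2 + (- 1) * y + 1)"
    unfolding hinge_def by (intro integral_cong_unit unit_bounded_continuous continuous_intros) auto
  then show ?thesis unfolding integral_quadratic by simp
qed

lemma hinge_split: "hinge x = (\<Sum>j\<in>{1,2,3}. LINT y|P. max 0 (x - S r j y)) / 3"
  unfolding hinge_def by (intro integral_self_similar unit_bounded_continuous continuous_intros)

lemma hinge_same: "(LINT y|P. max 0 (S r j z - S r j y)) = r * hinge z"
proof -
  have "max 0 (S r j z - S r j y) = r * max 0 (z - y)" for y
    using r_pos by (simp add: S_def max_mult_distrib_left algebra_simps)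
  then show ?thesis by (simp add: hinge_def)
qed

lemma hinge_left:
  assumes "j \<in> {1,2,3}" "x \<le> S r j 0"
  shows "(LINT y|P. max 0 (x - S r j y)) = 0"
proof -
  have "(LINT y|P. max 0 (x - S r j y)) = (LINT y|P. 0)"
  proof (intro integral_cong_unit unit_bounded_continuous continuous_intros)
    fix y :: real assume "y \<in> {0..1}"
    then have "S r j 0 \<le> S r j y" using r_pos by (simp add: S_def)
    with assms(2) show "max 0 (x - S r j y) = 0" by simp
  qed
  then show ?thesis by simp
qed

lemma hinge_right:
  assumes "j \<in> {1,2,3}" "S r j 1 \<le> x"
  shows "(LINT y|P. max 0 (x - S r j y)) = x - S r j (1/2)"
proof -
  have "(LINT y|P. max 0 (x - S r j y)) = (LINT y|P. 0 * y\<^sup>2 + (- r) * y + (x - S r j 0))"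
  proof (intro integral_cong_unit unit_bounded_continuous continuous_intros)
    fix y :: real assume "y \<in> {0..1}"
    then have "S r j y \<le> S r j 1" using r_pos by (simp add: S_def)
    with assms(2) show "max 0 (x - S r j y) = 0 * y\<^sup>2 + (- r) * y + (x - S r j 0)" by (simp add: S_def)
  qed
  then show ?thesis unfolding integral_quadratic by (simp add: S_def algebra_simps)
qed

text \<open>For a point of the j-th piece, every piece to the left contributes the distance to its
  centre, every piece to the right contributes 0, and the j-th piece contributes a scaled copy. The
  recursion gives \<open>hinge\<close> at end points of cylinders as polynomials in
  \<open>r\<close>.\<close>

lemma hinge_S:
  assumes "0 \<le> z" "z \<le> 1"
  shows "hinge (S r 1 z) = r / 3 * hinge z"
    and "hinge (S r 2 z) = (S r 2 z - r / 2 + r * hinge z) / 3"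
    and "hinge (S r 3 z) = (2 * S r 3 z - r / 2 - 1 / 2 + r * hinge z) / 3"
proof -
  have z: "0 \<le> r * z" "r * z \<le> r" using assms r_pos by auto
  have le: "S r 1 z \<le> S r 2 0" "S r 1 z \<le> S r 3 0" "S r 2 z \<le> S r 3 0"
      "S r 1 1 \<le> S r 2 z" "S r 1 1 \<le> S r 3 z" "S r 2 1 \<le> S r 3 z"
    using z r_less by (simp_all add: S_simps field_simps)
  have S_half: "S r (Suc 0) (1/2) = r / 2" "S r 2 (1/2) = 1/2" by (simp_all add: S_simps field_simps)
  show "hinge (S r 1 z) = r / 3 * hinge z"
    using le by (simp only: hinge_split[of "S r 1 z"]) (simp add: hinge_same[of 1, simplified] hinge_left)
  show "hinge (S r 2 z) = (S r 2 z - r / 2 + r * hinge z) / 3"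
    using le by (simp only: hinge_split[of "S r 2 z"]) (simp add: hinge_same S_half hinge_left hinge_right)
  show "hinge (S r 3 z) = (2 * S r 3 z - r / 2 - 1 / 2 + r * hinge z) / 3"
    using le by (simp only: hinge_split[of "S r 3 z"]) (simp add: hinge_same S_half hinge_right)
qed

lemma integrable_indicator_mult:
  assumes "A \<in> sets borel" "continuous_on UNIV f"
  shows "integrable P (\<lambda>y. indicator A y * f y :: real)"
  by (intro integrable_unit_bounded unit_bounded_mult unit_bounded_indicator unit_bounded_continuous assms)

lemma integrable_indicator: "A \<in> sets borel \<Longrightarrow> integrable P (indicator A :: real \<Rightarrow> real)"
  by (intro integrable_unit_bounded unit_bounded_indicator)

definition moment :: "real set \<Rightarrow> real" where
  "moment A = (LINT y|P. indicator A y * (1/2 - y))"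

text \<open>Restricting x - y to \<open>A\<close> gives at most its positive part, with equality for
  \<open>A = {..x}\<close>. So every line is a supporting line of the region of pairs of mass and
  moment.\<close>

lemma moment_le_hinge:
  assumes [measurable]: "A \<in> sets borel"
  shows "moment A \<le> hinge x + (1/2 - x) * measure P A"
proof -
  have int: "integrable P (\<lambda>y. indicator A y * (1/2 - y))" "integrable P (\<lambda>y. indicator A y * (x - y))"
      "integrable P (indicator A :: real \<Rightarrow> real)" "integrable P (\<lambda>y. max 0 (x - y))"
    using assms by (intro integrable_indicator_mult integrable_indicator integrable_continuous continuous_intros; simp)+
  have "moment A = (LINT y|P. indicator A y * (x - y) + (1/2 - x) * indicator A y)"
    unfolding moment_def by (intro Bochner_Integration.integral_cong refl) (simp add: algebra_simps)
  also have "\<dots> = (LINT y|P. indicator A y * (x - y)) + (1/2 - x) * measure P A"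
    using int by simp
  also have "(LINT y|P. indicator A y * (x - y)) \<le> hinge x"
    unfolding hinge_def using int by (intro integral_mono) (auto simp: indicator_def)
  finally show ?thesis by simp
qed

lemma moment_reflected:
  assumes "A \<in> sets borel"
  shows "self_similar.moment (distr P borel (\<lambda>x. 1 - x)) ((\<lambda>x. 1 - x) -` A) = - moment A"
    and "measure (distr P borel (\<lambda>x. 1 - x)) ((\<lambda>x. 1 - x) -` A) = measure P A"
proof -
  have [measurable]: "A \<in> sets borel" "(\<lambda>x::real. 1 - x) -` A \<in> sets borel"
    using assms measurable_sets[of "\<lambda>x::real. 1 - x" borel borel A] by auto
  have "(\<lambda>x::real. 1 - x) -` (\<lambda>x. 1 - x) -` A = A" by auto
  then show "measure (distr P borel (\<lambda>x. 1 - x)) ((\<lambda>x. 1 - x) -` A) = measure P A"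
    by (simp add: measure_distr)
  have "self_similar.moment (distr P borel (\<lambda>x. 1 - x)) ((\<lambda>x. 1 - x) -` A) =
     (LINT y|P. indicator ((\<lambda>x. 1 - x) -` A) (1 - y) * (1/2 - (1 - y)))"
    unfolding self_similar.moment_def[OF reflected] by (subst integral_distr) auto
  also have "\<dots> = (LINT y|P. - (indicator A y * (1/2 - y)))"
    by (intro Bochner_Integration.integral_cong refl) (simp add: indicator_def)
  finally show "self_similar.moment (distr P borel (\<lambda>x. 1 - x)) ((\<lambda>x. 1 - x) -` A) = - moment A"
    by (simp add: moment_def)
qed

lemma moment_Compl:
  assumes "A \<in> sets borel"
  shows "moment (- A) = - moment A" "measure P (- A) = 1 - measure P A"
proof -
  have int: "integrable P (\<lambda>y. indicator A y * (1/2 - y))" "integrable P (\<lambda>y::real. 1/2 - y)"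
    using assms by (intro integrable_indicator_mult integrable_indicator integrable_continuous continuous_intros; simp)+
  have "moment (- A) = (LINT y|P. (1/2 - y) - indicator A y * (1/2 - y))"
    unfolding moment_def by (intro Bochner_Integration.integral_cong refl) (simp add: indicator_def)
  also have "\<dots> = (LINT y|P. 0 * y\<^sup>2 + (- 1) * y + 1/2) - moment A"
    using int by (simp add: moment_def)
  finally show "moment (- A) = - moment A" unfolding integral_quadratic by simp
  show "measure P (- A) = 1 - measure P A"
    using prob_compl[of A] assms by (simp add: Compl_eq_Diff_UNIV)
qed

lemma partition_cost:
  assumes A: "A \<in> sets borel"
  shows "(LINT y|P. indicator A y * (y - a)\<^sup>2 + (1 - indicator A y) * (y - b)\<^sup>2) =
    V + measure P A * (a - 1/2)\<^sup>2 + 2 * (a - 1/2) * moment A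
      + (1 - measure P A) * (b - 1/2)\<^sup>2 - 2 * (b - 1/2) * moment A"
proof -
  have int: "integrable P (\<lambda>y. indicator A y * (1/2 - y))"
      "integrable P (indicator A :: real \<Rightarrow> real)" "integrable P (\<lambda>y::real. (y - b)\<^sup>2)"
    using assms by (intro integrable_indicator_mult integrable_indicator integrable_continuous continuous_intros; simp)+
  have "(LINT y|P. indicator A y * (y - a)\<^sup>2 + (1 - indicator A y) * (y - b)\<^sup>2) =
    (LINT y|P. (y - b)\<^sup>2 + ((a - 1/2)\<^sup>2 - (b - 1/2)\<^sup>2) * indicator A y + 2 * (a - b) * (indicator A y * (1/2 - y)))"
    by (intro Bochner_Integration.integral_cong refl)
       (simp add: indicator_def power2_eq_square field_simps)
  also have "\<dots> = (LINT y|P. (y - b)\<^sup>2) + ((a - 1/2)\<^sup>2 - (b - 1/2)\<^sup>2) * measure P A + 2 * (a - b) * moment A"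
    using int A by (simp add: moment_def)
  also have "(LINT y|P. (y - b)\<^sup>2) = V + (1/2 - b)\<^sup>2"
    using integral_square_affine[of 1 "- b"] by simp
  finally show ?thesis by (simp add: power2_eq_square field_simps)
qed

text \<open>For a fixed cell \<open>A\<close> the cost is quadratic in \<open>a\<close> and in
  \<open>b\<close>. Completing both squares subtracts m^2/p and m^2/(1 - p), whose sum is m^2/(p (1
  - p)) and hence at most \<open>K\<close>.\<close>

lemma two_means_lower:
  assumes K: "0 \<le> K" "\<And>A. A \<in> sets borel \<Longrightarrow> (moment A)\<^sup>2 \<le> K * (measure P A * (1 - measure P A))"
  shows "V - K \<le> distortion P {a, b}"
proof -
  define A where "A = {y. \<bar>y - a\<bar> \<le> \<bar>y - b\<bar>}"
  define p where "p = measure P A"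
  define m where "m = moment A"
  have A: "A \<in> sets borel" unfolding A_def by measurable
  have p: "0 \<le> p" "p \<le> 1" by (auto simp: p_def)
  have m: "m\<^sup>2 \<le> K * (p * (1 - p))" using K(2)[OF A] by (simp add: m_def p_def)
  have "sqdist {a, b} y = indicator A y * (y - a)\<^sup>2 + (1 - indicator A y) * (y - b)\<^sup>2" for y
    by (auto simp: sqdist_def A_def indicator_def abs_le_square_iff)
  then have "distortion P {a, b} =
    V + p * (a - 1/2)\<^sup>2 + 2 * (a - 1/2) * m + (1 - p) * (b - 1/2)\<^sup>2 - 2 * (b - 1/2) * m"
    unfolding distortion_sqdist p_def m_def partition_cost[OF A, symmetric] by presburger
  also have "\<dots> \<ge> V - K"
  \<comment> \<open>One of the two points serves almost nothing here; the ellipse inequality forces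
    \<open>m = 0\<close> and replaces the division by p (1 - p).\<close>
  proof (cases "p = 0 \<or> p = 1")
    case True
    then have "m = 0" using m by auto
    then show ?thesis using p K(1) by (simp add: add_increasing2)
  next
    case False
    then have p': "0 < p" "p < 1" using p by auto
    have "p * (a - 1/2)\<^sup>2 + 2 * (a - 1/2) * m = p * (a - 1/2 + m / p)\<^sup>2 - m\<^sup>2 / p"
      using p' by (simp add: power2_eq_square field_simps)
    moreover have "(1 - p) * (b - 1/2)\<^sup>2 - 2 * (b - 1/2) * m = (1 - p) * (b - 1/2 - m / (1 - p))\<^sup>2 - m\<^sup>2 / (1 - p)"
      using p' by (simp add: power2_eq_square divide_simps) (simp add: algebra_simps)
    moreover have "m\<^sup>2 / p + m\<^sup>2 / (1 - p) = m\<^sup>2 / (p * (1 - p))"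
      using p' by (simp add: field_simps)
    moreover have "m\<^sup>2 / (p * (1 - p)) \<le> K"
      using m p' by (simp add: divide_le_eq)
    moreover have "0 \<le> p * (a - 1/2 + m / p)\<^sup>2" "0 \<le> (1 - p) * (b - 1/2 - m / (1 - p))\<^sup>2"
      using p by auto
    ultimately show ?thesis by linarith
  qed
  finally show ?thesis .
qed

end

text \<open>The difference of the two sides is concave in \<open>p\<close>.\<close>

lemma ellipse_chord:
  fixes K c s p p1 p2 :: real
  assumes "0 \<le> K" "p1 \<le> p" "p \<le> p2"
    and "(c + s * p1)\<^sup>2 \<le> K * (p1 * (1 - p1))" "(c + s * p2)\<^sup>2 \<le> K * (p2 * (1 - p2))"
  shows "(c + s * p)\<^sup>2 \<le> K * (p * (1 - p))"
proof (cases "p1 = p2")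
  case True
  then show ?thesis using assms by simp
next
  case False
  then have d: "0 < p2 - p1" using assms by simp
  define q where "q x = K * (x * (1 - x)) - (c + s * x)\<^sup>2" for x
  have "(p2 - p1) * q p = (p2 - p) * q p1 + (p - p1) * q p2 + (K + s\<^sup>2) * ((p2 - p1) * ((p - p1) * (p2 - p)))"
    by (simp add: q_def power2_eq_square algebra_simps)
  moreover have "0 \<le> (p2 - p) * q p1" "0 \<le> (p - p1) * q p2" "0 \<le> (K + s\<^sup>2) * ((p2 - p1) * ((p - p1) * (p2 - p)))"
    using assms d by (auto simp: q_def)
  ultimately have "0 \<le> (p2 - p1) * q p" by linarith
  then show ?thesis using d by (simp add: zero_le_mult_iff q_def)
qed

text \<open>Taking complements turns p into 1 - p and changes the sign of the moment; reflection
  changes the sign alone. Upper bounds for \<open>p \<le> 1/2\<close> therefore suffice, provided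
  they hold for the reflected measure too, which is why \<open>half\<close> quantifies over
  \<open>P\<close>.\<close>

lemma moment_ellipse:
  assumes half: "\<And>P A. self_similar r P \<Longrightarrow> A \<in> sets borel \<Longrightarrow> measure P A \<le> 1/2 \<Longrightarrow>
      self_similar.moment P A \<le> sqrt (K * (measure P A * (1 - measure P A)))"
    and "0 \<le> K" "self_similar r P" and A: "A \<in> sets borel"
  shows "(self_similar.moment P A)\<^sup>2 \<le> K * (measure P A * (1 - measure P A))"
proof -
  interpret self_similar r P by fact
  have abs: "\<bar>moment A\<bar> \<le> sqrt (K * (measure P A * (1 - measure P A)))"
    if A: "A \<in> sets borel" and "measure P A \<le> 1/2" for A
  proof -
    have "(\<lambda>x. 1 - x) -` A \<in> sets borel"
      using A measurable_sets[of "\<lambda>x::real. 1 - x" borel borel A] by auto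
    from half[OF reflected this] have "- moment A \<le> sqrt (K * (measure P A * (1 - measure P A)))"
      unfolding moment_reflected[OF A] using that by simp
    with half[OF assms(3) A] that show ?thesis by simp
  qed
  have "\<bar>moment A\<bar> \<le> sqrt (K * (measure P A * (1 - measure P A)))"
  proof (cases "measure P A \<le> 1/2")
    case False
    have "- A \<in> sets borel" using A by auto
    from abs[OF this] show ?thesis
      unfolding moment_Compl[OF A] using False by (simp add: mult.commute)
  qed (rule abs[OF A])
  moreover have "0 \<le> K * (measure P A * (1 - measure P A))" using assms(2) by simp
  ultimately show ?thesis
    by (metis abs_ge_zero power2_abs power_mono real_sqrt_pow2)
qed

lemma square_le_const:
  fixes l u k K q :: real
  assumes "0 \<le> l" "l \<le> u" "u\<^sup>2 \<le> k * q" "k \<le> K" "0 \<le> q"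
  shows "l\<^sup>2 \<le> K * q"
proof -
  have "l\<^sup>2 \<le> u\<^sup>2" using assms by (intro power_mono) auto
  also have "\<dots> \<le> k * q" by fact
  also have "\<dots> \<le> K * q" using assms by (intro mult_right_mono) auto
  finally show ?thesis .
qed

text \<open>The value m^2 / (p (1 - p)) for \<open>p = 4/9\<close> and m = (1 - r)(3 + r)/18, the
  mass and the moment of the cell of the first point of \<open>gamma2\<close>.\<close>

definition gain :: "real \<Rightarrow> real" where
  "gain r = ((1 - r) * (3 + r))\<^sup>2 / 80"

section \<open>Exact values at end points of cylinders, and the sides of the polygon\<close>

context self_similar
begin

definition hinge_at :: "real \<Rightarrow> real \<Rightarrow> bool" where
  "hinge_at z h \<longleftrightarrow> 0 \<le> z \<and> z \<le> 1 \<and> hinge z = h"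

lemma hinge_at_ends: "hinge_at 0 0" "hinge_at 1 (1/2)"
  by (simp_all add: hinge_at_def hinge_0 hinge_1)

lemma hinge_at_S:
  assumes "hinge_at z h"
  shows "S r 1 z = z' \<Longrightarrow> r / 3 * h = h' \<Longrightarrow> hinge_at z' h'"
    and "S r 2 z = z' \<Longrightarrow> (z' - r / 2 + r * h) / 3 = h' \<Longrightarrow> hinge_at z' h'"
    and "S r 3 z = z' \<Longrightarrow> (2 * z' - r / 2 - 1 / 2 + r * h) / 3 = h' \<Longrightarrow> hinge_at z' h'"
  using S_unit[of 1 z] S_unit[of 2 z] S_unit[of 3 z] hinge_S[of z] assms by (auto simp: hinge_at_def)

text \<open>The digits in these names are a word followed by the end, 0 or 1, of the unit interval
  to which its map is applied: \<open>hinge_211\<close> belongs to S_2(S_1(1)). The values give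
  sides of the polygon or serve to compute such values.\<close>

lemma hinge_11: "hinge_at (r) (1/6 * r)"
  by (rule hinge_at_S(1)[OF hinge_at_ends(2)]) (simp_all add: S_def power_eq_if field_simps)

lemma hinge_20: "hinge_at (1/2 - 1/2 * r) (1/6 - 1/3 * r)"
  by (rule hinge_at_S(2)[OF hinge_at_ends(1)]) (simp_all add: S_def power_eq_if field_simps)

lemma hinge_211: "hinge_at (1/2 - 1/2 * r + r^2) (1/6 - 1/3 * r + 7/18 * r^2)"
  by (rule hinge_at_S(2)[OF hinge_11]) (simp_all add: S_def power_eq_if field_simps)

lemma hinge_220: "hinge_at (1/2 - 1/2 * r^2) (1/6 - 1/9 * r - 5/18 * r^2)"
  by (rule hinge_at_S(2)[OF hinge_20]) (simp_all add: S_def power_eq_if field_simps)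

lemma hinge_30: "hinge_at (1 - r) (1/2 - 5/6 * r)"
  by (rule hinge_at_S(3)[OF hinge_at_ends(1)]) (simp_all add: S_def power_eq_if field_simps)

lemma hinge_130: "hinge_at (r - r^2) (1/6 * r - 5/18 * r^2)"
  by (rule hinge_at_S(1)[OF hinge_30]) (simp_all add: S_def power_eq_if field_simps)

lemma hinge_2130: "hinge_at (1/2 - 1/2 * r + r^2 - r^3) (1/6 - 1/3 * r + 7/18 * r^2 - 23/54 * r^3)"
  by (rule hinge_at_S(2)[OF hinge_130]) (simp_all add: S_def power_eq_if field_simps)

lemma hinge_22130: "hinge_at (1/2 - 1/2 * r^2 + r^3 - r^4) (1/6 - 1/9 * r - 5/18 * r^2 + 25/54 * r^3 - 77/162 * r^4)"
  by (rule hinge_at_S(2)[OF hinge_2130]) (simp_all add: S_def power_eq_if field_simps)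

lemma hinge_2211: "hinge_at (1/2 - 1/2 * r^2 + r^3) (1/6 - 1/9 * r - 5/18 * r^2 + 25/54 * r^3)"
  by (rule hinge_at_S(2)[OF hinge_211]) (simp_all add: S_def power_eq_if field_simps)

lemma hinge_2220: "hinge_at (1/2 - 1/2 * r^3) (1/6 - 1/9 * r - 1/27 * r^2 - 7/27 * r^3)"
  by (rule hinge_at_S(2)[OF hinge_220]) (simp_all add: S_def power_eq_if field_simps)

lemma hinge_22220: "hinge_at (1/2 - 1/2 * r^4) (1/6 - 1/9 * r - 1/27 * r^2 - 1/81 * r^3 - 41/162 * r^4)"
  by (rule hinge_at_S(2)[OF hinge_2220]) (simp_all add: S_def power_eq_if field_simps)

text \<open>One side of the polygon: by concavity it is enough that its two ends lie inside the
  ellipse.\<close>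

lemma moment_le_chord:
  assumes "A \<in> sets borel" "0 \<le> K" "p1 \<le> measure P A" "measure P A \<le> p2" "hinge_at x c"
    and "(c + (1/2 - x) * p1)\<^sup>2 \<le> K * (p1 * (1 - p1))" "(c + (1/2 - x) * p2)\<^sup>2 \<le> K * (p2 * (1 - p2))"
  shows "moment A \<le> sqrt (K * (measure P A * (1 - measure P A)))"
proof -
  have "moment A \<le> c + (1/2 - x) * measure P A"
    using moment_le_hinge[OF assms(1), of x] assms(5) by (simp add: hinge_at_def)
  also have "\<dots> \<le> \<bar>c + (1/2 - x) * measure P A\<bar>" by simp
  also have "\<dots> = sqrt ((c + (1/2 - x) * measure P A)\<^sup>2)" by simp
  also have "\<dots> \<le> sqrt (K * (measure P A * (1 - measure P A)))"
    by (intro real_sqrt_le_mono ellipse_chord[OF assms(2-4,6,7)])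
  finally show ?thesis .
qed

end

text \<open>The polygon formed by the lines of \<open>moment_le_hinge\<close>, \<open>x\<close> running through end points of cylinders,
  lies inside the ellipse \<open>m\<^sup>2 = gain r * p * (1 - p)\<close>. It touches the ellipse at \<open>p = 1/3\<close> and
  \<open>p = 4/9\<close> for \<open>r\<^sub>0\<close>, and at \<open>p = 4/9\<close> and \<open>p = 13/27\<close> for \<open>r\<^sub>1\<close>; at these vertices the
  comparison is an exact identity, at the others it is numerical.\<close>

lemma moment_half_r0:
  assumes "self_similar r P" "A \<in> sets borel" "measure P A \<le> 1/2"
    and eq: "(3 + r)\<^sup>2 = 10" and r: "16227/100000 \<le> r" "r \<le> 4057/25000"
  shows "self_similar.moment P A \<le> sqrt (gain r * (measure P A * (1 - measure P A)))"
proof -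
  interpret self_similar r P by fact
  have r2: "263315529/10000000000 \<le> r^2" "r^2 \<le> 16459249/625000000"
    using power_mono[OF r(1), of 2] power_mono[OF r(2), of 2] r_pos by (simp_all add: power_divide)
  have gain: "87721/1000000 \<le> gain r"
  proof -
    have "(1 - r) * (3 + r) = 3 - 2 * r - r^2" by (simp add: power2_eq_square algebra_simps)
    then have "1655690751/625000000 \<le> (1 - r) * (3 + r)" using r r2 by simp
    then have "(1655690751/625000000)\<^sup>2 \<le> ((1 - r) * (3 + r))\<^sup>2" by (intro power_mono) auto
    then show ?thesis by (simp add: gain_def power_divide)
  qed
  have gain0: "0 \<le> gain r" by (simp add: gain_def)
  let ?p = "measure P A"
  note chord = moment_le_chord[OF assms(2) gain0]
  note num = r r2 gain
  have "0 \<le> ?p" by simp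
  \<comment> \<open>Abscissas of the vertices. 1/3 and 4/9 are the masses to the left of holes of
    the support; 7/18 is their midpoint, where the lines of the two ends of
    \<open>J r [2, 1]\<close> meet. 1/5 replaces the true vertex 1/6: both neighbouring lines are
    still below the ellipse there.\<close>
  then consider "0 \<le> ?p" "?p \<le> 1/5" | "1/5 \<le> ?p" "?p \<le> 1/3" | "1/3 \<le> ?p" "?p \<le> 7/18" | "7/18 \<le> ?p" "?p \<le> 4/9" | "4/9 \<le> ?p" "?p \<le> 1/2"
    using assms(3) by linarith
  then show ?thesis
  proof cases
    case 1
    show ?thesis
    proof (rule chord[OF 1 hinge_at_ends(1)])
      show "(0 + (1/2 - 0) * 0)\<^sup>2 \<le> gain r * (0 * (1 - 0))" by simp
      show "(0 + (1/2 - 0) * (1/5))\<^sup>2 \<le> gain r * (1/5 * (1 - 1/5))"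
        \<comment> \<open>\<open>u\<close> bounds the line from above at this abscissa and
          \<open>k\<close> bounds \<open>gain r\<close> from below, which leaves a comparison of
          rational numbers.\<close>
        by (rule square_le_const[where u = "1/10" and k = "87721/1000000"]) (use num in \<open>simp_all add: power_divide field_simps\<close>)
    qed
  next
    case 2
    show ?thesis
    proof (rule chord[OF 2 hinge_11])
      show "(1/6 * r + (1/2 - (r)) * (1/5))\<^sup>2 \<le> gain r * (1/5 * (1 - 1/5))"
        by (rule square_le_const[where u = "94591/1000000" and k = "87721/1000000"]) (use num in \<open>simp_all add: power_divide field_simps\<close>)
      \<comment> \<open>A vertex on the ellipse: with (3 + r)^2 = 10 both sides equal (1 - r)^2 /
        36.\<close>
      have line: "1/6 * r + (1/2 - (r)) * (1/3) = (1 - r) / 6"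
        by (simp add: power_eq_if field_simps)
      show "(1/6 * r + (1/2 - (r)) * (1/3))\<^sup>2 \<le> gain r * (1/3 * (1 - 1/3))"
        unfolding line using eq by (simp add: gain_def power_divide power_mult_distrib)
    qed
  next
    case 3
    show ?thesis
    proof (rule chord[OF 3 hinge_20])
      have line: "1/6 - 1/3 * r + (1/2 - (1/2 - 1/2 * r)) * (1/3) = (1 - r) / 6"
        by (simp add: power_eq_if field_simps)
      show "(1/6 - 1/3 * r + (1/2 - (1/2 - 1/2 * r)) * (1/3))\<^sup>2 \<le> gain r * (1/3 * (1 - 1/3))"
        unfolding line using eq by (simp add: gain_def power_divide power_mult_distrib)
      show "(1/6 - 1/3 * r + (1/2 - (1/2 - 1/2 * r)) * (7/18))\<^sup>2 \<le> gain r * (7/18 * (1 - 7/18))"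
        by (rule square_le_const[where u = "14413/100000" and k = "87721/1000000"]) (use num in \<open>simp_all add: power_divide field_simps\<close>)
    qed
  next
    case 4
    show ?thesis
    proof (rule chord[OF 4 hinge_211])
      show "(1/6 - 1/3 * r + 7/18 * r^2 + (1/2 - (1/2 - 1/2 * r + r^2)) * (7/18))\<^sup>2 \<le> gain r * (7/18 * (1 - 7/18))"
        by (rule square_le_const[where u = "14413/100000" and k = "87721/1000000"]) (use num in \<open>simp_all add: power_divide field_simps\<close>)
      \<comment> \<open>At mass 4/9 equality holds for every \<open>r\<close>, by the choice of
        \<open>gain\<close>.\<close>
      have line: "1/6 - 1/3 * r + 7/18 * r^2 + (1/2 - (1/2 - 1/2 * r + r^2)) * (4/9) = (1 - r) * (3 + r) / 18"
        by (simp add: power_eq_if field_simps)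
      show "(1/6 - 1/3 * r + 7/18 * r^2 + (1/2 - (1/2 - 1/2 * r + r^2)) * (4/9))\<^sup>2 \<le> gain r * (4/9 * (1 - 4/9))"
        unfolding line using eq by (simp add: gain_def power_divide power_mult_distrib)
    qed
  next
    case 5
    show ?thesis
    proof (rule chord[OF 5 hinge_220])
      have line: "1/6 - 1/9 * r - 5/18 * r^2 + (1/2 - (1/2 - 1/2 * r^2)) * (4/9) = (1 - r) * (3 + r) / 18"
        by (simp add: power_eq_if field_simps)
      show "(1/6 - 1/9 * r - 5/18 * r^2 + (1/2 - (1/2 - 1/2 * r^2)) * (4/9))\<^sup>2 \<le> gain r * (4/9 * (1 - 4/9))"
        unfolding line using eq by (simp add: gain_def power_divide power_mult_distrib)
      show "(1/6 - 1/9 * r - 5/18 * r^2 + (1/2 - (1/2 - 1/2 * r^2)) * (1/2))\<^sup>2 \<le> gain r * (1/2 * (1 - 1/2))"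
        by (rule square_le_const[where u = "73953/500000" and k = "87721/1000000"]) (use num in \<open>simp_all add: power_divide field_simps\<close>)
    qed
  qed
qed

lemma moment_half_r1:
  assumes "self_similar r P" "A \<in> sets borel" "measure P A \<le> 1/2"
    and eq: "10 * (9 + 3 * r + r\<^sup>2)\<^sup>2 = 91 * (3 + r)\<^sup>2" and r: "23176263/100000000 \<le> r" "r \<le> 2897033/12500000"
  shows "self_similar.moment P A \<le> sqrt (gain r * (measure P A * (1 - measure P A)))"
proof -
  interpret self_similar r P by fact
  have eq': "(9 + 3 * r + r\<^sup>2)\<^sup>2 = 91 / 10 * (3 + r)\<^sup>2" using eq by simp
  have r2: "6714239583/125000000000 \<le> r^2" "r^2 \<le> 537139213/10000000000"
    using power_mono[OF r(1), of 2] power_mono[OF r(2), of 2] r_pos by (simp_all add: power_divide)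
  have r3: "12448878593/1000000000000 \<le> r^3" "r^3 \<le> 6224440103/500000000000"
    using power_mono[OF r(1), of 3] power_mono[OF r(2), of 3] r_pos by (simp_all add: power_divide)
  have r4: "2885184843/1000000000000 \<le> r^4" "r^4 \<le> 1442592671/500000000000"
    using power_mono[OF r(1), of 4] power_mono[OF r(2), of 4] r_pos by (simp_all add: power_divide)
  have gain: "770512647/10000000000 \<le> gain r"
  proof -
    have "(1 - r) * (3 + r) = 3 - 2 * r - r^2" by (simp add: power2_eq_square algebra_simps)
    then have "24827607987/10000000000 \<le> (1 - r) * (3 + r)" using r r2 by simp
    then have "(24827607987/10000000000)\<^sup>2 \<le> ((1 - r) * (3 + r))\<^sup>2" by (intro power_mono) auto
    then show ?thesis by (simp add: gain_def power_divide)
  qed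
  have gain0: "0 \<le> gain r" by (simp add: gain_def)
  let ?p = "measure P A"
  note chord = moment_le_chord[OF assms(2) gain0]
  note num = r r2 r3 r4 gain
  have "0 \<le> ?p" by simp
  \<comment> \<open>7/18, 4/9, 77/162 and 13/27 are exact intersections of neighbouring lines. 7/30,
    169/368 and 99/202 are rational approximations to intersections that depend on
    \<open>r\<close>.\<close>
  then consider "0 \<le> ?p" "?p \<le> 7/30" | "7/30 \<le> ?p" "?p \<le> 7/18" | "7/18 \<le> ?p" "?p \<le> 4/9" | "4/9 \<le> ?p" "?p \<le> 169/368" | "169/368 \<le> ?p" "?p \<le> 77/162" | "77/162 \<le> ?p" "?p \<le> 13/27" | "13/27 \<le> ?p" "?p \<le> 99/202" | "99/202 \<le> ?p" "?p \<le> 1/2"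
    using assms(3) by linarith
  then show ?thesis
  proof cases
    case 1
    show ?thesis
    proof (rule chord[OF 1 hinge_at_ends(1)])
      show "(0 + (1/2 - 0) * 0)\<^sup>2 \<le> gain r * (0 * (1 - 0))" by simp
      show "(0 + (1/2 - 0) * (7/30))\<^sup>2 \<le> gain r * (7/30 * (1 - 7/30))"
        by (rule square_le_const[where u = "72916667/625000000" and k = "770512647/10000000000"]) (use num in \<open>simp_all add: power_divide field_simps\<close>)
    qed
  next
    case 2
    show ?thesis
    proof (rule chord[OF 2 hinge_20])
      show "(1/6 - 1/3 * r + (1/2 - (1/2 - 1/2 * r)) * (7/30))\<^sup>2 \<le> gain r * (7/30 * (1 - 7/30))"
        by (rule square_le_const[where u = "1164514307/10000000000" and k = "770512647/10000000000"]) (use num in \<open>simp_all add: power_divide field_simps\<close>)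
      show "(1/6 - 1/3 * r + (1/2 - (1/2 - 1/2 * r)) * (7/18))\<^sup>2 \<le> gain r * (7/18 * (1 - 7/18))"
        by (rule square_le_const[where u = "134477413/1000000000" and k = "770512647/10000000000"]) (use num in \<open>simp_all add: power_divide field_simps\<close>)
    qed
  next
    case 3
    show ?thesis
    proof (rule chord[OF 3 hinge_211])
      show "(1/6 - 1/3 * r + 7/18 * r^2 + (1/2 - (1/2 - 1/2 * r + r^2)) * (7/18))\<^sup>2 \<le> gain r * (7/18 * (1 - 7/18))"
        by (rule square_le_const[where u = "134477413/1000000000" and k = "770512647/10000000000"]) (use num in \<open>simp_all add: power_divide field_simps\<close>)
      have line: "1/6 - 1/3 * r + 7/18 * r^2 + (1/2 - (1/2 - 1/2 * r + r^2)) * (4/9) = (1 - r) * (3 + r) / 18"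
        by (simp add: power_eq_if field_simps)
      show "(1/6 - 1/3 * r + 7/18 * r^2 + (1/2 - (1/2 - 1/2 * r + r^2)) * (4/9))\<^sup>2 \<le> gain r * (4/9 * (1 - 4/9))"
        unfolding line by (simp add: gain_def power_divide power_mult_distrib eq')
    qed
  next
    case 4
    show ?thesis
    proof (rule chord[OF 4 hinge_220])
      have line: "1/6 - 1/9 * r - 5/18 * r^2 + (1/2 - (1/2 - 1/2 * r^2)) * (4/9) = (1 - r) * (3 + r) / 18"
        by (simp add: power_eq_if field_simps)
      show "(1/6 - 1/9 * r - 5/18 * r^2 + (1/2 - (1/2 - 1/2 * r^2)) * (4/9))\<^sup>2 \<le> gain r * (4/9 * (1 - 4/9))"
        unfolding line by (simp add: gain_def power_divide power_mult_distrib eq')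
      show "(1/6 - 1/9 * r - 5/18 * r^2 + (1/2 - (1/2 - 1/2 * r^2)) * (169/368))\<^sup>2 \<le> gain r * (169/368 * (1 - 169/368))"
        by (rule square_le_const[where u = "1383284977/10000000000" and k = "770512647/10000000000"]) (use num in \<open>simp_all add: power_divide field_simps\<close>)
    qed
  next
    case 5
    show ?thesis
    proof (rule chord[OF 5 hinge_22130])
      show "(1/6 - 1/9 * r - 5/18 * r^2 + 25/54 * r^3 - 77/162 * r^4 + (1/2 - (1/2 - 1/2 * r^2 + r^3 - r^4)) * (169/368))\<^sup>2 \<le> gain r * (169/368 * (1 - 169/368))"
        by (rule square_le_const[where u = "1383284917/10000000000" and k = "770512647/10000000000"]) (use num in \<open>simp_all add: power_divide field_simps\<close>)
      show "(1/6 - 1/9 * r - 5/18 * r^2 + 25/54 * r^3 - 77/162 * r^4 + (1/2 - (1/2 - 1/2 * r^2 + r^3 - r^4)) * (77/162))\<^sup>2 \<le> gain r * (77/162 * (1 - 77/162))"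
        by (rule square_le_const[where u = "69303193/500000000" and k = "770512647/10000000000"]) (use num in \<open>simp_all add: power_divide field_simps\<close>)
    qed
  next
    case 6
    show ?thesis
    proof (rule chord[OF 6 hinge_2211])
      show "(1/6 - 1/9 * r - 5/18 * r^2 + 25/54 * r^3 + (1/2 - (1/2 - 1/2 * r^2 + r^3)) * (77/162))\<^sup>2 \<le> gain r * (77/162 * (1 - 77/162))"
        by (rule square_le_const[where u = "69303193/500000000" and k = "770512647/10000000000"]) (use num in \<open>simp_all add: power_divide field_simps\<close>)
      \<comment> \<open>The cut after 1, 21, 221. It ties with the cut at 4/9 by the equation for
        \<open>r\<close>, so this vertex is on the ellipse as well.\<close>
      have line: "1/6 - 1/9 * r - 5/18 * r^2 + 25/54 * r^3 + (1/2 - (1/2 - 1/2 * r^2 + r^3)) * (13/27) = (1 - r) * (9 + 3 * r + r\<^sup>2) / 54"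
        by (simp add: power_eq_if field_simps)
      show "(1/6 - 1/9 * r - 5/18 * r^2 + 25/54 * r^3 + (1/2 - (1/2 - 1/2 * r^2 + r^3)) * (13/27))\<^sup>2 \<le> gain r * (13/27 * (1 - 13/27))"
        unfolding line by (simp add: gain_def power_divide power_mult_distrib eq')
    qed
  next
    case 7
    show ?thesis
    proof (rule chord[OF 7 hinge_2220])
      have line: "1/6 - 1/9 * r - 1/27 * r^2 - 7/27 * r^3 + (1/2 - (1/2 - 1/2 * r^3)) * (13/27) = (1 - r) * (9 + 3 * r + r\<^sup>2) / 54"
        by (simp add: power_eq_if field_simps)
      show "(1/6 - 1/9 * r - 1/27 * r^2 - 7/27 * r^3 + (1/2 - (1/2 - 1/2 * r^3)) * (13/27))\<^sup>2 \<le> gain r * (13/27 * (1 - 13/27))"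
        unfolding line by (simp add: gain_def power_divide power_mult_distrib eq')
      show "(1/6 - 1/9 * r - 1/27 * r^2 - 7/27 * r^3 + (1/2 - (1/2 - 1/2 * r^3)) * (99/202))\<^sup>2 \<le> gain r * (99/202 * (1 - 99/202))"
        by (rule square_le_const[where u = "1387489641/10000000000" and k = "770512647/10000000000"]) (use num in \<open>simp_all add: power_divide field_simps\<close>)
    qed
  next
    case 8
    show ?thesis
    proof (rule chord[OF 8 hinge_22220])
      show "(1/6 - 1/9 * r - 1/27 * r^2 - 1/81 * r^3 - 41/162 * r^4 + (1/2 - (1/2 - 1/2 * r^4)) * (99/202))\<^sup>2 \<le> gain r * (99/202 * (1 - 99/202))"
        by (rule square_le_const[where u = "1387489817/10000000000" and k = "770512647/10000000000"]) (use num in \<open>simp_all add: power_divide field_simps\<close>)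
      show "(1/6 - 1/9 * r - 1/27 * r^2 - 1/81 * r^3 - 41/162 * r^4 + (1/2 - (1/2 - 1/2 * r^4)) * (1/2))\<^sup>2 \<le> gain r * (1/2 * (1 - 1/2))"
        by (rule square_le_const[where u = "173454081/1250000000" and k = "770512647/10000000000"]) (use num in \<open>simp_all add: power_divide field_simps\<close>)
    qed
  qed
qed

text \<open>The numerical enclosures only select the root in question.\<close>

definition critical :: "real \<Rightarrow> bool" where
  "critical r \<longleftrightarrow> (3 + r)\<^sup>2 = 10 \<and> 16227/100000 \<le> r \<and> r \<le> 4057/25000 \<or>
     10 * (9 + 3 * r + r\<^sup>2)\<^sup>2 = 91 * (3 + r)\<^sup>2 \<and> 23176263/100000000 \<le> r \<and> r \<le> 2897033/12500000"

lemma (in self_similar) two_means: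
  assumes "critical r"
  shows "V - gain r \<le> distortion P {a, b}"
proof (rule two_means_lower)
  show "0 \<le> gain r" by (simp add: gain_def)
  fix A :: "real set" assume "A \<in> sets borel"
  show "(moment A)\<^sup>2 \<le> gain r * (measure P A * (1 - measure P A))"
  proof (rule moment_ellipse)
    show "self_similar.moment P A \<le> sqrt (gain r * (measure P A * (1 - measure P A)))"
      if "self_similar r P" "A \<in> sets borel" "measure P A \<le> 1/2" for P A
      using assms moment_half_r0[OF that] moment_half_r1[OF that] by (auto simp: critical_def)
  qed (use self_similar_axioms \<open>A \<in> sets borel\<close> in \<open>auto simp: gain_def\<close>)
qed

section \<open>The Lagrangian lower bound\<close>

context self_similar
begin

lemma distortion_ge_V:
  assumes "card \<beta> = 1"
  shows "V \<le> distortion P \<beta>"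
  using assms by (auto simp: card_1_singleton_iff distortion_singleton)

definition far_cost :: "real \<Rightarrow> real" where
  "far_cost t = (if r \<le> t then (r\<^sup>2 * V + (t - r / 2)\<^sup>2) / 3 else 0)"

lemma far_cost_mono: "s \<le> t \<Longrightarrow> far_cost s \<le> far_cost t"
proof -
  assume "s \<le> t"
  moreover have "(s - r / 2)\<^sup>2 \<le> (t - r / 2)\<^sup>2" if "r \<le> s"
    using that \<open>s \<le> t\<close> r_pos by (intro power_mono) auto
  moreover have "0 \<le> r\<^sup>2 * V + (t - r / 2)\<^sup>2" using V_pos by simp
  ultimately show ?thesis by (auto simp: far_cost_def)
qed

lemma child_1_far_cost:
  assumes "finite \<beta>" "\<beta> \<noteq> {}" "\<And>b. b \<in> \<beta> \<Longrightarrow> t \<le> \<bar>b\<bar>"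
  shows "far_cost t \<le> child 1 \<beta> / 3"
  using child_1_far[of \<beta> t] child_nonneg[of \<beta> 1] assms by (auto simp: far_cost_def)

lemma child_3_far_cost:
  assumes "finite \<beta>" "\<beta> \<noteq> {}" "\<And>b. b \<in> \<beta> \<Longrightarrow> t \<le> \<bar>b - 1\<bar>"
  shows "far_cost t \<le> child 3 \<beta> / 3"
  using child_3_far[of \<beta> t] child_nonneg[of \<beta> 3] assms by (auto simp: far_cost_def)

lemma distortion_far_left:
  assumes "finite \<beta>" "\<beta> \<noteq> {}" "\<And>b. b \<in> \<beta> \<Longrightarrow> t \<le> \<bar>b\<bar>"
  shows "far_cost t \<le> distortion P \<beta>"
  using child_1_far_cost[OF assms] child_nonneg[OF assms(1,2)] distortion_child[OF assms(1,2)]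
  by (simp add: add_divide_distrib add_increasing2)

lemma distortion_far_right:
  assumes "finite \<beta>" "\<beta> \<noteq> {}" "\<And>b. b \<in> \<beta> \<Longrightarrow> t \<le> \<bar>b - 1\<bar>"
  shows "far_cost t \<le> distortion P \<beta>"
  using child_3_far_cost[OF assms] child_nonneg[OF assms(1,2)] distortion_child[OF assms(1,2)]
  by (simp add: add_divide_distrib add_increasing)

lemma distortion_far_both:
  assumes "finite \<beta>" "\<beta> \<noteq> {}" "\<And>b. b \<in> \<beta> \<Longrightarrow> t \<le> \<bar>b\<bar>" "\<And>b. b \<in> \<beta> \<Longrightarrow> s \<le> \<bar>b - 1\<bar>"
  shows "far_cost t + far_cost s \<le> distortion P \<beta>"
  using child_1_far_cost[OF assms(1-3)] child_3_far_cost[OF assms(1,2,4)]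
    child_nonneg[OF assms(1,2), of 2] distortion_child[OF assms(1,2)]
  by (simp add: add_divide_distrib)

lemma card_ge_2:
  assumes "finite \<beta>" "a \<in> \<beta>" "\<beta> \<noteq> {a}"
  shows "2 \<le> card \<beta>"
proof -
  have "card \<beta> \<noteq> 0" using assms by auto
  moreover have "card \<beta> \<noteq> 1" using assms by (auto simp: card_1_singleton_iff)
  ultimately show ?thesis by linarith
qed

text \<open>The whole charge goes to a piece that sees the shared point at distance at least
  \<open>gap / 2\<close>; of two distances with sum \<open>gap\<close>, one is that large. Such a
  set either is a single point outside the open unit interval, with distortion at least V + 1/4, or
  has two points, and then the count contributes \<open>2 * lam\<close> on top of the far
  cost.\<close>

lemma easy_step:
  fixes lam \<Phi> :: real
  assumes lam: "0 \<le> lam"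
    and base: "\<And>\<beta>. finite \<beta> \<Longrightarrow> \<beta> \<noteq> {} \<Longrightarrow> \<Phi> \<le> distortion P \<beta> + lam * card \<beta>"
    and \<Phi>: "\<Phi> \<le> V + 1/4" "\<Phi> \<le> far_cost (gap / 2) + lam" "\<Phi> \<le> 2 * far_cost (gap / 2)"
    and \<alpha>: "finite \<alpha>" "\<alpha> \<noteq> {}"
  shows "r\<^sup>2 * \<Phi> \<le> distortion P \<alpha> + r\<^sup>2 / 3 * lam * card \<alpha>"
proof (rule lagrange_step[where e = "\<lambda>t. if gap / 2 \<le> t then lam else 0", OF lam base _ _ _ _ _ \<alpha>])
  have c: "0 < gap" using r_pos r_less by (simp add: gap_def)
  have l: "\<Phi> + lam \<le> distortion P \<beta> + lam * card \<beta>" if \<beta>: "finite \<beta>" "a \<in> \<beta>" "\<beta> \<noteq> {a}" "far_cost (gap / 2) \<le> distortion P \<beta>"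
    for \<beta> and a :: real
  proof -
    have "lam * real 2 \<le> lam * card \<beta>"
      using card_ge_2[OF \<beta>(1-3)] lam by (intro mult_left_mono of_nat_mono)
    then show ?thesis using \<Phi>(2) \<beta>(4) by simp
  qed
  have s: "\<Phi> + lam \<le> distortion P \<beta> + lam * card \<beta>" if \<beta>: "\<beta> = {a}" "1/2 \<le> \<bar>1/2 - a\<bar>" for \<beta> a
  proof -
    have "(1/2)\<^sup>2 \<le> (1/2 - a)\<^sup>2" using \<beta>(2) by (simp add: abs_le_square_iff[symmetric])
    then show ?thesis using \<Phi>(1) \<beta>(1) by (simp add: distortion_singleton power_divide)
  qed
  {
    fix \<beta> and t :: real assume \<beta>: "finite \<beta>" "0 \<le> t" "- t \<in> \<beta>" "\<And>b. b \<in> \<beta> \<Longrightarrow> t \<le> \<bar>b\<bar>"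
    have "far_cost (gap / 2) \<le> distortion P \<beta>" if "gap / 2 \<le> t"
      using distortion_far_left[OF \<beta>(1) _ \<beta>(4)] \<beta>(3) far_cost_mono[OF that] by fastforce
    then have "\<Phi> + lam \<le> distortion P \<beta> + lam * card \<beta>" if "gap / 2 \<le> t"
      using l[OF \<beta>(1,3)] s[of \<beta> "- t"] \<beta>(2) that by (cases "\<beta> = {- t}") simp_all
    moreover have "\<Phi> \<le> distortion P \<beta> + lam * card \<beta>" using base[OF \<beta>(1)] \<beta>(3) by blast
    ultimately show "\<Phi> + (if gap / 2 \<le> t then lam else 0) \<le> distortion P \<beta> + lam * card \<beta>" by simp
  }
  {
    fix \<beta> and t :: real assume \<beta>: "finite \<beta>" "0 \<le> t" "1 + t \<in> \<beta>" "\<And>b. b \<in> \<beta> \<Longrightarrow> t \<le> \<bar>b - 1\<bar>"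
    have "far_cost (gap / 2) \<le> distortion P \<beta>" if "gap / 2 \<le> t"
      using distortion_far_right[OF \<beta>(1) _ \<beta>(4)] \<beta>(3) far_cost_mono[OF that] by fastforce
    then have "\<Phi> + lam \<le> distortion P \<beta> + lam * card \<beta>" if "gap / 2 \<le> t"
      using l[OF \<beta>(1,3)] s[of \<beta> "1 + t"] \<beta>(2) that by (cases "\<beta> = {1 + t}") simp_all
    moreover have "\<Phi> \<le> distortion P \<beta> + lam * card \<beta>" using base[OF \<beta>(1)] \<beta>(3) by blast
    ultimately show "\<Phi> + (if gap / 2 \<le> t then lam else 0) \<le> distortion P \<beta> + lam * card \<beta>" by simp
  }
  {
    fix \<beta> and s t :: real
    assume \<beta>: "finite \<beta>" "0 \<le> t" "- t \<in> \<beta>" "\<And>b. b \<in> \<beta> \<Longrightarrow> t \<le> \<bar>b\<bar>"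
      "0 \<le> s" "1 + s \<in> \<beta>" "\<And>b. b \<in> \<beta> \<Longrightarrow> s \<le> \<bar>b - 1\<bar>"
    then have ne: "\<beta> \<noteq> {}" "\<beta> \<noteq> {- t}" by auto
    have far: "far_cost t + far_cost s \<le> distortion P \<beta>"
      by (rule distortion_far_both[OF \<beta>(1) ne(1) \<beta>(4,7)])
    have "far_cost t \<ge> 0" "far_cost s \<ge> 0" using V_pos by (auto simp: far_cost_def)
    moreover have "2 * lam \<le> lam * card \<beta>"
      using card_ge_2[OF \<beta>(1,3) ne(2)] lam by (simp add: mult.commute mult_left_mono)
    ultimately show "\<Phi> + (if gap / 2 \<le> t then lam else 0) + (if gap / 2 \<le> s then lam else 0) \<le> distortion P \<beta> + lam * card \<beta>"
      using base[OF \<beta>(1) ne(1)] far \<Phi>(2,3) far_cost_mono[of "gap/2" t] far_cost_mono[of "gap/2" s] by auto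
  }
  show "(if gap / 2 \<le> t then lam else 0) = 0" if "t < 0" for t using that c by auto
  show "lam \<le> (if gap / 2 \<le> s then lam else 0) + (if gap / 2 \<le> t then lam else 0)" if "s + t = gap" for s t
    using that lam by auto
qed

text \<open>In the applications \<open>\<Phi> - 2 * lam\<close> is the two-point distortion \<open>V - gain r\<close>.\<close>

lemma hard_step:
  fixes lam \<Phi> :: real and e :: "real \<Rightarrow> real"
  assumes lam: "0 \<le> lam"
    and base: "\<And>\<beta>. finite \<beta> \<Longrightarrow> \<beta> \<noteq> {} \<Longrightarrow> \<Phi> \<le> distortion P \<beta> + lam * card \<beta>"
    and \<Phi>: "\<Phi> \<le> V + 1/4"
    and e: "\<And>t. e t \<le> lam" "\<And>t. t < 0 \<Longrightarrow> e t = 0" "\<And>s t. s + t = gap \<Longrightarrow> lam \<le> e s + e t"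
    and pair_left: "\<And>t b. 0 \<le> t \<Longrightarrow> \<Phi> + e t \<le> distortion P {- t, b} + 2 * lam"
    and pair_right: "\<And>s b. 0 \<le> s \<Longrightarrow> \<Phi> + e s \<le> distortion P {1 + s, b} + 2 * lam"
    and pair_both: "\<And>s t. 0 \<le> s \<Longrightarrow> 0 \<le> t \<Longrightarrow> \<Phi> + e t + e s \<le> distortion P {- t, 1 + s} + 2 * lam"
    and far: "\<And>t. 0 \<le> t \<Longrightarrow> e t = 0 \<or> \<Phi> + e t \<le> far_cost t + 3 * lam"
    and far_both: "\<And>s t. 0 \<le> s \<Longrightarrow> 0 \<le> t \<Longrightarrow> e s = 0 \<or> e t = 0 \<or> \<Phi> + e t + e s \<le> far_cost t + far_cost s + 3 * lam"
    and \<alpha>: "finite \<alpha>" "\<alpha> \<noteq> {}"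
  shows "r\<^sup>2 * \<Phi> \<le> distortion P \<alpha> + r\<^sup>2 / 3 * lam * card \<alpha>"
proof (rule lagrange_step[where e = e, OF lam base _ _ _ e(2,3) \<alpha>])
  \<comment> \<open>A single point is settled by its distance to 1/2, a pair by the
    \<open>pair\<close> hypotheses. From three points on, the far cost and the count are
    enough.\<close>
  have cases: "\<beta> = {a} \<or> (\<exists>b. \<beta> = {a, b} \<and> card \<beta> = 2) \<or> 3 * lam \<le> lam * card \<beta>"
    if \<beta>: "finite \<beta>" "a \<in> \<beta>" for \<beta> and a :: real
  proof (cases "3 \<le> card \<beta>")
    case True
    then have "lam * real 3 \<le> lam * card \<beta>" using lam by (intro mult_left_mono of_nat_mono)
    then show ?thesis by simp
  next
    case False
    show ?thesis
    proof (cases "\<beta> = {a}")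
      case False
      with \<open>\<not> 3 \<le> card \<beta>\<close> card_ge_2[OF \<beta>] have 2: "card \<beta> = 2" by simp
      then obtain x y where "\<beta> = {x, y}" by (auto simp: card_2_iff)
      with \<beta>(2) 2 show ?thesis by (auto simp: insert_commute)
    qed simp
  qed
  have s: "\<Phi> + e t \<le> distortion P \<beta> + lam * card \<beta>" if \<beta>: "\<beta> = {a}" "1/2 \<le> \<bar>1/2 - a\<bar>" for \<beta> a t
  proof -
    have "(1/2)\<^sup>2 \<le> (1/2 - a)\<^sup>2" using \<beta>(2) by (simp add: abs_le_square_iff[symmetric])
    then show ?thesis using \<Phi> e(1)[of t] \<beta>(1) by (simp add: distortion_singleton power_divide)
  qed
  {
    fix \<beta> and t :: real assume \<beta>: "finite \<beta>" "0 \<le> t" "- t \<in> \<beta>" "\<And>b. b \<in> \<beta> \<Longrightarrow> t \<le> \<bar>b\<bar>"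
    then have ne: "\<beta> \<noteq> {}" by auto
    from cases[OF \<beta>(1,3)] show left: "\<Phi> + e t \<le> distortion P \<beta> + lam * card \<beta>"
    proof (elim disjE exE conjE)
      fix b assume "\<beta> = {- t, b}" "card \<beta> = 2"
      then show ?thesis using pair_left[OF \<beta>(2), of b] by (simp add: mult.commute)
    next
      assume "\<beta> = {- t}"
      then show ?thesis using s \<beta>(2) by simp
    next
      assume "3 * lam \<le> lam * card \<beta>"
      then show ?thesis
        using far[OF \<beta>(2)] base[OF \<beta>(1) ne] distortion_far_left[OF \<beta>(1) ne \<beta>(4)] by auto
    qed
  } note left = this
  {
    fix \<beta> and t :: real assume \<beta>: "finite \<beta>" "0 \<le> t" "1 + t \<in> \<beta>" "\<And>b. b \<in> \<beta> \<Longrightarrow> t \<le> \<bar>b - 1\<bar>"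
    then have ne: "\<beta> \<noteq> {}" by auto
    from cases[OF \<beta>(1,3)] show "\<Phi> + e t \<le> distortion P \<beta> + lam * card \<beta>"
    proof (elim disjE exE conjE)
      fix b assume "\<beta> = {1 + t, b}" "card \<beta> = 2"
      then show ?thesis using pair_right[OF \<beta>(2), of b] by (simp add: mult.commute)
    next
      assume "\<beta> = {1 + t}"
      then show ?thesis using s \<beta>(2) by simp
    next
      assume "3 * lam \<le> lam * card \<beta>"
      then show ?thesis
        using far[OF \<beta>(2)] base[OF \<beta>(1) ne] distortion_far_right[OF \<beta>(1) ne \<beta>(4)] by auto
    qed
  } note right = this
  {
    fix \<beta> and s t :: real
    assume \<beta>: "finite \<beta>" "0 \<le> t" "- t \<in> \<beta>" "\<And>b. b \<in> \<beta> \<Longrightarrow> t \<le> \<bar>b\<bar>"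
      "0 \<le> s" "1 + s \<in> \<beta>" "\<And>b. b \<in> \<beta> \<Longrightarrow> s \<le> \<bar>b - 1\<bar>"
    then have ne: "\<beta> \<noteq> {}" "\<beta> \<noteq> {- t}" by auto
    from cases[OF \<beta>(1,3)] ne(2) show "\<Phi> + e t + e s \<le> distortion P \<beta> + lam * card \<beta>"
    proof (elim disjE exE conjE)
      fix b assume b: "\<beta> = {- t, b}" "card \<beta> = 2"
      then have "b = 1 + s" using \<beta>(2,5,6) by auto
      then show ?thesis using b pair_both[OF \<beta>(5,2)] by (simp add: mult.commute)
    next
      assume "3 * lam \<le> lam * card \<beta>"
      then show ?thesis
        using far_both[OF \<beta>(5,2)] distortion_far_both[OF \<beta>(1) ne(1) \<beta>(4,7)]
          left[OF \<beta>(1-4)] right[OF \<beta>(1,5-7)] by auto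
    qed simp
  }
qed

text \<open>Here \<Phi> is the common value of f(1) + lam and f(2) + 2 lam, so one and two points
  reduce to \<open>V\<close> and \<open>two_means\<close>. From three points on, the count alone
  suffices.\<close>

lemma lagrange_1:
  assumes crit: "critical r" and V: "V \<le> 2 * gain r"
    and \<beta>: "finite \<beta>" "\<beta> \<noteq> {}"
  shows "V + gain r \<le> distortion P \<beta> + gain r * card \<beta>"
proof -
  have "card \<beta> \<noteq> 0" using \<beta> by simp
  then consider "card \<beta> = 1" | "card \<beta> = 2" | "3 \<le> card \<beta>" by linarith
  then show ?thesis
  proof cases
    case 1
    then show ?thesis using distortion_ge_V[OF 1] by simp
  next
    case 2
    then obtain a b where "\<beta> = {a, b}" by (auto simp: card_2_iff)
    then show ?thesis using two_means[OF crit, of a b] 2 by simp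
  next
    case 3
    then have "gain r * real 3 \<le> gain r * card \<beta>" by (intro mult_left_mono of_nat_mono) (auto simp: gain_def)
    then show ?thesis using V distortion_nonneg[OF \<beta>] by simp
  qed
qed

text \<open>Here \<Phi> is the common value of f(2) + 2 lam and f(3) + 3 lam.
  \<open>lam \<le> gain r\<close> settles one point, and \<open>r\<^sup>2 * V \<le> lam\<close>
  settles four or more by the count alone.\<close>

lemma lagrange_2:
  assumes crit: "critical r"
    and three: "\<And>\<beta>. finite \<beta> \<Longrightarrow> card \<beta> = 3 \<Longrightarrow> r\<^sup>2 * V \<le> distortion P \<beta>"
    and lam: "lam = V - gain r - r\<^sup>2 * V" "0 \<le> lam" "lam \<le> gain r" "r\<^sup>2 * V \<le> lam"
    and \<beta>: "finite \<beta>" "\<beta> \<noteq> {}"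
  shows "r\<^sup>2 * V + 3 * lam \<le> distortion P \<beta> + lam * card \<beta>"
proof -
  have "card \<beta> \<noteq> 0" using \<beta> by simp
  then consider "card \<beta> = 1" | "card \<beta> = 2" | "card \<beta> = 3" | "4 \<le> card \<beta>" by linarith
  then show ?thesis
  proof cases
    case 1
    then show ?thesis using distortion_ge_V[OF 1] lam(1,3) by (simp add: algebra_simps)
  next
    case 2
    then obtain a b where "\<beta> = {a, b}" by (auto simp: card_2_iff)
    then show ?thesis using two_means[OF crit, of a b] 2 lam by simp
  next
    case 3
    then show ?thesis using three[OF \<beta>(1) 3] by simp
  next
    case 4
    then have "lam * real 4 \<le> lam * card \<beta>" using lam(2) by (intro mult_left_mono of_nat_mono)
    then show ?thesis using lam(4) distortion_nonneg[OF \<beta>] by simp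
  qed
qed

end

text \<open>A ramp from 0 to \<open>lam\<close> through \<open>lam / 2\<close> at 0. Opposite
  arguments give values with sum at least \<open>lam\<close>, and \<open>s + t = gap\<close> makes
  \<open>s - gap / 2\<close> and \<open>t - gap / 2\<close> opposite.\<close>

definition clip :: "real \<Rightarrow> real \<Rightarrow> real" where
  "clip lam y = max 0 (min lam (lam / 2 + y))"

lemma clip_le: "0 \<le> lam \<Longrightarrow> clip lam y \<le> lam"
  by (simp add: clip_def)

lemma clip_opposite: "0 \<le> lam \<Longrightarrow> lam \<le> clip lam y + clip lam (- y)"
  by (auto simp: clip_def max_def min_def)

lemma clip_eq_0: "lam / 2 + y \<le> 0 \<Longrightarrow> clip lam y = 0"
  by (auto simp: clip_def)

lemma clip_le_max: "clip lam y \<le> max 0 (lam / 2 + y)"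
  by (auto simp: clip_def)

section \<open>Squared distance to a pair of points, and linear lower bounds\<close>

lemma sqdist_pair_left:
  assumes "- t \<le> b" "2 * x \<le> b - t"
  shows "sqdist {- t, b} x = (x + t)\<^sup>2"
proof -
  have "0 \<le> (b + t) * (b - t - 2 * x)" using assms by simp
  then have "(x + t)\<^sup>2 \<le> (x - b)\<^sup>2" by (simp add: power2_eq_square algebra_simps)
  then show ?thesis by (simp add: sqdist_def)
qed

lemma sqdist_pair_right:
  assumes "- t \<le> b" "b - t \<le> 2 * x"
  shows "sqdist {- t, b} x = (x - b)\<^sup>2"
proof -
  have "0 \<le> (b + t) * (2 * x - (b - t))" using assms by simp
  then have "(x - b)\<^sup>2 \<le> (x + t)\<^sup>2" by (simp add: power2_eq_square algebra_simps)
  then show ?thesis by (simp add: sqdist_def)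
qed

lemma sqdist_pair_far:
  assumes "b \<le> - t" "0 \<le> x" "0 \<le> t"
  shows "sqdist {- t, b} x = (x + t)\<^sup>2"
proof -
  have "(x + t)\<^sup>2 \<le> (x - b)\<^sup>2" using assms by (intro power_mono) auto
  then show ?thesis by (simp add: sqdist_def)
qed

text \<open>Dropping t^2 and replacing \<open>x\<close> by a number \<open>y\<close> makes the bound
  linear in \<open>t\<close>, so that the case distinctions below end in linear arithmetic.\<close>

lemma square_ge_tangent:
  fixes x t y :: real
  assumes "y \<le> x" "0 \<le> t" "0 \<le> y"
  shows "y\<^sup>2 + 2 * y * t \<le> (x + t)\<^sup>2"
proof -
  have "(y + t)\<^sup>2 \<le> (x + t)\<^sup>2" using assms by (intro power_mono) auto
  moreover have "y\<^sup>2 + 2 * y * t + t\<^sup>2 = (y + t)\<^sup>2" by (simp add: power2_eq_square algebra_simps)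
  ultimately show ?thesis using zero_le_power2[of t] by linarith
qed

context self_similar
begin

lemma distortion_endpoints:
  assumes "finite \<alpha>" "\<alpha> \<noteq> {}"
  shows "(sqdist \<alpha> 0 + sqdist \<alpha> r + sqdist \<alpha> ((1 - r) / 2) + sqdist \<alpha> ((1 + r) / 2) + sqdist \<alpha> (1 - r) + sqdist \<alpha> 1) / 6
    - r\<^sup>2 * (1/4 - V) \<le> distortion P \<alpha>"
proof -
  have S: "S r 1 0 = 0" "S r 1 1 = r" "S r 2 0 = (1 - r) / 2" "S r 2 1 = (1 + r) / 2" "S r 3 0 = 1 - r" "S r 3 1 = 1"
    by (simp_all add: S_simps field_simps)
  have "(sqdist \<alpha> 0 + sqdist \<alpha> r) / 2 - r\<^sup>2 * (1/4 - V) \<le> child 1 \<alpha>"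
    "(sqdist \<alpha> ((1 - r) / 2) + sqdist \<alpha> ((1 + r) / 2)) / 2 - r\<^sup>2 * (1/4 - V) \<le> child 2 \<alpha>"
    "(sqdist \<alpha> (1 - r) + sqdist \<alpha> 1) / 2 - r\<^sup>2 * (1/4 - V) \<le> child 3 \<alpha>"
    using child_endpoints[OF assms, of 1] child_endpoints[OF assms, of 2] child_endpoints[OF assms, of 3]
    unfolding S by simp_all
  then show ?thesis unfolding distortion_child[OF assms] by argo
qed

text \<open>The tangent of the square at \<open>y\<close>, again for linear arithmetic; its slope in
  \<open>t\<close> is 2 y / 3.\<close>

lemma far_cost_ge:
  assumes "r \<le> t"
  shows "(r\<^sup>2 * V + 2 * y * (t - r / 2) - y\<^sup>2) / 3 \<le> far_cost t"
proof -
  have "0 \<le> (t - r / 2 - y)\<^sup>2" by simp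
  then have "2 * y * (t - r / 2) - y\<^sup>2 \<le> (t - r / 2)\<^sup>2" by (simp add: power2_eq_square algebra_simps)
  then show ?thesis using assms by (simp add: far_cost_def)
qed

end

text \<open>The second slope f(2) - f(3).\<close>

definition (in self_similar) lam2 :: real where "lam2 = V - gain r - r\<^sup>2 * V"

section \<open>The critical step for the larger ratio\<close>

locale self_similar_r1 = self_similar +
  assumes r_ge: "23176263/100000000 \<le> r" and r_le: "r \<le> 2897033/12500000"
begin

lemma r2_bounds: "537139/10000000 \<le> r\<^sup>2" "r\<^sup>2 \<le> 53714/1000000"
  using power_mono[OF r_ge, of 2] power_mono[OF r_le, of 2] r_pos by (simp_all add: power_divide)

lemma V_bounds: "103948/1000000 \<le> V" "V \<le> 103949/1000000"
  using r_ge r_le by (simp_all add: V_def field_simps)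

lemma gain_bounds: "770512/10000000 \<le> gain r" "gain r \<le> 770513/10000000"
proof -
  have eq: "(1 - r) * (3 + r) = 3 - 2 * r - r\<^sup>2" by (simp add: power2_eq_square algebra_simps)
  have r2: "0.0537139166 \<le> r\<^sup>2" "r\<^sup>2 \<le> 0.0537139213"
    using power_mono[OF r_ge, of 2] power_mono[OF r_le, of 2] r_pos by (simp_all add: power_divide)
  have b: "2.48276 \<le> (1 - r) * (3 + r)" "(1 - r) * (3 + r) \<le> 2.482761"
    using r_ge r_le r2 unfolding eq by simp_all
  have "(2.48276::real)\<^sup>2 \<le> ((1 - r) * (3 + r))\<^sup>2" "((1 - r) * (3 + r))\<^sup>2 \<le> 2.482761\<^sup>2"
    using power_mono[OF b(1), of 2] power_mono[OF b(2), of 2] b(1) by simp_all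
  then show "770512/10000000 \<le> gain r" "gain r \<le> 770513/10000000"
    by (simp_all add: gain_def power_divide)
qed

lemma gap_bounds: "65737/100000 \<le> gap" "gap \<le> 65739/100000"
  using r_ge r_le by (simp_all add: gap_def field_simps)

lemma r2V_bounds: "55833/10000000 \<le> r\<^sup>2 * V" "r\<^sup>2 * V \<le> 55836/10000000"
proof -
  have "537139/10000000 * (103948/1000000) \<le> r\<^sup>2 * V" "r\<^sup>2 * V \<le> 53714/1000000 * (103949/1000000)"
    using r2_bounds V_bounds by (intro mult_mono; simp)+
  then show "55833/10000000 \<le> r\<^sup>2 * V" "r\<^sup>2 * V \<le> 55836/10000000" by simp_all
qed

text \<open>The slopes \<open>3/20\<close> here and \<open>71/500\<close> in \<open>e2\<close> are close to those of the cost bounds at \<open>t = gap / 2\<close>,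
  the symmetric position of a shared point, where the margins are smallest.\<close>

definition e1 :: "real \<Rightarrow> real" where
  "e1 t = clip (gain r) (3/20 * (t - gap / 2))"

lemma e1_le: "0 \<le> t \<Longrightarrow> e1 t \<le> 3/20 * t" "e1 t \<le> gain r"
proof -
  show "e1 t \<le> 3/20 * t" if "0 \<le> t"
  proof -
    have "gain r / 2 + 3/20 * (t - gap / 2) \<le> 3/20 * t" using gain_bounds gap_bounds by argo
    then show ?thesis
      unfolding e1_def using clip_le_max[of "gain r" "3/20 * (t - gap / 2)"] that by linarith
  qed
  show "e1 t \<le> gain r" unfolding e1_def using gain_bounds by (intro clip_le) simp
qed

text \<open>The distortion is bounded through the six end points of the pieces. The position of the
  midpoint (b - t)/2 decides which of them \<open>- t\<close> serves; these are bounded linearly in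
  \<open>t\<close>. Those served by \<open>b\<close> contribute at least their scatter about their
  own mean, and terms with margin to spare are dropped.\<close>

lemma pair_left:
  assumes t: "0 \<le> t"
  shows "V - gain r + min (gain r) (gain r / 2 + 3/20 * (t - gap / 2)) \<le> distortion P {- t, b}"
proof -
  let ?m = "sqdist {- t, b}"
  have x: "23176263/100000000 \<le> r" "38411/100000 \<le> (1 - r) / 2" "61588/100000 \<le> (1 + r) / 2"
    using r_ge r_le by simp_all
  note sq = square_ge_tangent[OF x(1) t] square_ge_tangent[OF x(2) t] square_ge_tangent[OF x(3) t]
  have D: "(?m 0 + ?m r + ?m ((1 - r) / 2) + ?m ((1 + r) / 2) + ?m (1 - r) + ?m 1) / 6 - r\<^sup>2 / 4 + r\<^sup>2 * V \<le> distortion P {- t, b}"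
    using distortion_endpoints[of "{- t, b}"] by (simp add: algebra_simps)
  have nn: "0 \<le> ?m x" for x by (rule sqdist_nonneg) auto
  note num = r_ge r_le r2_bounds V_bounds gain_bounds gap_bounds r2V_bounds
  have lin: "gain r / 2 + 3/20 * (t - gap / 2) \<le> 3/20 * t - 107/10000" using gain_bounds gap_bounds by argo
  have goal: ?thesis if "V - gain r + (3/20 * t - 107/10000) \<le> distortion P {- t, b}"
    using that lin by linarith
  show ?thesis
  proof (cases "b \<le> - t \<or> 1 + r \<le> b - t")
    case True
    have "?m 0 = (0 + t)\<^sup>2" "?m r = (r + t)\<^sup>2" "?m ((1 - r) / 2) = ((1 - r) / 2 + t)\<^sup>2" "?m ((1 + r) / 2) = ((1 + r) / 2 + t)\<^sup>2"
      using True r_pos r_less t by (cases "b \<le> - t"; intro sqdist_pair_left sqdist_pair_far; simp)+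
    then have "537139/10000000 + 46/100 * t \<le> ?m r" "1475/10000 + 768/1000 * t \<le> ?m ((1 - r) / 2)"
        "379/1000 + 123/100 * t \<le> ?m ((1 + r) / 2)"
      using sq t by (simp_all add: power_divide)
    then show ?thesis
      using D nn[of 0] nn[of "1 - r"] nn[of 1] t num by (intro goal) argo
  next
    case b: False
    then have b': "- t \<le> b" by simp
    note L = sqdist_pair_left[OF b'] and R = sqdist_pair_right[OF b']
    consider "b - t \<le> 0" | "0 \<le> b - t" "b - t \<le> 2 * r" | "2 * r \<le> b - t" "b - t \<le> 1 - r" | "1 - r \<le> b - t" "b - t \<le> 1 + r"
      using b by linarith
    then show ?thesis
    proof cases
      \<comment> \<open>\<open>b\<close> serves every end point and the chord bound is exact, giving
        \<open>V\<close>. This is the case for which the charge has to be capped at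
        \<open>gain r\<close>.\<close>
      case 1
      have "?m 0 = (0 - b)\<^sup>2" "?m r = (r - b)\<^sup>2" "?m ((1 - r) / 2) = ((1 - r) / 2 - b)\<^sup>2" "?m ((1 + r) / 2) = ((1 + r) / 2 - b)\<^sup>2"
          "?m (1 - r) = (1 - r - b)\<^sup>2" "?m 1 = (1 - b)\<^sup>2"
        using 1 r_pos r_less by (intro R; simp)+
      then have "(?m 0 + ?m r + ?m ((1 - r) / 2) + ?m ((1 + r) / 2) + ?m (1 - r) + ?m 1) / 6 - r\<^sup>2 / 4 + r\<^sup>2 * V
         = (1 - r)\<^sup>2 / 6 + r\<^sup>2 * V + (1/2 - b)\<^sup>2"
        by (simp add: power2_eq_square field_simps)
      also have "(1 - r)\<^sup>2 / 6 + r\<^sup>2 * V = V" using V_eq by (simp add: algebra_simps)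
      finally show ?thesis using D zero_le_power2[of "1/2 - b"] by linarith
    next
      case 2
      have m: "?m 0 = (0 + t)\<^sup>2" by (rule L) (use 2 in simp)
      have "?m r = (r - b)\<^sup>2" "?m ((1 - r) / 2) = ((1 - r) / 2 - b)\<^sup>2" "?m ((1 + r) / 2) = ((1 + r) / 2 - b)\<^sup>2"
          "?m (1 - r) = (1 - r - b)\<^sup>2" "?m 1 = (1 - b)\<^sup>2"
        using 2 r_pos r_less by (intro R; simp)+
      then have "?m r + ?m ((1 - r) / 2) + ?m ((1 + r) / 2) + ?m (1 - r) + ?m 1 = 7/10 - 2 * r + 5/2 * r\<^sup>2 + 5 * (b - 3/5)\<^sup>2"
        by (simp add: power2_eq_square field_simps)
      then have "7/10 - 2 * r + 5/2 * r\<^sup>2 \<le> ?m r + ?m ((1 - r) / 2) + ?m ((1 + r) / 2) + ?m (1 - r) + ?m 1" by simp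
      \<comment> \<open>The tangent of t^2 at 45/100.\<close>
      moreover have "9/10 * t - 2025/10000 \<le> ?m 0"
        using zero_le_power2[of "t - 45/100"] unfolding m by (simp add: power2_eq_square algebra_simps)
      ultimately show ?thesis using D num by (intro goal) argo
    next
      case 3
      have m: "?m 0 = (0 + t)\<^sup>2" "?m r = (r + t)\<^sup>2" using 3 r_pos by (intro L; simp)+
      have "?m ((1 - r) / 2) = ((1 - r) / 2 - b)\<^sup>2" "?m ((1 + r) / 2) = ((1 + r) / 2 - b)\<^sup>2"
          "?m (1 - r) = (1 - r - b)\<^sup>2" "?m 1 = (1 - b)\<^sup>2"
        using 3 r_pos r_less by (intro R; simp)+
      then have "?m ((1 - r) / 2) + ?m ((1 + r) / 2) + ?m (1 - r) + ?m 1 = 1/4 - 1/2 * r + 5/4 * r\<^sup>2 + 4 * (b - (3 - r) / 4)\<^sup>2"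
        by (simp add: power2_eq_square field_simps)
      then have "1/4 - 1/2 * r + 5/4 * r\<^sup>2 \<le> ?m ((1 - r) / 2) + ?m ((1 + r) / 2) + ?m (1 - r) + ?m 1" by simp
      moreover have "23176263/100000000 * t \<le> r * t" using r_ge t by (rule mult_right_mono)
      \<comment> \<open>The term 2 t^2 is replaced by its tangent at 15/100.\<close>
      then have "6/10 * t - 45/1000 + r\<^sup>2 + 2 * (23176263/100000000 * t) \<le> ?m 0 + ?m r"
        using zero_le_power2[of "t - 15/100"] unfolding m by (simp add: power2_eq_square algebra_simps)
      ultimately show ?thesis using D num t by (intro goal) argo
    next
      case 4
      have m: "?m 0 = (0 + t)\<^sup>2" "?m r = (r + t)\<^sup>2" "?m ((1 - r) / 2) = ((1 - r) / 2 + t)\<^sup>2"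
        using 4 r_pos r_less by (intro L; simp)+
      have "?m ((1 + r) / 2) = ((1 + r) / 2 - b)\<^sup>2" "?m 1 = (1 - b)\<^sup>2"
        using 4 r_pos r_less by (intro R; simp)+
      then have "?m ((1 + r) / 2) + ?m 1 = (1 - 2 * r + r\<^sup>2) / 8 + 2 * (b - (3 + r) / 4)\<^sup>2"
        by (simp add: power2_eq_square field_simps)
      then have "(1 - 2 * r + r\<^sup>2) / 8 \<le> ?m ((1 + r) / 2) + ?m 1" by simp
      moreover have "537139/10000000 + 46/100 * t \<le> ?m r" "1475/10000 + 768/1000 * t \<le> ?m ((1 - r) / 2)"
        using m sq t by (simp_all add: power_divide)
      ultimately show ?thesis using D nn[of 0] nn[of "1 - r"] t num by (intro goal) argo
    qed
  qed
qed

text \<open>The truncation of the charge at 0 is the case in which nothing is gained over the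
  two-point optimum.\<close>

lemma pair_left_e1:
  assumes "critical r" "0 \<le> t"
  shows "V - gain r + e1 t \<le> distortion P {- t, b}"
  using pair_left[OF assms(2), of b] two_means[OF assms(1), of "- t" b]
  unfolding e1_def clip_def by linarith

text \<open>Since \<open>t \<le> s\<close>, the midpoint of the pair is at least 1/2 and
  \<open>- t\<close> serves 0, r and (1 - r)/2. The cases tell which of (1 + r)/2 and 1 - r it
  serves too; the end point 1 is given away.\<close>

lemma pair_both_le:
  assumes t: "0 \<le> t" "t \<le> s"
  shows "V - gain r + e1 t + e1 s \<le> distortion P {- t, 1 + s}"
proof -
  let ?m = "sqdist {- t, 1 + s}"
  have s: "0 \<le> s" using t by simp
  have x: "23176263/100000000 \<le> r" "38411/100000 \<le> (1 - r) / 2" "61588/100000 \<le> (1 + r) / 2" "76823/100000 \<le> 1 - r"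
    using r_ge r_le by simp_all
  note sq = square_ge_tangent[OF x(1) t(1)] square_ge_tangent[OF x(2) t(1)] square_ge_tangent[OF x(3) t(1)] square_ge_tangent[OF x(4) t(1)]
  note sqs = square_ge_tangent[OF x(1) s] square_ge_tangent[OF x(2) s]
  have D: "(?m 0 + ?m r + ?m ((1 - r) / 2) + ?m ((1 + r) / 2) + ?m (1 - r) + ?m 1) / 6 - r\<^sup>2 / 4 + r\<^sup>2 * V \<le> distortion P {- t, 1 + s}"
    using distortion_endpoints[of "{- t, 1 + s}"] by (simp add: algebra_simps)
  have nn: "0 \<le> ?m x" for x by (rule sqdist_nonneg) auto
  have b': "- t \<le> 1 + s" using t by simp
  note L = sqdist_pair_left[OF b'] and R = sqdist_pair_right[OF b']
  have m: "?m 0 = (0 + t)\<^sup>2" "?m r = (r + t)\<^sup>2" "?m ((1 - r) / 2) = ((1 - r) / 2 + t)\<^sup>2"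
    using t r_pos r_less by (intro L; simp)+
  then have low: "0 \<le> ?m 0" "537139/10000000 + 46/100 * t \<le> ?m r" "1475/10000 + 768/1000 * t \<le> ?m ((1 - r) / 2)"
    using sq t by (simp_all add: power_divide)
  note num = r_ge r_le r2_bounds V_bounds gain_bounds gap_bounds r2V_bounds
  note e = e1_le(1)[OF t(1)] e1_le(1)[OF s] e1_le(2)[of t] e1_le(2)[of s]
  consider "1 + s - t \<le> 1 + r" | "1 + r \<le> 1 + s - t" "1 + s - t \<le> 2 - 2 * r" | "2 - 2 * r \<le> 1 + s - t"
    by linarith
  then show ?thesis
  proof cases
    case 1
    have "?m ((1 + r) / 2) = ((1 + r) / 2 - (1 + s))\<^sup>2" "?m (1 - r) = (1 - r - (1 + s))\<^sup>2"
      using 1 r_pos r_less by (intro R; simp)+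
    then have "?m ((1 + r) / 2) = ((1 - r) / 2 + s)\<^sup>2" "?m (1 - r) = (r + s)\<^sup>2"
      by (simp_all add: power2_eq_square field_simps)
    then have "537139/10000000 + 46/100 * s \<le> ?m (1 - r)" "1475/10000 + 768/1000 * s \<le> ?m ((1 + r) / 2)"
      using sqs s by (simp_all add: power_divide)
    then show ?thesis using D nn[of 1] low e num t s by argo
  next
    case 2
    have 4: "?m ((1 + r) / 2) = ((1 + r) / 2 + t)\<^sup>2" using 2 by (intro L) simp
    have "?m (1 - r) = (1 - r - (1 + s))\<^sup>2" using 2 r_pos by (intro R) simp_all
    then have "?m (1 - r) = (r + s)\<^sup>2" by (simp_all add: power2_eq_square field_simps)
    then have "537139/10000000 + 46/100 * s \<le> ?m (1 - r)" "379/1000 + 123/100 * t \<le> ?m ((1 + r) / 2)"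
      using sq sqs s t 4 by (simp_all add: power_divide)
    then show ?thesis using D nn[of 1] low e num t s by argo
  next
    case 3
    have 4: "?m ((1 + r) / 2) = ((1 + r) / 2 + t)\<^sup>2" "?m (1 - r) = (1 - r + t)\<^sup>2"
      using 3 r_less by (intro L; simp)+
    then have "379/1000 + 123/100 * t \<le> ?m ((1 + r) / 2)" "59/100 + 153/100 * t \<le> ?m (1 - r)"
      using sq t by (simp_all add: power_divide)
    then show ?thesis using D nn[of 1] low e num t s by argo
  qed
qed

text \<open>For the first slope, sets of three points have slack \<open>2 * gain r - V\<close>
  against \<Phi>. Half of it is reserved for each end, so that debts at both ends can be paid at
  once.\<close>

lemma e1_far:
  assumes "0 \<le> t"
  shows "e1 t \<le> far_cost t + (2 * gain r - V) / 2"
proof (cases "r \<le> t")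
  case True
  \<comment> \<open>The tangent parameter 225/1000 is chosen so that the slope 2 y / 3 equals 3/20,
    the slope of \<open>e1\<close>.\<close>
  have "(225/1000::real)\<^sup>2 = 50625/1000000" by (simp add: power2_eq_square)
  then have "e1 t \<le> 0 \<or> e1 t \<le> gain r / 2 + 3/20 * (t - gap / 2)" "(r\<^sup>2 * V + 2 * (225/1000) * (t - r / 2) - 50625/1000000) / 3 \<le> far_cost t"
    using far_cost_ge[OF True, of "225/1000"] clip_le_max[of "gain r" "3/20 * (t - gap / 2)"] by (simp_all only: e1_def le_max_iff_disj)
  moreover have "0 \<le> far_cost t" using V_pos by (simp add: far_cost_def)
  ultimately show ?thesis using r_ge r_le V_bounds gain_bounds gap_bounds r2V_bounds by argo
next
  case False
  then have "gain r / 2 + 3/20 * (t - gap / 2) \<le> (2 * gain r - V) / 2"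
    using r_le V_bounds gain_bounds gap_bounds by argo
  moreover have "0 \<le> 2 * gain r - V" using V_bounds gain_bounds by simp
  moreover have "e1 t \<le> 0 \<or> e1 t \<le> gain r / 2 + 3/20 * (t - gap / 2)"
    using clip_le_max[of "gain r" "3/20 * (t - gap / 2)"] by (simp only: e1_def le_max_iff_disj)
  moreover have "far_cost t = 0" using False by (simp add: far_cost_def)
  ultimately show ?thesis by argo
qed


lemma lam2_bounds: "213/10000 \<le> lam2" "lam2 \<le> 2132/100000"
  unfolding lam2_def using V_bounds gain_bounds r2V_bounds by simp_all

definition e2 :: "real \<Rightarrow> real" where
  "e2 t = clip lam2 (71/500 * (t - gap / 2))"

lemma e2_le: "e2 t \<le> lam2"
  unfolding e2_def using lam2_bounds by (intro clip_le) simp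

text \<open>Lets the pair estimates for \<open>e1\<close> serve the second slope, where \<Phi> minus
  twice the slope is again \<open>V - gain r\<close>.\<close>

lemma e2_le_e1: "0 \<le> t \<Longrightarrow> e2 t \<le> e1 t"
proof -
  assume "0 \<le> t"
  then have "lam2 / 2 + 71/500 * (t - gap / 2) \<le> gain r / 2 + 3/20 * (t - gap / 2)" "lam2 \<le> gain r"
    using lam2_bounds gain_bounds gap_bounds by argo+
  then show ?thesis unfolding e1_def e2_def clip_def by (intro max.mono min.mono) simp_all
qed

text \<open>For the second slope three points leave no slack, so the far cost must cover
  \<open>r\<^sup>2 * V\<close> as well as the charge. It can, because a nonzero charge forces
  \<open>r \<le> t\<close>.\<close>

lemma e2_far: "e2 t = 0 \<or> r\<^sup>2 * V + e2 t \<le> far_cost t"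
proof (cases "e2 t = 0")
  case False
  then have "\<not> lam2 / 2 + 71/500 * (t - gap / 2) \<le> 0"
    using clip_eq_0 unfolding e2_def by blast
  then have *: "e2 t \<le> lam2 / 2 + 71/500 * (t - gap / 2)" "0 \<le> lam2 / 2 + 71/500 * (t - gap / 2)"
    using clip_le_max[of lam2 "71/500 * (t - gap / 2)"] unfolding e2_def by linarith+
  then have "r \<le> t" using lam2_bounds gap_bounds r_le by argo
  \<comment> \<open>213/1000 is close to gap/2 - r/2, and 2 y / 3 is then 71/500, the slope of
    \<open>e2\<close>.\<close>
  then have "(r\<^sup>2 * V + 2 * (213/1000) * (t - r / 2) - (213/1000)\<^sup>2) / 3 \<le> far_cost t"
    by (rule far_cost_ge)
  moreover have "(213/1000::real)\<^sup>2 = 45369/1000000" by (simp add: power2_eq_square)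
  ultimately show ?thesis using * lam2_bounds gap_bounds r_ge r_le r2V_bounds by argo
qed simp

lemma e1_properties: "t < 0 \<Longrightarrow> e1 t = 0" "s + t = gap \<Longrightarrow> gain r \<le> e1 s + e1 t"
proof -
  show "e1 t = 0" if "t < 0"
    unfolding e1_def using that gain_bounds gap_bounds by (intro clip_eq_0) argo
  show "gain r \<le> e1 s + e1 t" if "s + t = gap"
  proof -
    have eq: "3/20 * (t - gap / 2) = - (3/20 * (s - gap / 2))" using that by argo
    have "0 \<le> gain r" using gain_bounds by simp
    from clip_opposite[OF this] show ?thesis unfolding e1_def eq .
  qed
qed

lemma e2_properties: "t < 0 \<Longrightarrow> e2 t = 0" "s + t = gap \<Longrightarrow> lam2 \<le> e2 s + e2 t"
proof -
  show "e2 t = 0" if "t < 0"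
    unfolding e2_def using that lam2_bounds gap_bounds by (intro clip_eq_0) argo
  show "lam2 \<le> e2 s + e2 t" if "s + t = gap"
  proof -
    have eq: "71/500 * (t - gap / 2) = - (71/500 * (s - gap / 2))" using that by argo
    have "0 \<le> lam2" using lam2_bounds by simp
    from clip_opposite[OF this] show ?thesis unfolding e2_def eq .
  qed
qed

end

lemma (in self_similar_r1) reflected_r1: "self_similar_r1 r (distr P borel (\<lambda>x. 1 - x))"
  using reflected r_ge r_le by (simp add: self_similar_r1_def self_similar_r1_axioms_def)

context self_similar_r1
begin

text \<open>Mirror image of \<open>pair_left_e1\<close>: x -> 1 - x carries this pair to
  \<open>{- s, 1 - b}\<close>.\<close>

lemma pair_right_e1:
  assumes "critical r" "0 \<le> s"
  shows "V - gain r + e1 s \<le> distortion P {1 + s, b}"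
proof -
  interpret Q: self_similar_r1 r "distr P borel (\<lambda>x. 1 - x)" by (rule reflected_r1)
  have "distortion (distr P borel (\<lambda>x. 1 - x)) {- s, 1 - b} = distortion P {1 + s, b}"
    by (subst distortion_reflected) auto
  with Q.pair_left_e1[OF assms, of "1 - b"] show ?thesis by simp
qed

lemma pair_both_e1:
  assumes "0 \<le> s" "0 \<le> t"
  shows "V - gain r + e1 t + e1 s \<le> distortion P {- t, 1 + s}"
proof (cases "t \<le> s")
  case False
  interpret Q: self_similar_r1 r "distr P borel (\<lambda>x. 1 - x)" by (rule reflected_r1)
  have "distortion (distr P borel (\<lambda>x. 1 - x)) {- s, 1 + t} = distortion P {- t, 1 + s}"
    by (subst distortion_reflected) (auto simp: insert_commute)
  with Q.pair_both_le[of s t] False assms show ?thesis by simp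
qed (use pair_both_le assms in auto)

lemma step_1:
  assumes crit: "critical r" and \<alpha>: "finite \<alpha>" "\<alpha> \<noteq> {}"
  shows "r\<^sup>2 * (V + gain r) \<le> distortion P \<alpha> + r\<^sup>2 / 3 * gain r * card \<alpha>"
proof (rule hard_step[where e = e1, OF _ _ _ _ _ _ _ _ _ _ _ \<alpha>])
  have V: "V \<le> 2 * gain r" using V_bounds gain_bounds by simp
  show "0 \<le> gain r" by (simp add: gain_def)
  show "V + gain r \<le> distortion P \<beta> + gain r * card \<beta>" if "finite \<beta>" "\<beta> \<noteq> {}" for \<beta>
    using lagrange_1[OF crit V that] .
  show "V + gain r \<le> V + 1/4" using gain_bounds by simp
  show "e1 t \<le> gain r" for t by (rule e1_le)
  show "e1 t = 0" if "t < 0" for t using e1_properties(1)[OF that] .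
  show "gain r \<le> e1 s + e1 t" if "s + t = gap" for s t using e1_properties(2)[OF that] .
  show "V + gain r + e1 t \<le> distortion P {- t, b} + 2 * gain r" if "0 \<le> t" for t b
    using pair_left_e1[OF crit that, of b] by simp
  show "V + gain r + e1 s \<le> distortion P {1 + s, b} + 2 * gain r" if "0 \<le> s" for s b
    using pair_right_e1[OF crit that, of b] by simp
  show "V + gain r + e1 t + e1 s \<le> distortion P {- t, 1 + s} + 2 * gain r" if "0 \<le> s" "0 \<le> t" for s t
    using pair_both_e1[OF that] by simp
  show "e1 t = 0 \<or> V + gain r + e1 t \<le> far_cost t + 3 * gain r" if "0 \<le> t" for t
    using e1_far[OF that] V by argo
  show "e1 s = 0 \<or> e1 t = 0 \<or> V + gain r + e1 t + e1 s \<le> far_cost t + far_cost s + 3 * gain r"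
    if "0 \<le> s" "0 \<le> t" for s t
    using e1_far[OF that(1)] e1_far[OF that(2)] V by argo
qed

lemma step_2:
  assumes crit: "critical r"
    and base: "\<And>\<beta>. finite \<beta> \<Longrightarrow> \<beta> \<noteq> {} \<Longrightarrow> r\<^sup>2 * V + 3 * lam2 \<le> distortion P \<beta> + lam2 * card \<beta>"
    and \<alpha>: "finite \<alpha>" "\<alpha> \<noteq> {}"
  shows "r\<^sup>2 * (r\<^sup>2 * V + 3 * lam2) \<le> distortion P \<alpha> + r\<^sup>2 / 3 * lam2 * card \<alpha>"
proof (rule hard_step[where e = e2, OF _ base _ _ _ _ _ _ _ _ _ \<alpha>])
  show "0 \<le> lam2" using lam2_bounds by simp
  show "r\<^sup>2 * V + 3 * lam2 \<le> V + 1/4" using lam2_bounds V_bounds r2V_bounds by argo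
  show "e2 t \<le> lam2" for t by (rule e2_le)
  show "e2 t = 0" if "t < 0" for t using e2_properties(1)[OF that] .
  show "lam2 \<le> e2 s + e2 t" if "s + t = gap" for s t using e2_properties(2)[OF that] .
  show "r\<^sup>2 * V + 3 * lam2 + e2 t \<le> distortion P {- t, b} + 2 * lam2" if "0 \<le> t" for t b
    using pair_left_e1[OF crit that, of b] e2_le_e1[OF that] by (simp add: lam2_def)
  show "r\<^sup>2 * V + 3 * lam2 + e2 s \<le> distortion P {1 + s, b} + 2 * lam2" if "0 \<le> s" for s b
    using pair_right_e1[OF crit that, of b] e2_le_e1[OF that] by (simp add: lam2_def)
  show "r\<^sup>2 * V + 3 * lam2 + e2 t + e2 s \<le> distortion P {- t, 1 + s} + 2 * lam2" if "0 \<le> s" "0 \<le> t" for s t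
    using pair_both_e1[OF that] e2_le_e1[OF that(1)] e2_le_e1[OF that(2)] by (simp add: lam2_def)
  show "e2 t = 0 \<or> r\<^sup>2 * V + 3 * lam2 + e2 t \<le> far_cost t + 3 * lam2" if "0 \<le> t" for t
    using e2_far[of t] by argo
  show "e2 s = 0 \<or> e2 t = 0 \<or> r\<^sup>2 * V + 3 * lam2 + e2 t + e2 s \<le> far_cost t + far_cost s + 3 * lam2"
    if "0 \<le> s" "0 \<le> t" for s t
    using e2_far[of t] e2_far[of s] r2V_bounds by argo
qed

end

section \<open>Iteration over the levels\<close>

context self_similar
begin

text \<open>The first step is a hypothesis of its own, since it may require the linear charge. After
  it the constant is at most \<open>r\<^sup>2 * \<Phi>\<close>, which
  \<open>far_cost (gap / 2)\<close> alone outweighs; \<open>easy_step\<close> then applies at any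
  slope.\<close>

lemma lagrange_iterate:
  fixes lam \<Phi> :: real
  assumes lam: "0 \<le> lam" and \<Phi>: "0 \<le> \<Phi>" "r\<^sup>2 * \<Phi> \<le> V + 1/4" "r\<^sup>2 * \<Phi> \<le> far_cost (gap / 2)"
    and base: "\<And>\<beta>. finite \<beta> \<Longrightarrow> \<beta> \<noteq> {} \<Longrightarrow> \<Phi> \<le> distortion P \<beta> + lam * card \<beta>"
    and step: "\<And>\<beta>. finite \<beta> \<Longrightarrow> \<beta> \<noteq> {} \<Longrightarrow> r\<^sup>2 * \<Phi> \<le> distortion P \<beta> + r\<^sup>2 / 3 * lam * card \<beta>"
    and \<beta>: "finite \<beta>" "\<beta> \<noteq> {}"
  shows "(r\<^sup>2) ^ l * \<Phi> \<le> distortion P \<beta> + (r\<^sup>2 / 3) ^ l * lam * card \<beta>"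
proof (cases l)
  case 0
  then show ?thesis using base[OF \<beta>] by simp
next
  case (Suc k)
  have "(r\<^sup>2) ^ Suc k * \<Phi> \<le> distortion P \<beta> + (r\<^sup>2 / 3) ^ Suc k * lam * card \<beta>"
    using \<beta>
  proof (induction k arbitrary: \<beta>)
    case 0
    then show ?case using step by simp
  next
    case (Suc k)
    have "(r\<^sup>2) ^ k \<le> 1" using r_pos r_less by (intro power_le_one) (auto simp: power_le_one)
    then have "(r\<^sup>2) ^ k * (r\<^sup>2 * \<Phi>) \<le> r\<^sup>2 * \<Phi>" using \<Phi>(1) by (intro mult_left_le_one_le) auto
    then have le: "(r\<^sup>2) ^ Suc k * \<Phi> \<le> r\<^sup>2 * \<Phi>" by (simp add: mult_ac)
    have lam': "0 \<le> (r\<^sup>2 / 3) ^ Suc k * lam" using lam by simp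
    have far: "0 \<le> far_cost (gap / 2)" using V_pos by (simp add: far_cost_def)
    have "r\<^sup>2 * ((r\<^sup>2) ^ Suc k * \<Phi>) \<le> distortion P \<beta> + r\<^sup>2 / 3 * ((r\<^sup>2 / 3) ^ Suc k * lam) * card \<beta>"
      by (rule easy_step[OF lam' Suc.IH]) (use le lam' far \<Phi> Suc.prems in auto)
    then show ?case by (simp add: mult_ac)
  qed
  then show ?thesis by (simp add: Suc)
qed

end

section \<open>Both ratios\<close>

locale critical_self_similar = self_similar +
  assumes critical: "critical r"
begin

lemma critical_cases:
  obtains "16227/100000 \<le> r" "r \<le> 4057/25000" | "self_similar_r1 r P"
  using critical self_similar_axioms
  by (auto simp: critical_def self_similar_r1_def self_similar_r1_axioms_def)

lemma r0_bounds:
  assumes r: "16227/100000 \<le> r" "r \<le> 4057/25000"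
  shows "12/100 \<le> V" "V \<le> 1202/10000" "877/10000 \<le> gain r" "gain r \<le> 878/10000"
    "3/1000 \<le> r\<^sup>2 * V" "r\<^sup>2 * V \<le> 32/10000" "16/100 \<le> far_cost (gap / 2)"
proof -
  have r2: "2633/100000 \<le> r\<^sup>2" "r\<^sup>2 \<le> 2634/100000"
    using power_mono[OF r(1), of 2] power_mono[OF r(2), of 2] r_pos by (simp_all add: power_divide)
  show V: "12/100 \<le> V" "V \<le> 1202/10000" using r by (simp_all add: V_def field_simps)
  have eq: "(1 - r) * (3 + r) = 3 - 2 * r - r\<^sup>2" by (simp add: power2_eq_square algebra_simps)
  have b: "26491/10000 \<le> (1 - r) * (3 + r)" "(1 - r) * (3 + r) \<le> 26492/10000"
    using r r2 unfolding eq by simp_all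
  show "877/10000 \<le> gain r" "gain r \<le> 878/10000"
    using power_mono[OF b(1), of 2] power_mono[OF b(2), of 2] b(1) by (simp_all add: gain_def power_divide)
  have "2633/100000 * (12/100) \<le> r\<^sup>2 * V" "r\<^sup>2 * V \<le> 2634/100000 * (1202/10000)"
    using r2 V by (intro mult_mono; simp)+
  then show r2V: "3/1000 \<le> r\<^sup>2 * V" "r\<^sup>2 * V \<le> 32/10000" by simp_all
  have c: "79/100 \<le> gap / 2" using r by (simp add: gap_def field_simps)
  then have "(7/10)\<^sup>2 \<le> (gap / 2 - r / 2)\<^sup>2" using r by (intro power_mono) auto
  then have "48/100 \<le> r\<^sup>2 * V + (gap / 2 - r / 2)\<^sup>2" using r2V by (simp add: power_divide)
  then show "16/100 \<le> far_cost (gap / 2)" using c r by (simp add: far_cost_def)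
qed

lemma r1_far_cost:
  assumes "self_similar_r1 r P"
  shows "168/10000 \<le> far_cost (gap / 2)"
proof -
  interpret self_similar_r1 r P by fact
  have "(212/1000)\<^sup>2 \<le> (gap / 2 - r / 2)\<^sup>2" using r_le gap_bounds by (intro power_mono) auto
  then have "504/10000 \<le> r\<^sup>2 * V + (gap / 2 - r / 2)\<^sup>2" using r2V_bounds by (simp add: power_divide)
  then show ?thesis using gap_bounds r_le by (simp add: far_cost_def)
qed

lemma V_le: "V \<le> 2 * gain r"
  using critical_cases
proof cases
  case 1
  from r0_bounds[OF 1] show ?thesis by argo
next
  case 2
  then interpret self_similar_r1 r P .
  show ?thesis using V_bounds gain_bounds by simp
qed

lemma gain_nonneg: "0 \<le> gain r"
  by (simp add: gain_def)

lemma lagrange_all_1: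
  assumes "finite \<beta>" "\<beta> \<noteq> {}"
  shows "(r\<^sup>2) ^ l * (V + gain r) \<le> distortion P \<beta> + (r\<^sup>2 / 3) ^ l * gain r * card \<beta>"
proof (rule lagrange_iterate[OF gain_nonneg _ _ _ _ _ assms])
  note base = lagrange_1[OF critical V_le]
  show "V + gain r \<le> distortion P \<beta> + gain r * card \<beta>" if "finite \<beta>" "\<beta> \<noteq> {}" for \<beta>
    using base[OF that] .
  show "0 \<le> V + gain r" using V_pos gain_nonneg by simp
  \<comment> \<open>The smaller ratio takes the easy step already at the first level, the larger one
    needs \<open>step_1\<close>.\<close>
  have *: "r\<^sup>2 * (V + gain r) \<le> V + 1/4 \<and> r\<^sup>2 * (V + gain r) \<le> far_cost (gap / 2) \<and>
    (\<forall>\<beta>. finite \<beta> \<longrightarrow> \<beta> \<noteq> {} \<longrightarrow> r\<^sup>2 * (V + gain r) \<le> distortion P \<beta> + r\<^sup>2 / 3 * gain r * card \<beta>)"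
    using critical_cases
  proof cases
    case 1
    note b = r0_bounds[OF 1]
    have "r\<^sup>2 * (V + gain r) \<le> (4057/25000)\<^sup>2 * (21/100)"
      using b 1 V_pos gain_nonneg by (intro mult_mono power_mono) auto
    then have "r\<^sup>2 * (V + gain r) \<le> 1/100" by (simp add: power_divide)
    then show ?thesis
      using easy_step[OF gain_nonneg base] b by (intro conjI allI impI) auto
  next
    case 2
    then interpret self_similar_r1 r P .
    have "r\<^sup>2 * (V + gain r) \<le> 53714/1000000 * (182/1000)"
      using r2_bounds V_bounds gain_bounds by (intro mult_mono) auto
    then show ?thesis
      using r1_far_cost[OF 2] V_bounds step_1[OF critical] by (intro conjI allI impI) auto
  qed
  then show "r\<^sup>2 * (V + gain r) \<le> V + 1/4" "r\<^sup>2 * (V + gain r) \<le> far_cost (gap / 2)" by auto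
  show "r\<^sup>2 * (V + gain r) \<le> distortion P \<beta> + r\<^sup>2 / 3 * gain r * card \<beta>" if "finite \<beta>" "\<beta> \<noteq> {}" for \<beta>
    using * that by blast
qed

text \<open>The first-slope bound at level 1, where three points are exactly one per piece and the
  terms with \<open>gain r\<close> cancel.\<close>

lemma three_means:
  assumes "finite \<beta>" "card \<beta> = 3"
  shows "r\<^sup>2 * V \<le> distortion P \<beta>"
proof -
  have "\<beta> \<noteq> {}" using assms by auto
  from lagrange_all_1[OF assms(1) this, of 1] assms(2) show ?thesis by (simp add: algebra_simps)
qed

lemma lam2_bounds: "0 \<le> lam2" "lam2 \<le> gain r" "r\<^sup>2 * V \<le> lam2"
proof -
  have "0 \<le> lam2 \<and> lam2 \<le> gain r \<and> r\<^sup>2 * V \<le> lam2"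
    using critical_cases
  proof cases
    case 1
    from r0_bounds[OF 1] show ?thesis unfolding lam2_def by (intro conjI; linarith)
  next
    case 2
    then interpret self_similar_r1 r P .
    show ?thesis using V_bounds gain_bounds r2V_bounds unfolding lam2_def by (intro conjI; linarith)
  qed
  then show "0 \<le> lam2" "lam2 \<le> gain r" "r\<^sup>2 * V \<le> lam2" by auto
qed

lemma lagrange_all_2:
  assumes "finite \<beta>" "\<beta> \<noteq> {}"
  shows "(r\<^sup>2) ^ l * (r\<^sup>2 * V + 3 * lam2) \<le> distortion P \<beta> + (r\<^sup>2 / 3) ^ l * lam2 * card \<beta>"
proof (rule lagrange_iterate[OF lam2_bounds(1) _ _ _ _ _ assms])
  have base: "r\<^sup>2 * V + 3 * lam2 \<le> distortion P \<beta> + lam2 * card \<beta>" if "finite \<beta>" "\<beta> \<noteq> {}" for \<beta>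
    by (rule lagrange_2[OF critical three_means lam2_def lam2_bounds that])
  show "r\<^sup>2 * V + 3 * lam2 \<le> distortion P \<beta> + lam2 * card \<beta>" if "finite \<beta>" "\<beta> \<noteq> {}" for \<beta>
    using base[OF that] .
  show nn: "0 \<le> r\<^sup>2 * V + 3 * lam2" using V_pos lam2_bounds by simp
  have *: "r\<^sup>2 * (r\<^sup>2 * V + 3 * lam2) \<le> V + 1/4 \<and> r\<^sup>2 * (r\<^sup>2 * V + 3 * lam2) \<le> far_cost (gap / 2) \<and>
    (\<forall>\<beta>. finite \<beta> \<longrightarrow> \<beta> \<noteq> {} \<longrightarrow> r\<^sup>2 * (r\<^sup>2 * V + 3 * lam2) \<le> distortion P \<beta> + r\<^sup>2 / 3 * lam2 * card \<beta>)"
    using critical_cases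
  proof cases
    case 1
    note b = r0_bounds[OF 1]
    have "lam2 \<le> 296/10000" using b unfolding lam2_def by linarith
    then have \<Phi>: "r\<^sup>2 * V + 3 * lam2 \<le> 1/10" using b by linarith
    have "r\<^sup>2 * (r\<^sup>2 * V + 3 * lam2) \<le> (4057/25000)\<^sup>2 * (1/10)"
      using \<Phi> nn 1 r_pos by (intro mult_mono power_mono) auto
    then have "r\<^sup>2 * (r\<^sup>2 * V + 3 * lam2) \<le> 1/100" by (simp add: power_divide)
    moreover have "r\<^sup>2 * (r\<^sup>2 * V + 3 * lam2) \<le> distortion P \<beta> + r\<^sup>2 / 3 * lam2 * card \<beta>" if "finite \<beta>" "\<beta> \<noteq> {}" for \<beta>
      by (rule easy_step[OF lam2_bounds(1) base]) (use \<Phi> b lam2_bounds that in auto)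
    ultimately show ?thesis using b by auto
  next
    case 2
    then interpret R: self_similar_r1 r P .
    have \<Phi>: "r\<^sup>2 * V + 3 * lam2 \<le> 1/10" using R.lam2_bounds R.r2V_bounds by simp
    have "r\<^sup>2 * (r\<^sup>2 * V + 3 * lam2) \<le> 53714/1000000 * (1/10)"
      using R.r2_bounds \<Phi> nn by (intro mult_mono) auto
    then show ?thesis
      using r1_far_cost[OF 2] R.V_bounds R.step_2[OF critical] base by (intro conjI allI impI) auto
  qed
  then show "r\<^sup>2 * (r\<^sup>2 * V + 3 * lam2) \<le> V + 1/4" "r\<^sup>2 * (r\<^sup>2 * V + 3 * lam2) \<le> far_cost (gap / 2)" by auto
  show "r\<^sup>2 * (r\<^sup>2 * V + 3 * lam2) \<le> distortion P \<beta> + r\<^sup>2 / 3 * lam2 * card \<beta>" if "finite \<beta>" "\<beta> \<noteq> {}" for \<beta>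
    using * that by blast
qed

end

section \<open>Upper bounds from cylinders\<close>

context self_similar
begin

lemma finite_words: "finite (words k)"
  unfolding words_def using finite_lists_length_eq[of "{1,2,3::nat}" k] by (simp add: conj_commute)

lemma card_words: "card (words k) = 3 ^ k"
proof -
  have "card {\<sigma>. set \<sigma> \<subseteq> {1,2,3::nat} \<and> length \<sigma> = k} = card {1,2,3::nat} ^ k"
    by (rule card_lists_length_eq) simp
  moreover have "card {1,2,3::nat} = 3" by simp
  ultimately show ?thesis unfolding words_def by (simp only: conj_commute)
qed

lemma words_Suc: "words (Suc k) = (\<lambda>(j, \<sigma>). j # \<sigma>) ` ({1,2,3} \<times> words k)"
proof -
  have "\<sigma> \<in> words (Suc k) \<longleftrightarrow> (\<exists>j \<tau>. \<sigma> = j # \<tau> \<and> j \<in> {1,2,3} \<and> \<tau> \<in> words k)" for \<sigma>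
    by (cases \<sigma>) (auto simp: words_def)
  then show ?thesis by (auto simp: image_iff)
qed

lemma integral_words:
  assumes "unit_bounded f"
  shows "(LINT x|P. f x) = (\<Sum>\<sigma>\<in>words k. LINT x|P. f (S_word r \<sigma> x)) / 3 ^ k"
  using assms
proof (induction k arbitrary: f)
  case 0
  have "words 0 = {[]}" by (auto simp: words_def)
  then show ?case by simp
next
  case (Suc k)
  have "(LINT x|P. f x) = (\<Sum>j\<in>{1,2,3}. LINT x|P. f (S r j x)) / 3"
    by (rule integral_self_similar[OF Suc.prems])
  also have "\<dots> = (\<Sum>j\<in>{1,2,3}. (\<Sum>\<sigma>\<in>words k. LINT x|P. f (S r j (S_word r \<sigma> x))) / 3 ^ k) / 3"
    using Suc.IH[OF unit_bounded_S[OF Suc.prems]] by (intro arg_cong[where f = "\<lambda>x. x / 3"] sum.cong refl) blast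
  also have "\<dots> = (\<Sum>j\<in>{1,2,3}. \<Sum>\<sigma>\<in>words k. LINT x|P. f (S_word r (j # \<sigma>) x)) / 3 ^ Suc k"
    by (simp add: sum_divide_distrib[symmetric] add_divide_distrib)
  also have "(\<Sum>j\<in>{1,2,3}. \<Sum>\<sigma>\<in>words k. LINT x|P. f (S_word r (j # \<sigma>) x)) = (\<Sum>\<sigma>\<in>words (Suc k). LINT x|P. f (S_word r \<sigma> x))"
    unfolding words_Suc
    by (subst sum.reindex) (auto simp: inj_on_def sum.cartesian_product case_prod_beta' intro: sum.cong)
  finally show ?case .
qed

lemma S_word_diff: "S_word r \<sigma> x - S_word r \<sigma> y = r ^ length \<sigma> * (x - y)"
proof (induction \<sigma>)
  case (Cons j \<sigma>)
  have "S r j u - S r j v = r * (u - v)" for u v by (simp add: S_def algebra_simps)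
  with Cons show ?case by simp
qed simp

lemma continuous_S_word: "continuous_on UNIV (S_word r \<sigma>)"
proof -
  have "S_word r \<sigma> x = S_word r \<sigma> 0 + r ^ length \<sigma> * x" for x
    using S_word_diff[of \<sigma> x 0] by simp
  then have "S_word r \<sigma> = (\<lambda>x. S_word r \<sigma> 0 + r ^ length \<sigma> * x)" by (rule ext)
  moreover have "continuous_on UNIV (\<lambda>x. S_word r \<sigma> 0 + r ^ length \<sigma> * x)" by (intro continuous_intros)
  ultimately show ?thesis by metis
qed

text \<open>Inside the cylinder only the copy of \<beta> is used, and squared distances scale by r^2
  for each letter.\<close>

lemma word_cost:
  assumes "finite \<alpha>" "S_word r \<sigma> ` \<beta> \<subseteq> \<alpha>" "finite \<beta>" "\<beta> \<noteq> {}"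
  shows "(LINT x|P. sqdist \<alpha> (S_word r \<sigma> x)) \<le> (r\<^sup>2) ^ length \<sigma> * distortion P \<beta>"
proof -
  have "(LINT x|P. sqdist \<alpha> (S_word r \<sigma> x)) \<le> (LINT x|P. (r\<^sup>2) ^ length \<sigma> * sqdist \<beta> x)"
  proof (intro integral_mono_unit unit_bounded_continuous)
    have "\<alpha> \<noteq> {}" using assms by auto
    then show "continuous_on UNIV (\<lambda>x. sqdist \<alpha> (S_word r \<sigma> x))"
      using continuous_on_compose2[OF continuous_sqdist continuous_S_word] assms by blast
    show "continuous_on UNIV (\<lambda>x. (r\<^sup>2) ^ length \<sigma> * sqdist \<beta> x)"
      using assms by (intro continuous_intros continuous_sqdist) auto
    fix x :: real
    obtain b where b: "b \<in> \<beta>" "sqdist \<beta> x = (x - b)\<^sup>2" using sqdist_attained[OF assms(3,4)] by metis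
    then have "S_word r \<sigma> b \<in> \<alpha>" using assms by blast
    from sqdist_le[OF assms(1) this, of "S_word r \<sigma> x"]
    show "sqdist \<alpha> (S_word r \<sigma> x) \<le> (r\<^sup>2) ^ length \<sigma> * sqdist \<beta> x"
      unfolding S_word_diff b(2) by (simp add: power_mult_distrib power_mult[symmetric] mult.commute)
  qed
  then show ?thesis by (simp add: distortion_sqdist)
qed

text \<open>Common form of both branches of \<open>gamma_set\<close>: one shape is copied into the
  cylinders outside \<open>I\<close>, another into those of \<open>I\<close>.\<close>

lemma distortion_two_shapes:
  assumes I: "I \<subseteq> words k"
    and \<beta>: "finite \<beta>" "\<beta> \<noteq> {}" "finite \<gamma>" "\<gamma> \<noteq> {}"
    and \<alpha>: "\<alpha> = (\<Union>\<sigma>\<in>words k - I. S_word r \<sigma> ` \<beta>) \<union> (\<Union>\<sigma>\<in>I. S_word r \<sigma> ` \<gamma>)"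
  shows "finite \<alpha>" "\<alpha> \<noteq> {}" "card \<alpha> \<le> (3 ^ k - card I) * card \<beta> + card I * card \<gamma>"
    "distortion P \<alpha> \<le> (r\<^sup>2 / 3) ^ k * ((3 ^ k - real (card I)) * distortion P \<beta> + card I * distortion P \<gamma>)"
proof -
  have finI: "finite I" "finite (words k - I)" using I finite_words finite_subset by blast+
  have cardW: "card (words k - I) = 3 ^ k - card I"
    using I finI by (simp add: card_Diff_subset card_words)
  \<comment> \<open>Guarantees that the natural number difference \<open>3 ^ k - card I\<close> is
    not truncated.\<close>
  have cardI: "card I \<le> 3 ^ k" using card_mono[OF finite_words I] by (simp add: card_words)
  show fin: "finite \<alpha>" unfolding \<alpha> using finI \<beta> by blast
  have "words k \<noteq> {}" using card_words[of k] by force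
  then show ne: "\<alpha> \<noteq> {}" unfolding \<alpha> using \<beta> I by fastforce
  have "card (\<Union>\<sigma>\<in>words k - I. S_word r \<sigma> ` \<beta>) \<le> (\<Sum>\<sigma>\<in>words k - I. card \<beta>)"
    using finI \<beta> by (intro order_trans[OF card_UN_le] sum_mono card_image_le) auto
  moreover have "card (\<Union>\<sigma>\<in>I. S_word r \<sigma> ` \<gamma>) \<le> (\<Sum>\<sigma>\<in>I. card \<gamma>)"
    using finI \<beta> by (intro order_trans[OF card_UN_le] sum_mono card_image_le) auto
  moreover have "card \<alpha> \<le> card (\<Union>\<sigma>\<in>words k - I. S_word r \<sigma> ` \<beta>) + card (\<Union>\<sigma>\<in>I. S_word r \<sigma> ` \<gamma>)"
    unfolding \<alpha> by (rule card_Un_le)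
  ultimately show "card \<alpha> \<le> (3 ^ k - card I) * card \<beta> + card I * card \<gamma>"
    by (simp add: cardW)
  let ?c = "\<lambda>\<sigma>. LINT x|P. sqdist \<alpha> (S_word r \<sigma> x)"
  have len: "length \<sigma> = k" if "\<sigma> \<in> words k" for \<sigma> using that by (simp add: words_def)
  have "(\<Sum>\<sigma>\<in>words k. ?c \<sigma>) = (\<Sum>\<sigma>\<in>words k - I. ?c \<sigma>) + (\<Sum>\<sigma>\<in>I. ?c \<sigma>)"
    using I finite_words by (simp add: sum.subset_diff)
  also have "\<dots> \<le> (\<Sum>\<sigma>\<in>words k - I. (r\<^sup>2) ^ k * distortion P \<beta>) + (\<Sum>\<sigma>\<in>I. (r\<^sup>2) ^ k * distortion P \<gamma>)"
  proof (intro add_mono sum_mono)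
    show "?c \<sigma> \<le> (r\<^sup>2) ^ k * distortion P \<beta>" if "\<sigma> \<in> words k - I" for \<sigma>
    proof -
      have "S_word r \<sigma> ` \<beta> \<subseteq> \<alpha>" using that unfolding \<alpha> by blast
      from word_cost[OF fin this \<beta>(1,2)] that show ?thesis by (simp add: len)
    qed
    show "?c \<sigma> \<le> (r\<^sup>2) ^ k * distortion P \<gamma>" if "\<sigma> \<in> I" for \<sigma>
    proof -
      have "S_word r \<sigma> ` \<gamma> \<subseteq> \<alpha>" using that unfolding \<alpha> by blast
      moreover have "length \<sigma> = k" using that I len by blast
      ultimately show ?thesis using word_cost[OF fin _ \<beta>(3,4)] by metis
    qed
  qed
  also have "\<dots> = (r\<^sup>2) ^ k * ((3 ^ k - real (card I)) * distortion P \<beta> + card I * distortion P \<gamma>)"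
    using cardI by (simp add: cardW of_nat_diff algebra_simps)
  finally show "distortion P \<alpha> \<le> (r\<^sup>2 / 3) ^ k * ((3 ^ k - real (card I)) * distortion P \<beta> + card I * distortion P \<gamma>)"
    using integral_words[OF unit_bounded_sqdist[OF fin ne], of k]
    by (simp add: distortion_sqdist power_divide divide_right_mono)
qed

end

section \<open>The sets of the theorem\<close>

context self_similar
begin

text \<open>Peels one letter off a union of cylinders: \<open>B j\<close> needs to be the preimage
  of \<open>A\<close> only within [0,1], where \<open>P\<close> lives.\<close>

lemma integral_indicator_split:
  fixes g :: "real \<Rightarrow> real"
  assumes A: "A \<in> sets borel" and B: "\<And>j. j \<in> {1,2,3} \<Longrightarrow> B j \<in> sets borel"
    and AB: "\<And>j x. j \<in> {1,2,3} \<Longrightarrow> x \<in> {0..1} \<Longrightarrow> S r j x \<in> A \<longleftrightarrow> x \<in> B j"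
    and g: "continuous_on UNIV g"
  shows "(LINT x|P. indicator A x * g x) = (\<Sum>j\<in>{1,2,3}. LINT x|P. indicator (B j) x * g (S r j x)) / 3"
proof -
  have ug: "unit_bounded (\<lambda>x. indicator A x * g x)"
    by (intro unit_bounded_mult unit_bounded_indicator unit_bounded_continuous A g)
  have "(LINT x|P. indicator A (S r j x) * g (S r j x)) = (LINT x|P. indicator (B j) x * g (S r j x))"
    if j: "j \<in> {1,2,3}" for j
  proof (intro integral_cong_unit)
    have "unit_bounded (\<lambda>x. g (S r j x))"
      by (rule unit_bounded_S[OF unit_bounded_continuous[OF g] j])
    then show "unit_bounded (\<lambda>x. indicator (B j) x * g (S r j x))"
      by (intro unit_bounded_mult unit_bounded_indicator B j)
    show "unit_bounded (\<lambda>x. indicator A (S r j x) * g (S r j x))"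
      by (rule unit_bounded_S[OF ug j])
    fix x :: real assume "x \<in> {0..1}"
    then show "indicator A (S r j x) * g (S r j x) = indicator (B j) x * g (S r j x)"
      using AB[OF j, of x] by (simp add: indicator_def)
  qed
  then show ?thesis by (subst integral_self_similar[OF ug]) simp
qed

lemma S_mem:
  assumes "x \<in> {0..1}"
  shows "r * x \<in> {0..r}" "r * x + (1 - r) / 2 \<in> {(1 - r) / 2..(1 + r) / 2}" "r * x + (1 - r) \<in> {1 - r..1}"
proof -
  have "0 \<le> r * x" "r * x \<le> r" using assms r_pos by (auto simp: mult_left_le)
  then show "r * x \<in> {0..r}" "r * x + (1 - r) / 2 \<in> {(1 - r) / 2..(1 + r) / 2}" "r * x + (1 - r) \<in> {1 - r..1}"
    by (auto simp: field_simps)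
qed

definition left_part :: "real set" where "left_part = (\<Union>\<sigma>\<in>{[1], [2, 1]}. J r \<sigma>)"
definition right_part :: "real set" where "right_part = (\<Union>\<sigma>\<in>{[2, 2], [2, 3], [3]}. J r \<sigma>)"

lemma J_simps:
  "J r [1] = {0..r}" "J r [3] = {1 - r..1}"
  "J r [2, j] = S r 2 ` S r j ` {0..1}"
proof -
  show "J r [1] = {0..r}" "J r [3] = {1 - r..1}"
    using unit_image by (simp_all add: J_def)
  show "J r [2, j] = S r 2 ` S r j ` {0..1}" by (auto simp: J_def image_image)
qed

lemma S_inj: "S r j x = S r j y \<longleftrightarrow> x = y"
  using r_pos by (simp add: S_def)

lemma S_image_mem: "S r j x \<in> S r j ` B \<longleftrightarrow> x \<in> B"
  by (auto simp: S_inj)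

lemma S_image_mid: "B \<subseteq> {0..1} \<Longrightarrow> S r 2 ` B \<subseteq> {(1 - r) / 2..(1 + r) / 2}"
  using unit_image(2) by blast

lemma closed_S_image: "compact B \<Longrightarrow> S r j ` B \<in> sets borel"
  by (intro borel_closed compact_imp_closed compact_continuous_image continuous_on_subset[OF continuous_S[OF continuous_on_id]]) auto

lemma integral_left_part:
  fixes g :: "real \<Rightarrow> real"
  assumes g: "continuous_on UNIV g"
  shows "left_part \<in> sets borel"
    "(LINT x|P. indicator left_part x * g x) = ((LINT x|P. g (S r 1 x)) + (LINT x|P. g (S r 2 (S r 1 x))) / 3) / 3"
proof -
  have eq: "left_part = {0..r} \<union> S r 2 ` {0..r}"
    unfolding left_part_def using J_simps(1) J_simps(3)[of 1] unit_image(1) by auto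
  have sub: "{0..r} \<subseteq> {0..1}" using r_less by auto
  have mid: "S r 2 ` {0..r} \<subseteq> {(1 - r) / 2..(1 + r) / 2}" by (rule S_image_mid[OF sub])
  show A: "left_part \<in> sets borel" unfolding eq by (intro sets.Un closed_S_image) auto
  \<comment> \<open>The first piece lies in \<open>left_part\<close> entirely, the second only
    through its own first piece, which is split off next, and the third not at all.\<close>
  have "(LINT x|P. indicator left_part x * g x) =
    (\<Sum>j\<in>{1,2,3}. LINT x|P. indicator (if j = 1 then UNIV else if j = 2 then {0..r} else {}) x * g (S r j x)) / 3"
  proof (rule integral_indicator_split[OF A _ _ g])
    fix j x assume j: "j \<in> {1,2,3::nat}" and x: "x \<in> {0..1::real}"
    note m = S_mem[OF x]
    consider "j = 1" | "j = 2" | "j = 3" using j by auto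
    then show "S r j x \<in> left_part \<longleftrightarrow> x \<in> (if j = 1 then UNIV else if j = 2 then {0..r} else {})"
    proof cases
      case 1
      then show ?thesis using m(1) unfolding eq by (simp add: S_simps)
    next
      case 2
      have "S r 2 x \<notin> {0..r}" using m(2) r_less by (auto simp: S_simps field_simps)
      then show ?thesis unfolding 2 eq Un_iff S_image_mem by auto
    next
      case 3
      have "S r 3 x \<notin> {0..r}" "S r 3 x \<notin> {(1 - r) / 2..(1 + r) / 2}" using m(3) r_less by (auto simp: S_simps field_simps)
      then show ?thesis unfolding 3 eq using mid by auto
    qed
  qed auto
  also have "\<dots> = ((LINT x|P. g (S r 1 x)) + (LINT x|P. indicator {0..r} x * g (S r 2 x))) / 3"
    by simp
  also have "(LINT x|P. indicator {0..r} x * g (S r 2 x)) =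
    (\<Sum>j\<in>{1,2,3}. LINT x|P. indicator (if j = 1 then UNIV else {}) x * g (S r 2 (S r j x))) / 3"
  proof (rule integral_indicator_split)
    show "continuous_on UNIV (\<lambda>x. g (S r 2 x))"
      by (rule continuous_on_compose2[OF g]) (auto intro: continuous_intros)
    fix j x assume j: "j \<in> {1,2,3::nat}" and x: "x \<in> {0..1::real}"
    note m = S_mem[OF x]
    show "S r j x \<in> {0..r} \<longleftrightarrow> x \<in> (if j = 1 then UNIV else {})"
      using j m r_less by (auto simp: S_simps field_simps)
  qed auto
  finally show "(LINT x|P. indicator left_part x * g x) = ((LINT x|P. g (S r 1 x)) + (LINT x|P. g (S r 2 (S r 1 x))) / 3) / 3"
    by simp
qed

lemma integral_right_part:
  fixes g :: "real \<Rightarrow> real"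
  assumes g: "continuous_on UNIV g"
  shows "right_part \<in> sets borel"
    "(LINT x|P. indicator right_part x * g x) =
      ((LINT x|P. g (S r 3 x)) + ((LINT x|P. g (S r 2 (S r 2 x))) + (LINT x|P. g (S r 2 (S r 3 x)))) / 3) / 3"
proof -
  define B where "B = {(1 - r) / 2..(1 + r) / 2} \<union> {1 - r..1}"
  have eq: "right_part = {1 - r..1} \<union> S r 2 ` B"
    unfolding right_part_def B_def using J_simps(2) J_simps(3)[of 2] J_simps(3)[of 3] unit_image(2,3) by auto
  have sub: "B \<subseteq> {0..1}" unfolding B_def using r_pos r_less by auto
  have mid: "S r 2 ` B \<subseteq> {(1 - r) / 2..(1 + r) / 2}" by (rule S_image_mid[OF sub])
  have B: "B \<in> sets borel" "compact B" by (auto simp: B_def intro!: compact_Un)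
  show A: "right_part \<in> sets borel" unfolding eq using B by (intro sets.Un closed_S_image) auto
  have "(LINT x|P. indicator right_part x * g x) =
    (\<Sum>j\<in>{1,2,3}. LINT x|P. indicator (if j = 3 then UNIV else if j = 2 then B else {}) x * g (S r j x)) / 3"
  proof (rule integral_indicator_split[OF A _ _ g])
    fix j x assume j: "j \<in> {1,2,3::nat}" and x: "x \<in> {0..1::real}"
    note m = S_mem[OF x]
    consider "j = 1" | "j = 2" | "j = 3" using j by auto
    then show "S r j x \<in> right_part \<longleftrightarrow> x \<in> (if j = 3 then UNIV else if j = 2 then B else {})"
    proof cases
      case 3
      then show ?thesis using m(3) unfolding eq by (simp add: S_simps)
    next
      case 2
      have "S r 2 x \<notin> {1 - r..1}" using m(2) r_less by (auto simp: S_simps field_simps)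
      then show ?thesis unfolding 2 eq Un_iff S_image_mem by auto
    next
      case 1
      have "S r 1 x \<notin> {1 - r..1}" "S r 1 x \<notin> {(1 - r) / 2..(1 + r) / 2}" using m(1) r_less by (auto simp: S_simps field_simps)
      then show ?thesis unfolding 1 eq using mid by auto
    qed
  qed (use B in auto)
  also have "\<dots> = ((LINT x|P. g (S r 3 x)) + (LINT x|P. indicator B x * g (S r 2 x))) / 3"
    by simp
  also have "(LINT x|P. indicator B x * g (S r 2 x)) =
    (\<Sum>j\<in>{1,2,3}. LINT x|P. indicator (if j = 1 then {} else UNIV) x * g (S r 2 (S r j x))) / 3"
  proof (rule integral_indicator_split)
    show "continuous_on UNIV (\<lambda>x. g (S r 2 x))"
      by (rule continuous_on_compose2[OF g]) (auto intro: continuous_intros)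
    fix j x assume j: "j \<in> {1,2,3::nat}" and x: "x \<in> {0..1::real}"
    note m = S_mem[OF x]
    show "S r j x \<in> B \<longleftrightarrow> x \<in> (if j = 1 then {} else UNIV)"
      using j m r_less unfolding B_def by (auto simp: S_simps field_simps)
  qed (use B in auto)
  finally show "(LINT x|P. indicator right_part x * g x) =
      ((LINT x|P. g (S r 3 x)) + ((LINT x|P. g (S r 2 (S r 2 x))) + (LINT x|P. g (S r 2 (S r 3 x)))) / 3) / 3"
    by simp
qed

lemma integral_affine: "(LINT x|P. b * x + c) = b / 2 + c"
  using integral_quadratic[of 0 b c] by simp

lemma measure_eq_integral: "A \<in> sets borel \<Longrightarrow> measure P A = (LINT x|P. indicator A x * 1)"
  by simp

text \<open>These are the coordinates of the polygon's vertex at mass 4/9, realised by an actual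
  set.\<close>

lemma left_part:
  "measure P left_part = 4 / 9" "moment left_part = (1 - r) * (3 + r) / 18"
proof -
  have c: "continuous_on UNIV (\<lambda>x::real. 1::real)" "continuous_on UNIV (\<lambda>x::real. 1/2 - x)" by (intro continuous_intros)+
  note A = integral_left_part(1)[OF c(1)]
  show "measure P left_part = 4 / 9"
    unfolding measure_eq_integral[OF A] integral_left_part(2)[OF c(1)] by simp
  have "1/2 - S r 1 x = - r * x + 1/2" "1/2 - S r 2 (S r 1 x) = - (r * r) * x + r / 2" for x
    by (simp_all add: S_simps field_simps)
  then show "moment left_part = (1 - r) * (3 + r) / 18"
    unfolding moment_def integral_left_part(2)[OF c(2)] by (simp only: integral_affine) (simp add: field_simps)
qed

lemma right_part:
  "measure P right_part = 5 / 9" "moment right_part = - ((1 - r) * (3 + r) / 18)"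
proof -
  have c: "continuous_on UNIV (\<lambda>x::real. 1::real)" "continuous_on UNIV (\<lambda>x::real. 1/2 - x)" by (intro continuous_intros)+
  note A = integral_right_part(1)[OF c(1)]
  show "measure P right_part = 5 / 9"
    unfolding measure_eq_integral[OF A] integral_right_part(2)[OF c(1)] by simp
  have "1/2 - S r 3 x = - r * x + (r - 1/2)" "1/2 - S r 2 (S r 2 x) = - (r * r) * x + r * r / 2"
      "1/2 - S r 2 (S r 3 x) = - (r * r) * x + (r * r - r / 2)" for x
    by (simp_all add: S_simps field_simps)
  then show "moment right_part = - ((1 - r) * (3 + r) / 18)"
    unfolding moment_def integral_right_part(2)[OF c(2)] by (simp only: integral_affine) (simp add: field_simps)
qed

lemma cond_mean_moment:
  assumes "A \<in> sets borel" "measure P A \<noteq> 0"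
  shows "cond_mean P A = 1/2 - moment A / measure P A"
proof -
  have int: "integrable P (\<lambda>x. indicator A x * (1/2 - x))" "integrable P (indicator A :: real \<Rightarrow> real)"
    using assms by (intro integrable_indicator_mult integrable_indicator continuous_intros; simp)+
  have "(LINT x:A|P. x) = (LINT x|P. 1/2 * indicator A x - indicator A x * (1/2 - x))"
    unfolding set_lebesgue_integral_def by (intro Bochner_Integration.integral_cong refl) (simp add: algebra_simps)
  also have "\<dots> = 1/2 * measure P A - moment A"
    using int assms(1) by (simp add: moment_def)
  finally show ?thesis using assms(2) by (simp add: cond_mean_def field_simps)
qed

text \<open>Serving \<open>left_part\<close> from the first point and everything else from the
  second costs at least the distortion, so the Voronoi cells need not be determined. For critical
  \<open>r\<close>, \<open>two_means\<close> is the matching lower bound.\<close>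

lemma distortion_gamma2: "distortion P (gamma2 r P) \<le> V - gain r"
proof -
  define M where "M = (1 - r) * (3 + r) / 18"
  define a b where "a = 1/2 - M / (4/9)" and "b = 1/2 + M / (5/9)"
  have A: "left_part \<in> sets borel" "right_part \<in> sets borel"
    using integral_left_part(1) integral_right_part(1) continuous_on_id by blast+
  have "gamma2 r P = {cond_mean P left_part, cond_mean P right_part}"
    by (simp only: gamma2_def a_words_def left_part_def right_part_def)
  then have g: "gamma2 r P = {a, b}"
    using cond_mean_moment[OF A(1)] cond_mean_moment[OF A(2)]
    by (simp add: left_part right_part a_def b_def M_def)
  have u: "unit_bounded (\<lambda>y. indicator left_part y * (y - a)\<^sup>2 + (1 - indicator left_part y) * (y - b)\<^sup>2)"
  proof -
    have eq: "(\<lambda>y. indicator left_part y * (y - a)\<^sup>2 + (1 - indicator left_part y) * (y - b)\<^sup>2) =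
       (\<lambda>y. if y \<in> left_part then (y - a)\<^sup>2 else (y - b)\<^sup>2)" by (auto simp: indicator_def)
    have bound: "\<bar>if y \<in> left_part then (y - a)\<^sup>2 else (y - b)\<^sup>2\<bar> \<le> (1 + \<bar>a\<bar>)\<^sup>2 + (1 + \<bar>b\<bar>)\<^sup>2" if "y \<in> {0..1}" for y
    proof -
      have "(y - a)\<^sup>2 \<le> (1 + \<bar>a\<bar>)\<^sup>2" "(y - b)\<^sup>2 \<le> (1 + \<bar>b\<bar>)\<^sup>2"
        using that by (auto simp: abs_le_square_iff[symmetric])
      then show ?thesis by (simp add: add_increasing add_increasing2)
    qed
    show ?thesis
      unfolding eq using A(1) by (intro unit_boundedI[OF _ bound]) (auto intro!: measurable_If_set)
  qed
  have "distortion P (gamma2 r P) \<le> (LINT y|P. indicator left_part y * (y - a)\<^sup>2 + (1 - indicator left_part y) * (y - b)\<^sup>2)"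
    unfolding g distortion_sqdist
    by (intro integral_mono_unit unit_bounded_sqdist u) (auto simp: sqdist_def indicator_def)
  also have "\<dots> = V - gain r"
    unfolding partition_cost[OF A(1)] left_part M_def[symmetric] a_def b_def
    by (simp add: gain_def M_def power2_eq_square field_simps)
  finally show ?thesis .
qed

lemma card_gamma2: "finite (gamma2 r P)" "gamma2 r P \<noteq> {}" "card (gamma2 r P) \<le> 2"
  by (simp_all add: gamma2_def card_insert_if)

lemma card_gamma3: "finite (gamma3 r)" "gamma3 r \<noteq> {}" "card (gamma3 r) \<le> 3"
  by (simp_all add: gamma3_def card_insert_if)

text \<open>One centre per piece: the case of \<open>distortion_two_shapes\<close> with
  \<open>k = 1\<close>, \<open>I\<close> empty and the shape \<open>{1/2}\<close>.\<close>

lemma distortion_gamma3: "distortion P (gamma3 r) \<le> r\<^sup>2 * V"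
proof -
  have "words 1 = {[1], [2], [3]}" using words_Suc[of 0] by (auto simp: words_def)
  then have "gamma3 r = (\<Union>\<sigma>\<in>words 1 - {}. S_word r \<sigma> ` {1/2}) \<union> (\<Union>\<sigma>\<in>{}. S_word r \<sigma> ` {1/2})"
    by (auto simp: gamma3_def a_word_def)
  from distortion_two_shapes(4)[OF _ _ _ _ _ this] show ?thesis
    by (simp add: distortion_singleton)
qed

end

section \<open>Matching the upper and the lower bounds\<close>

lemma level_bounds:
  assumes "1 \<le> n"
  shows "3 ^ level n \<le> n" "n < 3 ^ (level n + 1)"
proof -
  obtain l where l: "3 ^ l \<le> n" "n < 3 ^ (l + 1)"
    using ex_power_ivl1[of 3 n] assms by fastforce
  have unique: "l' = l" if "3 ^ l' \<le> n \<and> n < 3 ^ (l' + 1)" for l'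
  proof (rule ccontr)
    assume "l' \<noteq> l"
    then consider "l' + 1 \<le> l" | "l + 1 \<le> l'" by linarith
    then show False
    proof cases
      case 1
      then have "(3::nat) ^ (l' + 1) \<le> 3 ^ l" by (intro power_increasing) auto
      with that l show False by linarith
    next
      case 2
      then have "(3::nat) ^ (l + 1) \<le> 3 ^ l'" by (intro power_increasing) auto
      with that l show False by linarith
    qed
  qed
  have "level n = l" unfolding level_def by (rule the_equality) (use l unique in blast)+
  with l show "3 ^ level n \<le> n" "n < 3 ^ (level n + 1)" by simp_all
qed

lemma optimal_n_meansI:
  assumes "finite \<alpha>" "\<alpha> \<noteq> {}" "card \<alpha> \<le> n" "distortion P \<alpha> \<le> F"
    and "\<And>\<beta>. finite \<beta> \<Longrightarrow> \<beta> \<noteq> {} \<Longrightarrow> card \<beta> \<le> n \<Longrightarrow> F \<le> distortion P \<beta>"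
  shows "optimal_n_means P n \<alpha>"
proof -
  have "quant_error P n = distortion P \<alpha>"
    unfolding quant_error_def
  proof (rule cInf_eq_minimum)
    show "distortion P \<alpha> \<in> {distortion P \<alpha> |\<alpha>. finite \<alpha> \<and> \<alpha> \<noteq> {} \<and> card \<alpha> \<le> n}"
      using assms(1-3) by blast
    fix x assume "x \<in> {distortion P \<alpha> |\<alpha>. finite \<alpha> \<and> \<alpha> \<noteq> {} \<and> card \<alpha> \<le> n}"
    then obtain \<beta> where "x = distortion P \<beta>" "finite \<beta>" "\<beta> \<noteq> {}" "card \<beta> \<le> n" by blast
    then show "distortion P \<alpha> \<le> x" using assms(4) assms(5)[of \<beta>] by simp
  qed
  with assms show ?thesis by (simp add: optimal_n_means_def)
qed

context critical_self_similar
begin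

text \<open>Up to the factor (r^2/3)^l, the Lagrangian bound at n = 3^l + i points reads 3^l (V + K)
  - K (3^l + i) = 3^l V - i K, the value of the constructed set. The second slope does the same for
  n = 2 * 3^l + i. Fewer points only strengthen the bound, as the slopes are nonnegative.\<close>

theorem gamma_set_optimal:
  assumes n: "3 \<le> n" and I: "admissible n I"
  shows "optimal_n_means P n (gamma_set r P n I)"
proof -
  define l where "l = level n"
  define i where "i = card I"
  have ln: "3 ^ l \<le> n" "n < 3 * 3 ^ l" using level_bounds[of n] n by (simp_all add: l_def)
  have IW: "I \<subseteq> words l" using I by (simp add: admissible_def l_def)
  have q: "(r\<^sup>2) ^ l = (r\<^sup>2 / 3) ^ l * 3 ^ l" by (simp add: power_divide)
  have q0: "0 \<le> (r\<^sup>2 / 3) ^ l" by simp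
  show ?thesis
  proof (cases "n \<le> 2 * 3 ^ l")
    case True
    then have i: "n = 3 ^ l + i" using I ln by (simp add: admissible_def l_def i_def)
    have il: "i \<le> 3 ^ l" using True i by simp
    have "gamma_set r P n I = (\<Union>\<sigma>\<in>words l - I. S_word r \<sigma> ` {1/2}) \<union> (\<Union>\<sigma>\<in>I. S_word r \<sigma> ` gamma2 r P)"
      using True by (auto simp: gamma_set_def l_def a_word_def)
    note shapes = distortion_two_shapes[OF IW _ _ card_gamma2(1,2) this, folded i_def, simplified]
    have "card (gamma_set r P n I) \<le> (3 ^ l - i) + i * 2"
      using shapes(3) card_gamma2(3) mult_le_mono2[OF card_gamma2(3), of i] by linarith
    then have card: "card (gamma_set r P n I) \<le> n" using i il by simp
    have "distortion P (gamma_set r P n I) \<le> (r\<^sup>2 / 3) ^ l * ((3 ^ l - real i) * V + i * distortion P (gamma2 r P))"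
      using shapes(4) by (simp add: distortion_singleton)
    also have "\<dots> \<le> (r\<^sup>2 / 3) ^ l * ((3 ^ l - real i) * V + i * (V - gain r))"
      using distortion_gamma2 by (intro mult_left_mono add_left_mono q0) auto
    finally have up: "distortion P (gamma_set r P n I) \<le> (r\<^sup>2 / 3) ^ l * ((3 ^ l - real i) * V + i * (V - gain r))" .
    show ?thesis
    proof (rule optimal_n_meansI[OF shapes(1,2) card up])
      fix \<beta> :: "real set" assume \<beta>: "finite \<beta>" "\<beta> \<noteq> {}" "card \<beta> \<le> n"
      have "(r\<^sup>2 / 3) ^ l * gain r * card \<beta> \<le> (r\<^sup>2 / 3) ^ l * gain r * n"
        using \<beta>(3) q0 gain_nonneg by (intro mult_left_mono) auto
      with lagrange_all_1[OF \<beta>(1,2), of l]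
      have "(r\<^sup>2 / 3) ^ l * 3 ^ l * (V + gain r) \<le> distortion P \<beta> + (r\<^sup>2 / 3) ^ l * gain r * (3 ^ l + i)"
        unfolding q i by simp
      then show "(r\<^sup>2 / 3) ^ l * ((3 ^ l - real i) * V + i * (V - gain r)) \<le> distortion P \<beta>"
        by (simp add: algebra_simps)
    qed
  next
    case False
    then have i: "n = 2 * 3 ^ l + i" using I ln by (simp add: admissible_def l_def i_def)
    have il: "i \<le> 3 ^ l" using ln i by simp
    have "gamma_set r P n I = (\<Union>\<sigma>\<in>words l - I. S_word r \<sigma> ` gamma2 r P) \<union> (\<Union>\<sigma>\<in>I. S_word r \<sigma> ` gamma3 r)"
      using False by (auto simp: gamma_set_def l_def)
    note shapes = distortion_two_shapes[OF IW card_gamma2(1,2) card_gamma3(1,2) this, folded i_def]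
    have "card (gamma_set r P n I) \<le> (3 ^ l - i) * 2 + i * 3"
      using shapes(3) mult_le_mono2[OF card_gamma2(3), of "3 ^ l - i"] mult_le_mono2[OF card_gamma3(3), of i] by linarith
    then have card: "card (gamma_set r P n I) \<le> n" using i il by simp
    have "real i \<le> real (3 ^ l)" using il by (rule of_nat_mono)
    then have up: "distortion P (gamma_set r P n I) \<le> (r\<^sup>2 / 3) ^ l * ((3 ^ l - real i) * (V - gain r) + i * (r\<^sup>2 * V))"
      using distortion_gamma2 distortion_gamma3
      by (intro order_trans[OF shapes(4)] mult_left_mono add_mono q0) auto
    show ?thesis
    proof (rule optimal_n_meansI[OF shapes(1,2) card up])
      fix \<beta> :: "real set" assume \<beta>: "finite \<beta>" "\<beta> \<noteq> {}" "card \<beta> \<le> n"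
      have "(r\<^sup>2 / 3) ^ l * lam2 * card \<beta> \<le> (r\<^sup>2 / 3) ^ l * lam2 * n"
        using \<beta>(3) q0 lam2_bounds(1) by (intro mult_left_mono) auto
      with lagrange_all_2[OF \<beta>(1,2), of l]
      have "(r\<^sup>2 / 3) ^ l * 3 ^ l * (r\<^sup>2 * V + 3 * lam2) \<le> distortion P \<beta> + (r\<^sup>2 / 3) ^ l * lam2 * (2 * 3 ^ l + i)"
        unfolding q i by simp
      then show "(r\<^sup>2 / 3) ^ l * ((3 ^ l - real i) * (V - gain r) + i * (r\<^sup>2 * V)) \<le> distortion P \<beta>"
        unfolding lam2_def by (simp add: algebra_simps)
    qed
  qed
qed

end

section \<open>The two ratios\<close>

lemma neg_fraction_eq_iff:
  fixes a b c d x :: real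
  assumes "c \<noteq> 0" "d \<noteq> 0" "x \<noteq> 0"
  shows "- (a / (c * x)) = - (b / (d * x)) \<longleftrightarrow> a * d = b * c"
  using assms by (simp only: neg_equal_iff_equal divide_divide_eq_left[symmetric] divide_cancel_right) (simp add: frac_eq_eq)

lemma eq_r0_iff:
  assumes "0 < r" "r < 1/3"
  shows "eq_r0 r \<longleftrightarrow> r = sqrt 10 - 3"
proof -
  have "eq_r0 r \<longleftrightarrow> 3*r^5 + 15*r^4 + 6*r^3 - 42*r^2 + 31*r - 13 = 10 * (3*r^3 - 3*r^2 + r - 1)"
    unfolding eq_r0_def using assms by (subst neg_fraction_eq_iff) auto
  \<comment> \<open>The last factor is the tangency condition at mass 1/3; the others vanish only at
    1 and -1.\<close>
  also have "\<dots> \<longleftrightarrow> 3 * ((r - 1)\<^sup>2 * (r + 1)) * ((3 + r)\<^sup>2 - 10) = 0"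
    by (simp add: power2_eq_square power_eq_if algebra_simps)
  also have "\<dots> \<longleftrightarrow> (3 + r)\<^sup>2 = 10" using assms by simp
  also have "\<dots> \<longleftrightarrow> 3 + r = sqrt 10"
    using assms by (metis add_nonneg_nonneg less_imp_le real_sqrt_pow2 real_sqrt_unique zero_le_numeral)
  finally show ?thesis by auto
qed

lemma eq_r1_iff:
  assumes "0 < r" "r < 1/3"
  shows "eq_r1 r \<longleftrightarrow> 10 * (9 + 3 * r + r\<^sup>2)\<^sup>2 = 91 * (3 + r)\<^sup>2"
proof -
  have "eq_r1 r \<longleftrightarrow> 91 * (3*r^5 + 15*r^4 + 6*r^3 - 42*r^2 + 31*r - 13) =
     10 * (3*r^7 + 15*r^6 + 60*r^5 + 66*r^4 + 18*r^3 - 324*r^2 + 283*r - 121)"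
    unfolding eq_r1_def using assms by (subst neg_fraction_eq_iff) auto
  \<comment> \<open>The same factorisation, now with the tangency condition at mass 13/27.\<close>
  also have "\<dots> \<longleftrightarrow> 3 * ((r - 1)\<^sup>2 * (r + 1)) * (10 * (9 + 3 * r + r\<^sup>2)\<^sup>2 - 91 * (3 + r)\<^sup>2) = 0"
    by (simp add: power2_eq_square power_eq_if algebra_simps) argo
  also have "\<dots> \<longleftrightarrow> 10 * (9 + 3 * r + r\<^sup>2)\<^sup>2 = 91 * (3 + r)\<^sup>2" using assms by simp
  finally show ?thesis .
qed

text \<open>The equation for \<open>r1\<close> says that this square is 91/10, so it has at most one
  positive root.\<close>

lemma quotient_strict_mono:
  fixes x y :: real
  assumes "0 < x" "x < y"
  shows "((9 + 3 * x + x\<^sup>2) / (3 + x))\<^sup>2 < ((9 + 3 * y + y\<^sup>2) / (3 + y))\<^sup>2"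
proof (rule power_strict_mono)
  have "(9 + 3 * y + y\<^sup>2) * (3 + x) - (9 + 3 * x + x\<^sup>2) * (3 + y) = (y - x) * (3 * (x + y) + x * y)"
    by (simp add: power2_eq_square algebra_simps)
  moreover have "0 < (y - x) * (3 * (x + y) + x * y)" using assms by (intro mult_pos_pos add_pos_pos) auto
  ultimately show "(9 + 3 * x + x\<^sup>2) / (3 + x) < (9 + 3 * y + y\<^sup>2) / (3 + y)"
    using assms by (simp add: divide_less_eq less_divide_eq field_simps)
qed (use assms in auto)

lemma root_r1:
  obtains r :: real where "\<bar>r - 0.2317626315\<bar> < 1 / (2 * 10 ^ 10)" "10 * (9 + 3 * r + r\<^sup>2)\<^sup>2 = 91 * (3 + r)\<^sup>2"
proof -
  define f where "f x = 10 * (9 + 3 * x + x\<^sup>2)\<^sup>2 - 91 * (3 + x)\<^sup>2" for x :: real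
  \<comment> \<open>The bracket extends 4e-11 to either side of 0.2317626315, inside the tolerance
    5e-11 of ten correct decimals.\<close>
  have "\<exists>x\<ge>0.23176263146. x \<le> 0.23176263154 \<and> f x = 0"
  proof (rule IVT')
    show "f 0.23176263146 \<le> 0" "0 \<le> f 0.23176263154" by (simp_all add: f_def power_divide power2_eq_square)
    show "continuous_on {0.23176263146..0.23176263154} f" unfolding f_def by (intro continuous_intros)
  qed simp
  then obtain x where x: "0.23176263146 \<le> x" "x \<le> 0.23176263154" "f x = 0" by auto
  show thesis
  proof (rule that)
    show "\<bar>x - 0.2317626315\<bar> < 1 / (2 * 10 ^ 10)" unfolding abs_less_iff using x(1,2) by simp
    show "10 * (9 + 3 * x + x\<^sup>2)\<^sup>2 = 91 * (3 + x)\<^sup>2" using x(3) by (simp add: f_def)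
  qed
qed

theorem theorem1p7:
  shows "\<exists>r0 r1 :: real.
      (r0 \<in> {0<..<1/3} \<and> eq_r0 r0 \<and> (\<forall>x\<in>{0<..<1/3}. eq_r0 x \<longrightarrow> x = r0)) \<and>
      (r1 \<in> {0<..<1/3} \<and> eq_r1 r1 \<and> (\<forall>x\<in>{0<..<1/3}. eq_r1 x \<longrightarrow> x = r1)) \<and>
      \<bar>r0 - 0.1622776602\<bar> < 1 / (2 * 10 ^ 10) \<and>
      \<bar>r1 - 0.2317626315\<bar> < 1 / (2 * 10 ^ 10) \<and>
      (\<forall>r P n I. (r = r0 \<or> r = r1) \<and> self_similar_measure r P \<and> n \<ge> 3 \<and> admissible n I
         \<longrightarrow> optimal_n_means P n (gamma_set r P n I))"
proof -
  define r0 where "r0 = sqrt 10 - 3"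
  have "3.16227766016 < sqrt 10" "sqrt 10 < 3.16227766017"
    by (rule real_less_rsqrt, simp add: power_divide) (rule real_less_lsqrt, simp_all add: power_divide)
  then have r0: "\<bar>r0 - 0.1622776602\<bar> < 1 / (2 * 10 ^ 10)" "0.16227766 < r0" "r0 < 0.16227767"
    unfolding r0_def abs_less_iff by simp_all
  have r0_eq: "(3 + r0)\<^sup>2 = 10" by (simp add: r0_def)
  obtain r1 :: real where r1: "\<bar>r1 - 0.2317626315\<bar> < 1 / (2 * 10 ^ 10)" "10 * (9 + 3 * r1 + r1\<^sup>2)\<^sup>2 = 91 * (3 + r1)\<^sup>2"
    using root_r1 .
  then have r1_bounds: "23176263/100000000 \<le> r1" "r1 \<le> 2897033/12500000" unfolding abs_less_iff by simp_all
  have r1_unique: "x = r1" if x: "0 < x" "10 * (9 + 3 * x + x\<^sup>2)\<^sup>2 = 91 * (3 + x)\<^sup>2" for x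
  proof -
    have q: "((9 + 3 * y + y\<^sup>2) / (3 + y))\<^sup>2 = 91/10" if "0 < y" "10 * (9 + 3 * y + y\<^sup>2)\<^sup>2 = 91 * (3 + y)\<^sup>2" for y :: real
      using that by (simp add: power_divide field_simps)
    show ?thesis
      using q[OF x] q[OF _ r1(2)] quotient_strict_mono[of x r1] quotient_strict_mono[of r1 x] x(1) r1_bounds
      by (cases x r1 rule: linorder_cases) auto
  qed
  have crit: "critical r0" "critical r1"
    using r0 r0_eq r1 r1_bounds by (auto simp: critical_def)
  have "optimal_n_means P n (gamma_set r P n I)"
    if "r = r0 \<or> r = r1" "self_similar_measure r P" "n \<ge> 3" "admissible n I" for r P n I
  proof -
    have "critical_self_similar r P"
      using that(1,2) crit r0 r1_bounds by unfold_locales auto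
    then show ?thesis using that(3,4) by (rule critical_self_similar.gamma_set_optimal)
  qed
  moreover have "\<forall>x\<in>{0<..<1/3}. eq_r0 x \<longrightarrow> x = r0" "eq_r0 r0"
    using eq_r0_iff r0 by (auto simp: r0_def)
  moreover have "\<forall>x\<in>{0<..<1/3}. eq_r1 x \<longrightarrow> x = r1" "eq_r1 r1"
    using eq_r1_iff r1_unique r1(2) r1_bounds by auto
  ultimately show ?thesis
    using r0 r1 r1_bounds by (intro exI[of _ r0] exI[of _ r1]) auto
qed

end
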